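(* Let $(\mathcal W\cup\mathcal W',\mathcal Y\cup\mathcal Y')$ be an $m$-triangular labyrinth patterns system and let $\pi$ be the unique element of $\mathcal P=\{\{1,2\},\{1,3\},\{2,3\}\}$ such that the system is not $\pi$-blocked (i.e., assume that there is exactly one such $\pi$). Then the arcs $a^{w}_{\pi}$ and $a^{y}_{\pi}$ have finite length, while $a^{w}_{\pi'}$ and $a^{y}_{\pi'}$ have infinite length for $\pi'\in\mathcal P\setminus\{\pi\}$.
   Context: **Triangles.** Let $H=\{(\alpha_1,\alpha_2,\alpha_3)\in[0,1]^3:\alpha_1+\alpha_2+\alpha_3=1\}$, $\mathbb N=\{0,1,2,\dots\}$, $\mathbf P_1=(0,0)$, $\mathbf P_2=(1,0)$, $\mathbf P_3=(1/2,\sqrt3/2)$. $\Delta(\mathbf A_1,\mathbf A_2,\mathbf A_3)$ denotes the full closed triangle with (ordered) vertices $\mathbf A_1,\mathbf A_2,\mathbf A_3$, and $T_1=\Delta(\mathbf P_1,\mathbf P_2,\mathbf P_3)$. For $\Delta=\Delta(\mathbf A_1,\mathbf A_2,\mathbf A_3)\subset T_1$ let $P_\Delta:T_1\to T_1$, $\sum\alpha_i\mathbf P_i\mapsto\sum\alpha_i\mathbf A_i$ for $(\alpha_1,\alpha_2,\alpha_3)\in H$. For $m\ge2$ and $(k_1,k_2,k_3)\in\mathbb Z^3$, $T_m(k_1,k_2,k_3)$ is the triangle with ordered vertices $\mathbf A_i=\frac1m\big(k_1\mathbf P_1+k_2\mathbf P_2+k_3\mathbf P_3+\mathbf P_i\big)$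 and $T'_m(k_1,k_2,k_3)$ is the triangle with ordered vertices $\mathbf A_i=\frac1m\big(k_1\mathbf P_1+k_2\mathbf P_2+k_3\mathbf P_3+\mathbf P_1+\mathbf P_2+\mathbf P_3-\mathbf P_i\big)$, $i=1,2,3$. Put $\mathcal T_m=\{T_m(k_1,k_2,k_3):k_i\in\mathbb N,\ k_1+k_2+k_3=m-1\}$ and $\mathcal T'_m=\{T'_m(k_1,k_2,k_3):k_i\in\mathbb N,\ k_1+k_2+k_3=m-2\}$. $T_m(k_1,k_2,k_3)$ and $T'_m(k'_1,k'_2,k'_3)$ are $j$-neighbours if $k_j=k'_j+1$ and $k_i=k'_i$ for $i\ne j$ (they then share a side). For $i\in\{1,2,3\}$ and $K\in\{0,\dots,m-1\}$, the set of all $T_m(k_1,k_2,k_3)\in\mathcal T_m$ and $T'_m(k_1,k_2,k_3)\in\mathcal T'_m$ with $k_i=K$ is called a strip of type $i$. **Patterns systems.** An $m$-triangular patterns system is a pair $(\mathcal W\cup\mathcal W',\mathcal Y\cup\mathcal Y')$ with $\mathcal W,\mathcal Y\subset\mathcal T_m$ and $\mathcal W',\mathcal Y'\subset\mathcal T'_m$. Put $\mathcal W_1=\mathcal W$, $\mathcal W'_1=\mathcal W'$, $\mathcal Y_1=\mathcal Y$, $\mathcal Y'_1=\mathcal Y'$, and for $n\ge2$ $\mathcal W_n=\{P_{U}(V):U\in\mathcal W_{n-1},V\in\mathcal W_1\}\cup\{P_{U}(V):U\in\mathcal W'_{n-1},V\in\mathcal Y'_1\}$, $\mathcal W'_n=\{P_{U}(V):U\in\mathcal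 W_{n-1},V\in\mathcal W'_1\}\cup\{P_{U}(V):U\in\mathcal W'_{n-1},V\in\mathcal Y_1\}$, $\mathcal Y_n=\{P_{U}(V):U\in\mathcal Y_{n-1},V\in\mathcal Y_1\}\cup\{P_{U}(V):U\in\mathcal Y'_{n-1},V\in\mathcal W'_1\}$, $\mathcal Y'_n=\{P_{U}(V):U\in\mathcal Y_{n-1},V\in\mathcal Y'_1\}\cup\{P_{U}(V):U\in\mathcal Y'_{n-1},V\in\mathcal W_1\}$. Then $\mathcal W_n,\mathcal Y_n\subset\mathcal T_{m^n}$, $\mathcal W'_n,\mathcal Y'_n\subset\mathcal T'_{m^n}$. $\mathcal G(\mathcal W_n\cup\mathcal W'_n)$ is the undirected graph with vertex set $\mathcal W_n\cup\mathcal W'_n$ in which two vertices are joined by an edge labelled $j$ iff they are $j$-neighbours; $\mathcal G(\mathcal Y_n\cup\mathcal Y'_n)$ is defined analogously. **Labyrinth patterns systems.** The system is an $m$-triangular labyrinth patterns system if: (1) (tree property) $\mathcal G(\mathcal W\cup\mathcal W')$ and $\mathcal G(\mathcal Y\cup\mathcal Y')$ are trees; (2) (exits property) there is exactly one triple $(k_1,k_2,k_3)$ of integers in $\{0,\dots,m-1\}$ with $T_m(0,k_1,m-1-k_1)\in\mathcal W$, $T_m(0,m-1-k_1,k_1)\in\mathcal Y$, $T_m(k_2,0,m-1-k_2)\in\mathcal W$, $T_m(m-1-k_2,0,k_2)\in\mathcal Y$, $T_m(k_3,m-1-k_3,0)\in\mathcal W$, $T_m(m-1-k_3,k_3,0)\in\mathcal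 Y$; (3) (corners property) the sets $\mathcal C(\mathcal W)$, $\mathcal C(\mathcal Y)$ of elements of $\mathcal W$, resp. $\mathcal Y$, that contain one of $\mathbf P_1,\mathbf P_2,\mathbf P_3$ are disjoint and each has at most one element. The exits of the patterns are $e^w_1=T_m(0,k_1,m-1-k_1)$, $e^w_2=T_m(k_2,0,m-1-k_2)$, $e^w_3=T_m(k_3,m-1-k_3,0)$ and $e^y_1=T_m(0,m-1-k_1,k_1)$, $e^y_2=T_m(m-1-k_2,0,k_2)$, $e^y_3=T_m(m-1-k_3,k_3,0)$. For each $n\ge1$ the pair $(\mathcal W_n\cup\mathcal W'_n,\mathcal Y_n\cup\mathcal Y'_n)$ is an $m^n$-triangular labyrinth patterns system; its exits are denoted $e^w_i(n)$, $e^y_i(n)$. **Fractals and arcs.** $L^{w}_n$ (resp. $L^{y}_n$) is the union of all triangles in $\mathcal W_n\cup\mathcal W'_n$ (resp. $\mathcal Y_n\cup\mathcal Y'_n$); $L^{w}_\infty=\bigcap_{n\ge1}L^{w}_n$ and $L^{y}_\infty=\bigcap_{n\ge1}L^{y}_n$ are the white and yellow triangular labyrinth fractals. They are dendrites, so any two distinct points are joined by a unique arc inside the fractal. The exits of the fractals are the points $\mathbf E^w_i,\mathbf E^y_i$ with $\{\mathbf E^w_i\}=\bigcap_{n\ge1}e^w_i(n)$, $\{\mathbf E^y_i\}=\bigcap_{n\ge1}e^y_i(n)$, $i=1,2,3$. For $\{i,j\}\in\mathcal P$, $a^w_{\{i,j\}}$ is the arc in $L^w_\infty$ connecting $\mathbf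 E^w_i$ and $\mathbf E^w_j$, and $a^y_{\{i,j\}}$ is the arc in $L^y_\infty$ connecting $\mathbf E^y_i$ and $\mathbf E^y_j$. The length of an arc is its one-dimensional (Lebesgue) measure. **Blocked.** For $\{i,j\}\in\mathcal P$ the white (yellow) path of type $\{i,j\}$ is the unique path in the tree $\mathcal G(\mathcal W\cup\mathcal W')$ (resp. $\mathcal G(\mathcal Y\cup\mathcal Y')$) from $e^w_i$ to $e^w_j$ (resp. $e^y_i$ to $e^y_j$). With $\{k\}=\{1,2,3\}\setminus\{i,j\}$, this path is blocked if it contains two triangles that are not contained in the same strip of type $k$. The system is $\pi$-blocked ($\pi\in\mathcal P$) if the white or the yellow path of type $\pi$ is blocked. *)

theory Defs
  imports "HOL-Analysis.Analysis"
begin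

section \<open>Triangles\<close>

type_synonym point = "real \<times> real"

text \<open>A triangle is given by its three ordered vertices \<open>A $ 1\<close>, \<open>A $ 2\<close>, \<open>A $ 3\<close>
  (in the index type \<open>3\<close> the numeral \<open>3\<close> equals \<open>0\<close>). The order matters, since \<open>tri_map\<close> depends
  on it; the triangle as a closed subset of the plane is \<open>region A\<close>.\<close>

type_synonym triangle = "point ^ 3"

definition P :: triangle where
  "P = vector [(0, 0), (1, 0), (1/2, sqrt 3 / 2)]"

definition region :: "triangle \<Rightarrow> point set" where
  "region A = convex hull {A $ 1, A $ 2, A $ 3}"

definition H :: "(real ^ 3) set" where
  "H = {\<alpha>. (\<forall>i. \<alpha> $ i \<in> {0..1}) \<and> \<alpha> $ 1 + \<alpha> $ 2 + \<alpha> $ 3 = 1}"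

definition tri_map :: "triangle \<Rightarrow> point \<Rightarrow> point" where
  "tri_map A x = (THE y. \<exists>\<alpha>\<in>H. x = (\<Sum>i\<in>UNIV. \<alpha> $ i *\<^sub>R P $ i) \<and> y = (\<Sum>i\<in>UNIV. \<alpha> $ i *\<^sub>R A $ i))"

text \<open>The triangle \<open>P\<^sub>U(V)\<close>; its vertices are ordered as those of \<open>V\<close>.\<close>

definition tri_image :: "triangle \<Rightarrow> triangle \<Rightarrow> triangle" where
  "tri_image U V = (\<chi> i. tri_map U (V $ i))"

definition T :: "nat \<Rightarrow> int ^ 3 \<Rightarrow> triangle" where
  "T m k = (\<chi> i. (1 / real m) *\<^sub>R ((\<Sum>j\<in>UNIV. real_of_int (k $ j) *\<^sub>R P $ j) + P $ i))"

definition T' :: "nat \<Rightarrow> int ^ 3 \<Rightarrow> triangle" where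
  "T' m k = (\<chi> i. (1 / real m) *\<^sub>R
     ((\<Sum>j\<in>UNIV. real_of_int (k $ j) *\<^sub>R P $ j) + (P $ 1 + P $ 2 + P $ 3) - P $ i))"

definition idx :: "int \<Rightarrow> (int ^ 3) set" where
  "idx s = {k. (\<forall>i. 0 \<le> k $ i) \<and> k $ 1 + k $ 2 + k $ 3 = s}"

definition TT :: "nat \<Rightarrow> triangle set" where
  "TT m = T m ` idx (int m - 1)"

definition TT' :: "nat \<Rightarrow> triangle set" where
  "TT' m = T' m ` idx (int m - 2)"

text \<open>The index sums are part of the definition: since \<open>P $ 1 = 0\<close>, the triangle \<open>T m k\<close> determines
  \<open>k\<close> only once the sum of the \<open>k $ i\<close> is prescribed.\<close>

definition neighbours :: "nat \<Rightarrow> 3 \<Rightarrow> triangle \<Rightarrow> triangle \<Rightarrow> bool" where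
  "neighbours m j U V \<longleftrightarrow> (\<exists>k\<in>idx (int m - 1). \<exists>k'\<in>idx (int m - 2).
     U = T m k \<and> V = T' m k' \<and> k $ j = k' $ j + 1 \<and> (\<forall>i. i \<noteq> j \<longrightarrow> k $ i = k' $ i))"

definition strip :: "nat \<Rightarrow> 3 \<Rightarrow> int \<Rightarrow> triangle set" where
  "strip m i K = T m ` {k \<in> idx (int m - 1). k $ i = K} \<union> T' m ` {k \<in> idx (int m - 2). k $ i = K}"

section \<open>The graph of a pattern\<close>

definition edge :: "nat \<Rightarrow> triangle set \<Rightarrow> 3 \<Rightarrow> triangle \<Rightarrow> triangle \<Rightarrow> bool" where
  "edge m V j A B \<longleftrightarrow> A \<in> V \<and> B \<in> V \<and> (neighbours m j A B \<or> neighbours m j B A)"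

text \<open>A path is given by the list of its pairwise distinct vertices.\<close>

definition graph_path :: "nat \<Rightarrow> triangle set \<Rightarrow> triangle list \<Rightarrow> bool" where
  "graph_path m V xs \<longleftrightarrow> xs \<noteq> [] \<and> set xs \<subseteq> V \<and> distinct xs \<and>
     (\<forall>i. Suc i < length xs \<longrightarrow> (\<exists>j. edge m V j (xs ! i) (xs ! Suc i)))"

definition path_from_to :: "nat \<Rightarrow> triangle set \<Rightarrow> triangle \<Rightarrow> triangle \<Rightarrow> triangle list \<Rightarrow> bool" where
  "path_from_to m V A B xs \<longleftrightarrow> graph_path m V xs \<and> hd xs = A \<and> last xs = B"

definition graph_cycle :: "nat \<Rightarrow> triangle set \<Rightarrow> triangle list \<Rightarrow> bool" where
  "graph_cycle m V xs \<longleftrightarrow> graph_path m V xs \<and> 3 \<le> length xs \<and> (\<exists>j. edge m V j (last xs) (hd xs))"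

definition graph_tree :: "nat \<Rightarrow> triangle set \<Rightarrow> bool" where
  "graph_tree m V \<longleftrightarrow> V \<noteq> {} \<and> (\<forall>A\<in>V. \<forall>B\<in>V. \<exists>xs. path_from_to m V A B xs) \<and>
     \<not> (\<exists>xs. graph_cycle m V xs)"

section \<open>Patterns systems\<close>

text \<open>The four sets of a patterns system are kept separate; no information is added to
  the pair of unions, because a triangle \<open>T\<close> and a triangle \<open>T'\<close> differ by a half turn.\<close>

record pattern_sets =
  white :: "triangle set"
  white' :: "triangle set"
  yellow :: "triangle set"
  yellow' :: "triangle set"

definition patterns_system :: "nat \<Rightarrow> pattern_sets \<Rightarrow> bool" where
  "patterns_system m S \<longleftrightarrow> 2 \<le> m \<and> white S \<subseteq> TT m \<and> yellow S \<subseteq> TT m \<and>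
     white' S \<subseteq> TT' m \<and> yellow' S \<subseteq> TT' m"

definition images :: "triangle set \<Rightarrow> triangle set \<Rightarrow> triangle set" where
  "images A B = {tri_image U V | U V. U \<in> A \<and> V \<in> B}"

text \<open>Levels are numbered from \<open>1\<close>; level \<open>0\<close> is left unspecified and is never used.\<close>

fun level :: "pattern_sets \<Rightarrow> nat \<Rightarrow> pattern_sets" where
  "level S (Suc 0) = S"
| "level S (Suc (Suc n)) = (let R = level S (Suc n) in
     \<lparr> white = images (white R) (white S) \<union> images (white' R) (yellow' S),
       white' = images (white R) (white' S) \<union> images (white' R) (yellow S),
       yellow = images (yellow R) (yellow S) \<union> images (yellow' R) (white' S),
       yellow' = images (yellow R) (yellow' S) \<union> images (yellow' R) (white S) \<rparr>)"

definition white_all :: "pattern_sets \<Rightarrow> triangle set" where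
  "white_all S = white S \<union> white' S"

definition yellow_all :: "pattern_sets \<Rightarrow> triangle set" where
  "yellow_all S = yellow S \<union> yellow' S"

section \<open>Labyrinth patterns systems\<close>

definition white_exit_at :: "nat \<Rightarrow> int ^ 3 \<Rightarrow> 3 \<Rightarrow> triangle" where
  "white_exit_at m k i =
     (if i = 1 then T m (vector [0, k $ 1, int m - 1 - k $ 1])
      else if i = 2 then T m (vector [k $ 2, 0, int m - 1 - k $ 2])
      else T m (vector [k $ 3, int m - 1 - k $ 3, 0]))"

definition yellow_exit_at :: "nat \<Rightarrow> int ^ 3 \<Rightarrow> 3 \<Rightarrow> triangle" where
  "yellow_exit_at m k i =
     (if i = 1 then T m (vector [0, int m - 1 - k $ 1, k $ 1])
      else if i = 2 then T m (vector [int m - 1 - k $ 2, 0, k $ 2])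
      else T m (vector [int m - 1 - k $ 3, k $ 3, 0]))"

definition exit_triple :: "nat \<Rightarrow> pattern_sets \<Rightarrow> int ^ 3 \<Rightarrow> bool" where
  "exit_triple m S k \<longleftrightarrow> (\<forall>i. k $ i \<in> {0..int m - 1} \<and>
     white_exit_at m k i \<in> white S \<and> yellow_exit_at m k i \<in> yellow S)"

definition corners :: "triangle set \<Rightarrow> triangle set" where
  "corners A = {U \<in> A. \<exists>i. P $ i \<in> region U}"

definition labyrinth_patterns_system :: "nat \<Rightarrow> pattern_sets \<Rightarrow> bool" where
  "labyrinth_patterns_system m S \<longleftrightarrow> patterns_system m S \<and>
     graph_tree m (white_all S) \<and> graph_tree m (yellow_all S) \<and>
     (\<exists>!k. exit_triple m S k) \<and>
     corners (white S) \<inter> corners (yellow S) = {} \<and>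
     (\<forall>U\<in>corners (white S). \<forall>V\<in>corners (white S). U = V) \<and>
     (\<forall>U\<in>corners (yellow S). \<forall>V\<in>corners (yellow S). U = V)"

definition white_exit :: "nat \<Rightarrow> pattern_sets \<Rightarrow> 3 \<Rightarrow> triangle" where
  "white_exit m S i = white_exit_at m (THE k. exit_triple m S k) i"

definition yellow_exit :: "nat \<Rightarrow> pattern_sets \<Rightarrow> 3 \<Rightarrow> triangle" where
  "yellow_exit m S i = yellow_exit_at m (THE k. exit_triple m S k) i"

section \<open>Fractals and arcs\<close>

definition white_fractal :: "pattern_sets \<Rightarrow> point set" where
  "white_fractal S = (\<Inter>n\<in>{1..}. \<Union> (region ` white_all (level S n)))"

definition yellow_fractal :: "pattern_sets \<Rightarrow> point set" where
  "yellow_fractal S = (\<Inter>n\<in>{1..}. \<Union> (region ` yellow_all (level S n)))"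

definition white_exit_point :: "nat \<Rightarrow> pattern_sets \<Rightarrow> 3 \<Rightarrow> point" where
  "white_exit_point m S i = (THE x. {x} = (\<Inter>n\<in>{1..}. region (white_exit (m ^ n) (level S n) i)))"

definition yellow_exit_point :: "nat \<Rightarrow> pattern_sets \<Rightarrow> 3 \<Rightarrow> point" where
  "yellow_exit_point m S i = (THE x. {x} = (\<Inter>n\<in>{1..}. region (yellow_exit (m ^ n) (level S n) i)))"

definition arc_between :: "point set \<Rightarrow> point \<Rightarrow> point \<Rightarrow> point set" where
  "arc_between L x y = (THE A. A \<subseteq> L \<and>
     (\<exists>g. arc g \<and> pathstart g = x \<and> pathfinish g = y \<and> path_image g = A))"

definition white_arc :: "nat \<Rightarrow> pattern_sets \<Rightarrow> 3 \<Rightarrow> 3 \<Rightarrow> point set" where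
  "white_arc m S i j =
     arc_between (white_fractal S) (white_exit_point m S i) (white_exit_point m S j)"

definition yellow_arc :: "nat \<Rightarrow> pattern_sets \<Rightarrow> 3 \<Rightarrow> 3 \<Rightarrow> point set" where
  "yellow_arc m S i j =
     arc_between (yellow_fractal S) (yellow_exit_point m S i) (yellow_exit_point m S j)"

text \<open>The one-dimensional measure of a subset of the plane is its one-dimensional Hausdorff
  (outer) measure, normalised so that a segment has its usual length. Boundedness is required
  because \<open>diameter\<close> is only meaningful for bounded sets.\<close>

definition hausdorff1_delta :: "real \<Rightarrow> point set \<Rightarrow> ennreal" where
  "hausdorff1_delta \<delta> A =
     (INF U\<in>{U :: nat \<Rightarrow> point set. A \<subseteq> (\<Union>n. U n) \<and> (\<forall>n. bounded (U n) \<and> diameter (U n) \<le> \<delta>)}.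
        \<Sum>n. ennreal (diameter (U n)))"

definition arc_length :: "point set \<Rightarrow> ennreal" where
  "arc_length A = (SUP \<delta>\<in>{0<..}. hausdorff1_delta \<delta> A)"

section \<open>Blocked patterns systems\<close>

definition PP :: "3 set set" where
  "PP = {{1, 2}, {1, 3}, {2, 3}}"

definition white_path :: "nat \<Rightarrow> pattern_sets \<Rightarrow> 3 \<Rightarrow> 3 \<Rightarrow> triangle list" where
  "white_path m S i j =
     (THE xs. path_from_to m (white_all S) (white_exit m S i) (white_exit m S j) xs)"

definition yellow_path :: "nat \<Rightarrow> pattern_sets \<Rightarrow> 3 \<Rightarrow> 3 \<Rightarrow> triangle list" where
  "yellow_path m S i j =
     (THE xs. path_from_to m (yellow_all S) (yellow_exit m S i) (yellow_exit m S j) xs)"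

definition path_blocked :: "nat \<Rightarrow> 3 \<Rightarrow> triangle list \<Rightarrow> bool" where
  "path_blocked m k xs \<longleftrightarrow> (\<exists>U\<in>set xs. \<exists>V\<in>set xs.
     \<not> (\<exists>K\<in>{0..int m - 1}. U \<in> strip m k K \<and> V \<in> strip m k K))"

definition blocked :: "nat \<Rightarrow> pattern_sets \<Rightarrow> 3 set \<Rightarrow> bool" where
  "blocked m S \<pi> \<longleftrightarrow> (\<exists>i j k. \<pi> = {i, j} \<and> {k} = UNIV - {i, j} \<and>
     (path_blocked m k (white_path m S i j) \<or> path_blocked m k (yellow_path m S i j)))"

end

theory Submission
  imports Defs
begin

text \<open>A pattern is glued from copies of itself (in the triangles \<open>T\<close>) and half turns of the pattern of the
  other colour (in the triangles \<open>T'\<close>), so both fractals solve a graph-directed system of contractions of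
  ratio \<open>1 / m\<close>. By the corners property two pieces of a fractal meet at most in one point, which is
  the common exit point of two neighbouring cells. Collapsing the branches of the tree at a cell
  is therefore continuous, and a connected subset of the fractal containing two exit points contains the whole
  chain of pieces along the path between them: this chain is the arc.

  Let \<open>k\<close> be the label outside of \<open>\<pi>\<close>. The straight paths of type \<open>\<pi>\<close> lie in the strips \<open>K\<close> (white) and
  \<open>m - 1 - K\<close> (yellow) of type \<open>k\<close>, so their substitution matrix divided by \<open>m\<close> has column sums \<open>1\<close>: the total
  size of the \<open>n\<close>-th covers stays bounded. The paths of the two other types cross all strips below;
  the crossings alone again give a matrix with column sums \<open>1\<close>, and since the three paths form a tripod whose
  \<open>\<pi>\<close>-leg is not trivial and both types are blocked, some further piece always occurs. Thus no finite positive
  length is compatible with the self-similarity.\<close>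

section \<open>Barycentric coordinates\<close>

text \<open>Both estimates are critical: the number of pieces grows exactly like the reciprocal
  \<open>m\<close> of the contraction ratio, so growth rates alone cannot separate finite from
  infinite length. The colours cannot be treated separately either: a straight path of colour
  \<open>c\<close> has \<open>h c + 1\<close> cells \<open>T\<close> and \<open>h c\<close> cells
  \<open>T'\<close>, and \<open>2 * h c + 1\<close> need not equal \<open>m\<close>. What helps is
  the exits property: it puts the white and yellow exits of each side in mirror positions, so
  \<open>h True + h False = m - 1\<close>, and the factor \<open>m\<close> appears once the two
  colours are added. For infinite length the same count is an inequality for the least lengths
  \<open>\<mu> c\<close> of the two blocked types. After adding the colours its two sides coincide,
  so every cell of a minimal path must be counted and must itself be minimal. This rigidity makes
  the minimal paths alternate between two sides only, hence stay in one strip for both colours,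
  against the assumption. The argument requires a length that is positive on every curve and
  superadditive over the cells; the value infinity is allowed.\<close>

lemma three_cases:
  fixes i j k l :: 3
  assumes "i \<noteq> j" "i \<noteq> k" "j \<noteq> k"
  shows "l = i \<or> l = j \<or> l = k"
  using assms exhaust_3[of i] exhaust_3[of j] exhaust_3[of k] exhaust_3[of l] by auto

lemma sum_three:
  fixes i j k :: 3
  assumes "i \<noteq> j" "i \<noteq> k" "j \<noteq> k"
  shows "sum g UNIV = g i + (g j + (g k :: 'a :: comm_monoid_add))"
proof -
  have "(UNIV :: 3 set) = {i, j, k}" using three_cases[OF assms] by auto
  then have "sum g UNIV = sum g {i, j, k}" by (rule arg_cong)
  with assms show ?thesis by simp
qed

lemma third_label:
  fixes i j :: 3
  obtains k where "k \<noteq> i" "k \<noteq> j"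
proof -
  have "(1::3) \<noteq> 2" "(1::3) \<noteq> 3" "(2::3) \<noteq> 3" by simp_all
  then show ?thesis using that[of 1] that[of 2] that[of 3] by metis
qed

text \<open>The barycentric coordinates with respect to \<open>P\<close>, given by explicit affine
  formulas that make sense on the whole plane.\<close>

definition bary :: "3 \<Rightarrow> point \<Rightarrow> real" where
  "bary i x = (if i = 1 then 1 - fst x - snd x / sqrt 3
     else if i = 2 then fst x - snd x / sqrt 3 else 2 * snd x / sqrt 3)"

definition base :: "point set" where
  "base = {x. \<forall>i. 0 \<le> bary i x}"

text \<open>The affine extension of \<open>tri_map U\<close> to the plane. Being total, it is
  continuous everywhere and composes without membership conditions on its argument.\<close>

definition cell_map :: "triangle \<Rightarrow> point \<Rightarrow> point" where
  "cell_map U x = (\<Sum>i\<in>UNIV. bary i x *\<^sub>R U $ i)"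

lemma P_simps: "P $ 1 = (0, 0)" "P $ 2 = (1, 0)" "P $ 3 = (1/2, sqrt 3 / 2)"
  by (simp_all add: P_def)

lemma sum_bary: "(\<Sum>i\<in>UNIV. bary i x) = 1"
  by (simp add: sum_3 bary_def)

lemma bary_expand: "(\<Sum>i\<in>UNIV. bary i x *\<^sub>R P $ i) = x"
  by (cases x) (simp add: sum_3 bary_def P_simps algebra_simps)

lemma bary_eqI: "(\<And>i. bary i x = bary i y) \<Longrightarrow> x = y"
  by (metis (no_types, lifting) bary_expand sum.cong)

lemma bary_P: "bary i (P $ j) = (if i = j then 1 else 0)"
  using exhaust_3[of i] exhaust_3[of j] by (auto simp: bary_def P_simps)

lemma bary_convex:
  assumes "sum a UNIV = 1"
  shows "bary i (\<Sum>j\<in>UNIV. a j *\<^sub>R x j) = (\<Sum>j\<in>(UNIV :: 3 set). a j * bary i (x j))"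
proof -
  have *: "a 1 = 1 - a 2 - a 3" using assms by (simp add: sum_3)
  show ?thesis unfolding sum_3 *
    by (simp add: bary_def divide_inverse algebra_simps)
qed

lemma bary_le_1: "x \<in> base \<Longrightarrow> bary i x \<le> 1"
  using sum_bary[of x] member_le_sum[of i UNIV "\<lambda>i. bary i x"] by (auto simp: base_def)

lemma continuous_bary [continuous_intros]: "continuous_on A (bary i)"
  unfolding bary_def by (cases "i = 1"; cases "i = 2") (auto intro!: continuous_intros)

lemma bary_Pcomb:
  assumes "sum a UNIV = 1"
  shows "bary i (\<Sum>j\<in>UNIV. a j *\<^sub>R P $ j) = a i"
  using bary_convex[OF assms, of i "\<lambda>j. P $ j"]
  by (simp add: bary_P if_distrib cong: if_cong)

lemma base_P: "P $ i \<in> base"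
  by (simp add: base_def bary_P)

lemma base_eq_convex_hull: "base = convex hull {P $ 1, P $ 2, P $ 3}"
proof (intro set_eqI iffI)
  fix x assume "x \<in> base"
  then show "x \<in> convex hull {P $ 1, P $ 2, P $ 3}"
    unfolding convex_hull_3 using bary_expand[of x] sum_bary[of x]
    by (intro CollectI exI[of _ "bary 1 x"] exI[of _ "bary 2 x"] exI[of _ "bary 3 x"])
      (simp add: base_def sum_3)
next
  fix x assume "x \<in> convex hull {P $ 1, P $ 2, P $ 3}"
  then obtain u v w where *: "0 \<le> u" "0 \<le> v" "0 \<le> w" "u + v + w = 1"
    "x = u *\<^sub>R P $ 1 + v *\<^sub>R P $ 2 + w *\<^sub>R P $ 3"
    unfolding convex_hull_3 by blast
  define a where "a i = (if i = 1 then u else if i = 2 then v else w)" for i :: 3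
  have a: "a 1 = u" "a 2 = v" "a 3 = w" by (simp_all add: a_def)
  have "x = (\<Sum>j\<in>UNIV. a j *\<^sub>R P $ j)" "sum a UNIV = 1" using * by (simp_all add: sum_3 a)
  then have "bary i x = a i" for i using bary_Pcomb by blast
  then show "x \<in> base" using * by (auto simp: base_def a_def)
qed

lemma region_eq: "region U = cell_map U ` base"
proof (intro set_eqI iffI)
  fix x assume "x \<in> cell_map U ` base"
  then obtain y where "y \<in> base" "x = cell_map U y" by auto
  then show "x \<in> region U"
    unfolding region_def convex_hull_3 cell_map_def using sum_bary[of y]
    by (intro CollectI exI[of _ "bary 1 y"] exI[of _ "bary 2 y"] exI[of _ "bary 3 y"])
      (simp add: base_def sum_3)
next
  fix x assume "x \<in> region U"
  then obtain u v w where *: "0 \<le> u" "0 \<le> v" "0 \<le> w" "u + v + w = 1"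
    "x = u *\<^sub>R U $ 1 + v *\<^sub>R U $ 2 + w *\<^sub>R U $ 3"
    unfolding region_def convex_hull_3 by blast
  define a where "a i = (if i = 1 then u else if i = 2 then v else w)" for i :: 3
  have a: "a 1 = u" "a 2 = v" "a 3 = w" by (simp_all add: a_def)
  define y where "y = (\<Sum>j\<in>UNIV. a j *\<^sub>R P $ j)"
  have "sum a UNIV = 1" using * by (simp_all add: sum_3 a)
  then have b: "bary i y = a i" for i using bary_Pcomb y_def by blast
  then have "y \<in> base" using * by (auto simp: base_def a_def)
  moreover have "x = cell_map U y" unfolding cell_map_def b using * by (simp add: sum_3 a)
  ultimately show "x \<in> cell_map U ` base" by blast
qed

lemma tri_map_eq: "x \<in> base \<Longrightarrow> tri_map U x = cell_map U x"
  unfolding tri_map_def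
proof (rule the_equality)
  assume x: "x \<in> base"
  define \<alpha> :: "real ^ 3" where "\<alpha> = (\<chi> i. bary i x)"
  have "\<alpha> \<in> H" using x sum_bary[of x] bary_le_1[OF x] by (simp add: H_def \<alpha>_def base_def sum_3)
  then show "\<exists>\<alpha>\<in>H. x = (\<Sum>i\<in>UNIV. \<alpha> $ i *\<^sub>R P $ i) \<and> cell_map U x = (\<Sum>i\<in>UNIV. \<alpha> $ i *\<^sub>R U $ i)"
    by (intro bexI[of _ \<alpha>]) (simp_all add: \<alpha>_def cell_map_def bary_expand)
next
  fix y assume "\<exists>\<alpha>\<in>H. x = (\<Sum>i\<in>UNIV. \<alpha> $ i *\<^sub>R P $ i) \<and> y = (\<Sum>i\<in>UNIV. \<alpha> $ i *\<^sub>R U $ i)"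
  then obtain \<alpha> where \<alpha>: "\<alpha> \<in> H" "x = (\<Sum>i\<in>UNIV. \<alpha> $ i *\<^sub>R P $ i)" "y = (\<Sum>i\<in>UNIV. \<alpha> $ i *\<^sub>R U $ i)"
    by blast
  then have "bary i x = \<alpha> $ i" for i using bary_Pcomb[of "\<lambda>i. \<alpha> $ i"] by (simp add: H_def sum_3)
  then show "y = cell_map U x" using \<alpha> by (simp add: cell_map_def)
qed

lemma compact_base: "compact base" and convex_base: "convex base"
  unfolding base_eq_convex_hull by (auto intro: finite_imp_compact_convex_hull convex_convex_hull)

text \<open>The diameter of a simplex is attained at two vertices, and the sides of this one have
  length 1.\<close>

lemma dist_base: assumes "x \<in> base" "y \<in> base" shows "dist x y \<le> 1"
proof -
  have *: "norm (p - q) \<le> 1" if "p \<in> {P $ 1, P $ 2, P $ 3}" "q \<in> {P $ 1, P $ 2, P $ 3}" for p q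
    using that unfolding P_simps by (elim insertE emptyE) (simp_all add: norm_Pair power_divide)
  obtain u v where "u \<in> {P $ 1, P $ 2, P $ 3}" "v \<in> {P $ 1, P $ 2, P $ 3}"
    and "\<forall>x\<in>base. \<forall>y\<in>base. norm (x - y) \<le> norm (u - v)"
    using simplex_extremal_le[of "{P $ 1, P $ 2, P $ 3}"] unfolding base_eq_convex_hull by blast
  with *[of u v] assms show ?thesis unfolding dist_norm by (meson order_trans)
qed

section \<open>The triangles \<open>T\<close> and \<open>T'\<close>\<close>

lemma idx_iff: "k \<in> idx s \<longleftrightarrow> (\<forall>i. 0 \<le> k $ i) \<and> (\<Sum>i\<in>UNIV. k $ i) = s"
  by (simp add: idx_def sum_3 add.assoc)

lemma idx_le: "k \<in> idx s \<Longrightarrow> k $ i \<le> s"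
  using member_le_sum[of i UNIV "\<lambda>i. k $ i"] by (auto simp: idx_iff)

lemma idx_sum_real: "k \<in> idx s \<Longrightarrow> (\<Sum>i\<in>UNIV. real_of_int (k $ i)) = of_int s"
  by (simp add: idx_iff flip: of_int_sum)

lemma cell_map_T:
  "cell_map (T m k) x = (1 / real m) *\<^sub>R ((\<Sum>j\<in>UNIV. real_of_int (k $ j) *\<^sub>R P $ j) + x)"
proof -
  have "cell_map (T m k) x = (\<Sum>i\<in>UNIV. (1 / real m) *\<^sub>R (bary i x *\<^sub>R (\<Sum>j\<in>UNIV. real_of_int (k $ j) *\<^sub>R P $ j) + bary i x *\<^sub>R P $ i))"
    unfolding cell_map_def T_def by (simp add: algebra_simps)
  also have "\<dots> = (1 / real m) *\<^sub>R ((\<Sum>i\<in>UNIV. bary i x) *\<^sub>R (\<Sum>j\<in>UNIV. real_of_int (k $ j) *\<^sub>R P $ j) + (\<Sum>i\<in>UNIV. bary i x *\<^sub>R P $ i))"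
    by (simp only: scaleR_sum_right[symmetric] scaleR_sum_left sum.distrib)
  finally show ?thesis by (simp add: sum_bary bary_expand)
qed

lemma cell_map_T':
  "cell_map (T' m k) x =
     (1 / real m) *\<^sub>R ((\<Sum>j\<in>UNIV. real_of_int (k $ j) *\<^sub>R P $ j) + (P $ 1 + P $ 2 + P $ 3) - x)"
proof -
  let ?Q = "(\<Sum>j\<in>UNIV. real_of_int (k $ j) *\<^sub>R P $ j) + (P $ 1 + P $ 2 + P $ 3)"
  have "cell_map (T' m k) x = (\<Sum>i\<in>UNIV. (1 / real m) *\<^sub>R (bary i x *\<^sub>R ?Q - bary i x *\<^sub>R P $ i))"
    unfolding cell_map_def T'_def by (simp add: algebra_simps)
  also have "\<dots> = (1 / real m) *\<^sub>R ((\<Sum>i\<in>UNIV. bary i x) *\<^sub>R ?Q - (\<Sum>i\<in>UNIV. bary i x *\<^sub>R P $ i))"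
    by (simp only: scaleR_sum_right[symmetric] scaleR_sum_left sum_subtractf)
  finally show ?thesis by (simp add: sum_bary bary_expand)
qed

text \<open>In base \<open>m\<close> the index \<open>k $ i\<close> is the leading digit of the
  coordinate and \<open>bary i x\<close> the remainder after it; all later computations with cells
  are digit arithmetic.\<close>

lemma bary_cell_map_T:
  assumes "k \<in> idx (int m - 1)" "0 < m"
  shows "bary i (cell_map (T m k) x) = (k $ i + bary i x) / m"
proof -
  define a where "a i = (k $ i + bary i x) / m" for i
  have "sum a UNIV = 1"
    using idx_sum_real[OF assms(1)] assms(2)
    by (simp add: a_def sum.distrib sum_bary flip: sum_divide_distrib)
  moreover have "cell_map (T m k) x = (\<Sum>j\<in>UNIV. a j *\<^sub>R P $ j)"
  proof -
    have "(\<Sum>j\<in>UNIV. a j *\<^sub>R P $ j) =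
      (1 / real m) *\<^sub>R (\<Sum>j\<in>UNIV. real_of_int (k $ j) *\<^sub>R P $ j + bary j x *\<^sub>R P $ j)"
      unfolding scaleR_sum_right a_def by (intro sum.cong refl) (simp add: algebra_simps divide_inverse)
    also have "\<dots> = cell_map (T m k) x"
      unfolding cell_map_T sum.distrib bary_expand by simp
    finally show ?thesis by simp
  qed
  ultimately show ?thesis using bary_Pcomb a_def by metis
qed

text \<open>The half turn complements the remainder: 1 minus \<open>bary i x\<close> follows the
  digit.\<close>

lemma bary_cell_map_T':
  assumes "k \<in> idx (int m - 2)" "0 < m"
  shows "bary i (cell_map (T' m k) x) = (k $ i + 1 - bary i x) / m"
proof -
  define a where "a i = (k $ i + 1 - bary i x) / m" for i
  have "sum a UNIV = 1"
    using idx_sum_real[OF assms(1)] assms(2)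
    by (simp add: a_def sum.distrib sum_subtractf sum_bary flip: sum_divide_distrib)
  moreover have "cell_map (T' m k) x = (\<Sum>j\<in>UNIV. a j *\<^sub>R P $ j)"
  proof -
    have "(\<Sum>j\<in>UNIV. a j *\<^sub>R P $ j) =
      (1 / real m) *\<^sub>R (\<Sum>j\<in>UNIV. real_of_int (k $ j) *\<^sub>R P $ j + P $ j - bary j x *\<^sub>R P $ j)"
      unfolding scaleR_sum_right a_def by (intro sum.cong refl) (simp add: algebra_simps divide_inverse)
    also have "\<dots> = cell_map (T' m k) x"
      unfolding cell_map_T' sum_subtractf sum.distrib bary_expand by (simp add: sum_3)
    finally show ?thesis by simp
  qed
  ultimately show ?thesis using bary_Pcomb a_def by metis
qed

lemma cell_map_P: "cell_map U (P $ i) = U $ i"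
  by (simp add: cell_map_def bary_P if_distrib cong: if_cong)
    (simp add: if_distribR cong: if_cong)

lemma continuous_cell_map: "continuous_on A (cell_map U)"
  unfolding cell_map_def by (intro continuous_intros)

lemma T_inj:
  assumes "T m k = T m k'" "k \<in> idx (int m - 1)" "k' \<in> idx (int m - 1)" "0 < m"
  shows "k = k'"
proof -
  have "real_of_int (k $ i) = k' $ i" for i
    using bary_cell_map_T[OF assms(2,4), of i "P $ 1"] bary_cell_map_T[OF assms(3,4), of i "P $ 1"] assms
    by (simp add: field_simps)
  then show ?thesis by (simp add: vec_eq_iff)
qed

lemma T'_inj:
  assumes "T' m k = T' m k'" "k \<in> idx (int m - 2)" "k' \<in> idx (int m - 2)" "0 < m"
  shows "k = k'"
proof -
  have "real_of_int (k $ i) = k' $ i" for i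
    using bary_cell_map_T'[OF assms(2,4), of i "P $ 1"] bary_cell_map_T'[OF assms(3,4), of i "P $ 1"] assms
    by (simp add: field_simps)
  then show ?thesis by (simp add: vec_eq_iff)
qed

text \<open>The first coordinate grows with that of the argument in \<open>T\<close> and falls in
  \<open>T'\<close>; the images of two vertices cannot match both ways.\<close>

lemma T_neq_T':
  assumes "k \<in> idx (int m - 1)" "k' \<in> idx (int m - 2)" "0 < m"
  shows "T m k \<noteq> T' m k'"
proof
  assume "T m k = T' m k'"
  then have "k $ 1 + bary 1 (P $ i) = k' $ 1 + 1 - bary 1 (P $ i)" for i
    using bary_cell_map_T[OF assms(1,3), of 1 "P $ i"] bary_cell_map_T'[OF assms(2,3), of 1 "P $ i"] assms(3)
    by (simp add: field_simps)
  from this[of 1] this[of 2] show False by (simp add: bary_P)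
qed

section \<open>One-dimensional Hausdorff measure\<close>

definition delta_cover :: "real \<Rightarrow> point set \<Rightarrow> (nat \<Rightarrow> point set) \<Rightarrow> bool" where
  "delta_cover \<delta> A U \<longleftrightarrow> A \<subseteq> (\<Union>n. U n) \<and> (\<forall>n. bounded (U n) \<and> diameter (U n) \<le> \<delta>)"

lemma hausdorff1_delta_le: "delta_cover \<delta> A U \<Longrightarrow> hausdorff1_delta \<delta> A \<le> (\<Sum>n. ennreal (diameter (U n)))"
  unfolding hausdorff1_delta_def delta_cover_def by (rule INF_lower) simp

lemma hausdorff1_delta_greatest:
  "(\<And>U. delta_cover \<delta> A U \<Longrightarrow> c \<le> (\<Sum>n. ennreal (diameter (U n)))) \<Longrightarrow> c \<le> hausdorff1_delta \<delta> A"
  unfolding hausdorff1_delta_def delta_cover_def by (rule INF_greatest) blast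

lemma hausdorff1_delta_antimono: "\<delta> \<le> \<delta>' \<Longrightarrow> hausdorff1_delta \<delta>' A \<le> hausdorff1_delta \<delta> A"
  by (intro hausdorff1_delta_greatest hausdorff1_delta_le)
    (auto simp: delta_cover_def intro: order_trans)

lemma hausdorff1_delta_mono: "A \<subseteq> B \<Longrightarrow> hausdorff1_delta \<delta> A \<le> hausdorff1_delta \<delta> B"
  by (intro hausdorff1_delta_greatest hausdorff1_delta_le) (auto simp: delta_cover_def)

lemma hausdorff1_delta_le_arc_length: "0 < \<delta> \<Longrightarrow> hausdorff1_delta \<delta> A \<le> arc_length A"
  unfolding arc_length_def by (rule SUP_upper) simp

lemma arc_length_mono: "A \<subseteq> B \<Longrightarrow> arc_length A \<le> arc_length B"
  unfolding arc_length_def by (intro SUP_mono) (use hausdorff1_delta_mono in blast)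

lemma hausdorff1_delta_lipschitz:
  assumes g: "C-lipschitz_on A g" and C: "0 < C"
  shows "hausdorff1_delta (C * \<delta>) (g ` A) \<le> ennreal C * hausdorff1_delta \<delta> A"
proof -
  let ?h = "hausdorff1_delta (C * \<delta>) (g ` A)"
  \<comment> \<open>The factor is moved to the left because the right-hand side is an infimum over
    covers, which is bounded below cover by cover.\<close>
  have "ennreal (1 / C) * ?h \<le> hausdorff1_delta \<delta> A"
  proof (rule hausdorff1_delta_greatest)
    fix U assume U: "delta_cover \<delta> A U"
    define V where "V n = g ` (U n \<inter> A)" for n
    have bU: "bounded (U n)" "diameter (U n) \<le> \<delta>" for n using U by (auto simp: delta_cover_def)
    have gU: "C-lipschitz_on (U n \<inter> A) g" for n by (rule lipschitz_on_subset[OF g]) simp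
    have bV: "bounded (V n)" for n
      unfolding V_def using gU[of n] bounded_subset[OF bU(1)[of n]] 
      by (meson Int_lower1 bounded_uniformly_continuous_image lipschitz_on_uniformly_continuous)
    have dV: "diameter (V n) \<le> C * diameter (U n)" for n
    proof (rule diameter_le)
      show "V n \<noteq> {} \<or> 0 \<le> C * diameter (U n)" using C diameter_ge_0[OF bU(1)] by simp
      fix x y assume "x \<in> V n" "y \<in> V n"
      then obtain x' y' where xy: "x' \<in> U n \<inter> A" "y' \<in> U n \<inter> A" "x = g x'" "y = g y'"
        by (auto simp: V_def)
      have "dist x y \<le> C * dist x' y'" using lipschitz_onD[OF gU] xy by blast
      also have "\<dots> \<le> C * diameter (U n)"
        using xy C diameter_bounded_bound[OF bU(1)] by (intro mult_left_mono) auto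
      finally show "norm (x - y) \<le> C * diameter (U n)" by (simp add: dist_norm)
    qed
    have "delta_cover (C * \<delta>) (g ` A) V"
      unfolding delta_cover_def
    proof (intro conjI allI)
      show "g ` A \<subseteq> \<Union> (range V)" using U by (force simp: delta_cover_def V_def)
      show "bounded (V n)" for n by (rule bV)
      show "diameter (V n) \<le> C * \<delta>" for n
        using dV[of n] mult_left_mono[OF bU(2)[of n], of C] C by linarith
    qed
    then have "?h \<le> (\<Sum>n. ennreal (diameter (V n)))" by (rule hausdorff1_delta_le)
    also have "\<dots> \<le> (\<Sum>n. ennreal (C * diameter (U n)))"
      using dV by (intro suminf_le) (auto intro: ennreal_leI)
    also have "\<dots> = ennreal C * (\<Sum>n. ennreal (diameter (U n)))"
      using C diameter_ge_0[OF bU(1)] by (simp add: ennreal_mult ennreal_suminf_cmult)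
    finally have "ennreal (1 / C) * ?h \<le> ennreal (1 / C) * (ennreal C * (\<Sum>n. ennreal (diameter (U n))))"
      by (intro mult_left_mono) auto
    also have "\<dots> = (\<Sum>n. ennreal (diameter (U n)))"
      using C by (simp flip: mult.assoc ennreal_mult)
    finally show "ennreal (1 / C) * ?h \<le> (\<Sum>n. ennreal (diameter (U n)))" .
  qed
  then have "ennreal C * (ennreal (1 / C) * ?h) \<le> ennreal C * hausdorff1_delta \<delta> A"
    by (rule mult_left_mono) simp
  then show ?thesis using C by (simp flip: mult.assoc ennreal_mult)
qed

lemma arc_length_lipschitz:
  assumes "C-lipschitz_on A g" "0 < C"
  shows "arc_length (g ` A) \<le> ennreal C * arc_length A"
proof -
  have "hausdorff1_delta \<delta> (g ` A) \<le> ennreal C * arc_length A" if "0 < \<delta>" for \<delta>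
  proof -
    have "hausdorff1_delta \<delta> (g ` A) \<le> ennreal C * hausdorff1_delta (\<delta> / C) A"
      using hausdorff1_delta_lipschitz[OF assms, of "\<delta> / C"] assms(2) by simp
    also have "\<dots> \<le> ennreal C * arc_length A"
      using that assms(2) by (intro mult_left_mono hausdorff1_delta_le_arc_length) auto
    finally show ?thesis .
  qed
  then show ?thesis unfolding arc_length_def[of "g ` A"] by (intro SUP_least) auto
qed

text \<open>No set of diameter at most \<delta> meets both \<open>A\<close> and \<open>B\<close>, so
  every cover splits into a cover of \<open>A\<close> and one of \<open>B\<close>.\<close>

lemma hausdorff1_delta_separated:
  assumes sep: "\<And>x y. x \<in> A \<Longrightarrow> y \<in> B \<Longrightarrow> \<delta> < dist x y"
  shows "hausdorff1_delta \<delta> A + hausdorff1_delta \<delta> B \<le> hausdorff1_delta \<delta> (A \<union> B)"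
proof (rule hausdorff1_delta_greatest)
  fix U assume U: "delta_cover \<delta> (A \<union> B) U"
  define N where "N = {n. U n \<inter> A \<noteq> {}}"
  define V where "V n = (if n \<in> N then U n else {})" for n
  define W where "W n = (if n \<in> N then {} else U n)" for n
  have bU: "bounded (U n)" "diameter (U n) \<le> \<delta>" for n using U by (auto simp: delta_cover_def)
  have d0: "0 \<le> \<delta>" using diameter_ge_0[OF bU(1)] bU(2) order_trans by blast
  have "delta_cover \<delta> A V"
    using U d0 by (force simp: delta_cover_def V_def N_def)
  moreover have "delta_cover \<delta> B W"
    unfolding delta_cover_def
  proof (intro conjI allI)
    show "B \<subseteq> \<Union> (range W)"
    proof
      fix y assume y: "y \<in> B"
      then obtain n where n: "y \<in> U n" using U by (auto simp: delta_cover_def)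
      have "n \<notin> N"
      proof
        assume "n \<in> N"
        then obtain x where "x \<in> U n" "x \<in> A" by (auto simp: N_def)
        then show False
          using sep[of x y] y n diameter_bounded_bound[OF bU(1)[of n], of x y] bU(2)[of n] by simp
      qed
      then show "y \<in> \<Union> (range W)" using n by (force simp: W_def)
    qed
  qed (use bU d0 in \<open>auto simp: W_def\<close>)
  ultimately have "hausdorff1_delta \<delta> A + hausdorff1_delta \<delta> B
      \<le> (\<Sum>n. ennreal (diameter (V n))) + (\<Sum>n. ennreal (diameter (W n)))"
    by (intro add_mono hausdorff1_delta_le)
  also have "\<dots> = (\<Sum>n. ennreal (diameter (V n)) + ennreal (diameter (W n)))"
    by (rule suminf_add) auto
  also have "\<dots> = (\<Sum>n. ennreal (diameter (U n)))"
    by (intro suminf_cong) (auto simp: V_def W_def)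
  finally show "hausdorff1_delta \<delta> A + hausdorff1_delta \<delta> B \<le> (\<Sum>n. ennreal (diameter (U n)))" .
qed

text \<open>Disjoint compact sets have positive distance, and every finer scale separates them. This
  gives superadditivity for the outer measure directly.\<close>

lemma arc_length_disjoint_compact:
  assumes "compact A" "compact B" "A \<inter> B = {}"
  shows "arc_length A + arc_length B \<le> arc_length (A \<union> B)"
proof -
  obtain d where d: "0 < d" "\<And>x y. x \<in> A \<Longrightarrow> y \<in> B \<Longrightarrow> d \<le> dist x y"
    using separate_compact_closed[OF assms(1) compact_imp_closed[OF assms(2)] assms(3)] by blast
  \<comment> \<open>Independent scales for the two sets allow the suprema to be taken one after the
    other.\<close>
  have *: "hausdorff1_delta \<delta> A + hausdorff1_delta \<epsilon> B \<le> arc_length (A \<union> B)" if "0 < \<delta>" "0 < \<epsilon>" for \<delta> \<epsilon>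
  proof -
    define \<eta> where "\<eta> = min (min \<delta> \<epsilon>) (d / 2)"
    have \<eta>: "0 < \<eta>" "\<eta> \<le> \<delta>" "\<eta> \<le> \<epsilon>" "\<eta> < d" using that d(1) by (auto simp: \<eta>_def)
    have "hausdorff1_delta \<delta> A + hausdorff1_delta \<epsilon> B \<le> hausdorff1_delta \<eta> A + hausdorff1_delta \<eta> B"
      using \<eta> by (intro add_mono hausdorff1_delta_antimono)
    also have "\<dots> \<le> hausdorff1_delta \<eta> (A \<union> B)"
      using d(2) \<eta>(4) by (intro hausdorff1_delta_separated) (meson less_le_trans)
    finally show ?thesis using hausdorff1_delta_le_arc_length[OF \<eta>(1)] order_trans by blast
  qed
  have *: "arc_length A + hausdorff1_delta \<epsilon> B \<le> arc_length (A \<union> B)" if "0 < \<epsilon>" for \<epsilon>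
  proof -
    have "(SUP \<delta>\<in>{0<..}. hausdorff1_delta \<delta> A + hausdorff1_delta \<epsilon> B) = arc_length A + hausdorff1_delta \<epsilon> B"
      unfolding arc_length_def by (rule ennreal_SUP_add_left) (rule greaterThan_non_empty)
    moreover have "(SUP \<delta>\<in>{0<..}. hausdorff1_delta \<delta> A + hausdorff1_delta \<epsilon> B) \<le> arc_length (A \<union> B)"
      using * that by (intro SUP_least) auto
    ultimately show ?thesis by simp
  qed
  have "(SUP \<epsilon>\<in>{0<..}. arc_length A + hausdorff1_delta \<epsilon> B) = arc_length A + arc_length B"
    unfolding arc_length_def[of B] add.commute[of "arc_length A"]
    by (rule ennreal_SUP_add_left) (rule greaterThan_non_empty)
  moreover have "(SUP \<epsilon>\<in>{0<..}. arc_length A + hausdorff1_delta \<epsilon> B) \<le> arc_length (A \<union> B)"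
    using * by (intro SUP_least) auto
  ultimately show ?thesis by simp
qed

lemma arc_length_disjoint_family:
  assumes "finite I" "\<And>i. i \<in> I \<Longrightarrow> compact (K i)" "disjoint_family_on K I"
  shows "(\<Sum>i\<in>I. arc_length (K i)) \<le> arc_length (\<Union>i\<in>I. K i)"
  using assms
proof (induction I rule: finite_induct)
  case (insert i I)
  have "(\<Sum>i\<in>insert i I. arc_length (K i)) \<le> arc_length (K i) + arc_length (\<Union>i\<in>I. K i)"
    using insert by (simp add: add_left_mono disjoint_family_on_insert)
  also have "\<dots> \<le> arc_length (K i \<union> (\<Union>i\<in>I. K i))"
    using insert by (intro arc_length_disjoint_compact compact_UN) (auto simp: disjoint_family_on_def)
  finally show ?case by simp
qed simp

text \<open>The finite cover is padded with empty sets, which have diameter 0. A list is used so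
  that repeated covering sets are simply counted by its length.\<close>

lemma hausdorff1_delta_le_list:
  assumes "A \<subseteq> \<Union> (set Us)" "\<And>U. U \<in> set Us \<Longrightarrow> bounded U \<and> diameter U \<le> \<delta>" "0 \<le> \<delta>"
  shows "hausdorff1_delta \<delta> A \<le> ennreal (real (length Us) * \<delta>)"
proof -
  define V where "V n = (if n < length Us then Us ! n else {})" for n
  have "A \<subseteq> (\<Union>n. V n)"
  proof
    fix x assume "x \<in> A"
    then obtain n where "n < length Us" "x \<in> Us ! n" using assms(1) by (metis UnionE in_set_conv_nth subsetD)
    then show "x \<in> (\<Union>n. V n)" by (auto simp: V_def intro!: exI[of _ n])
  qed
  then have "hausdorff1_delta \<delta> A \<le> (\<Sum>n. ennreal (diameter (V n)))"
    using assms by (intro hausdorff1_delta_le) (auto simp: delta_cover_def V_def)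
  also have "\<dots> = (\<Sum>n<length Us. ennreal (diameter (V n)))"
    by (rule suminf_finite) (auto simp: V_def)
  also have "\<dots> \<le> (\<Sum>n<length Us. ennreal \<delta>)"
    using assms by (intro sum_mono) (auto simp: V_def intro: ennreal_leI)
  also have "\<dots> = ennreal (real (length Us) * \<delta>)"
    using assms(3) by (simp add: ennreal_mult ennreal_of_nat_eq_real_of_nat)
  finally show ?thesis .
qed

text \<open>The function \<open>dist a\<close> maps a connected set onto an interval, and every covering set onto a set
  of at most twice its diameter; the excluded balls only account for a small part of the interval.\<close>

lemma connected_arc_length_pos:
  assumes "compact A" "connected A" "a \<in> A" "b \<in> A" "a \<noteq> b" "finite Q"
  obtains K where "compact K" "K \<subseteq> A - Q" "0 < arc_length K"
proof -
  define D where "D = dist a b"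
  have D: "0 < D" using assms by (simp add: D_def)
  \<comment> \<open>The balls around \<open>Q\<close> project to intervals of total length at most
    \<open>D / 2\<close>, leaving \<open>D / 2\<close> to be covered by the sets
    \<open>U n\<close>.\<close>
  define \<epsilon> where "\<epsilon> = D / (4 * (real (card Q) + 1))"
  have \<epsilon>: "0 < \<epsilon>" "2 * \<epsilon> * card Q \<le> D / 2"
    using D by (auto simp: \<epsilon>_def field_simps)
  define K where "K = A - (\<Union>q\<in>Q. ball q \<epsilon>)"
  have "compact K" unfolding K_def using assms(1) by (intro compact_diff open_UN) auto
  moreover have "K \<subseteq> A - Q" using \<epsilon>(1) by (auto simp: K_def)
  \<comment> \<open>The scale 1 is an arbitrary choice. One factor 1/2 in \<open>D / 4\<close> is
    lost to the balls, the other to intervals of twice the diameter.\<close>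
  moreover have "ennreal (D / 4) \<le> hausdorff1_delta 1 K"
  proof (rule hausdorff1_delta_greatest)
    fix U assume U: "delta_cover 1 K U"
    define d where "d n = diameter (U n)" for n
    have bU: "bounded (U n)" for n using U by (auto simp: delta_cover_def)
    have d0: "0 \<le> d n" for n unfolding d_def by (rule diameter_ge_0[OF bU])
    define u where "u n = (SOME x. x \<in> U n)" for n
    define J where "J n = {dist a (u n) - d n .. dist a (u n) + d n}" for n
    define J' where "J' q = {dist a q - \<epsilon> .. dist a q + \<epsilon>}" for q
    have "{0..D} \<subseteq> (\<Union>n. J n) \<union> (\<Union>q\<in>Q. J' q)"
    proof
      fix t assume t: "t \<in> {0..D}"
      have "connected (dist a ` A)"
        by (intro connected_continuous_image assms continuous_intros)
      moreover have "dist a a \<in> dist a ` A" "dist a b \<in> dist a ` A" using assms by blast+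
      ultimately have "t \<in> dist a ` A" using t connectedD_interval D_def by fastforce
      then obtain x where x: "x \<in> A" "t = dist a x" by blast
      show "t \<in> (\<Union>n. J n) \<union> (\<Union>q\<in>Q. J' q)"
      proof (cases "x \<in> K")
        case True
        then obtain n where n: "x \<in> U n" using U by (auto simp: delta_cover_def)
        then have "u n \<in> U n" unfolding u_def by (rule someI)
        then have "dist x (u n) \<le> d n" unfolding d_def using n bU by (intro diameter_bounded_bound)
        then have "t \<in> J n" unfolding J_def x using dist_triangle[of a x "u n"] dist_triangle[of a "u n" x]
          by (auto simp: dist_commute)
        then show ?thesis by blast
      next
        case False
        then obtain q where "q \<in> Q" "dist q x < \<epsilon>" using x by (auto simp: K_def)
        then have "t \<in> J' q" unfolding J'_def x using dist_triangle[of a x q] dist_triangle[of a q x]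
          by (auto simp: dist_commute)
        with \<open>q \<in> Q\<close> show ?thesis by blast
      qed
    qed
    then have "emeasure lborel {0..D} \<le> emeasure lborel ((\<Union>n. J n) \<union> (\<Union>q\<in>Q. J' q))"
      using assms(6) by (intro emeasure_mono sets.Un sets.countable_UN sets.finite_UN) (auto simp: J_def J'_def)
    also have "\<dots> \<le> emeasure lborel (\<Union>n. J n) + emeasure lborel (\<Union>q\<in>Q. J' q)"
      using assms(6) by (intro emeasure_subadditive sets.countable_UN sets.finite_UN) (auto simp: J_def J'_def)
    also have "\<dots> \<le> (\<Sum>n. emeasure lborel (J n)) + (\<Sum>q\<in>Q. emeasure lborel (J' q))"
      using assms(6) by (intro add_mono emeasure_subadditive_countably emeasure_subadditive_finite)
        (auto simp: J_def J'_def)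
    also have "\<dots> = (\<Sum>n. ennreal (2 * d n)) + ennreal (2 * \<epsilon> * card Q)"
      using d0 \<epsilon>(1) by (simp add: J_def J'_def ennreal_of_nat_eq_real_of_nat mult.commute flip: ennreal_mult)
    also have "\<dots> \<le> (\<Sum>n. ennreal (2 * d n)) + ennreal (D / 2)"
      using \<epsilon> by (intro add_left_mono ennreal_leI)
    also have "(\<Sum>n. ennreal (2 * d n)) = 2 * (\<Sum>n. ennreal (d n))"
      using d0 by (simp add: ennreal_mult)
    finally have *: "ennreal D \<le> 2 * (\<Sum>n. ennreal (d n)) + ennreal (D / 2)" using D by simp
    show "ennreal (D / 4) \<le> (\<Sum>n. ennreal (diameter (U n)))"
    proof (cases "(\<Sum>n. ennreal (d n))")
      case (real r)
      have "2 * ennreal r = ennreal (2 * r)" using real by (simp add: ennreal_mult)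
      then have "ennreal D \<le> ennreal (2 * r + D / 2)"
        using * real D by (metis ennreal_plus less_eq_real_def half_gt_zero mult_nonneg_nonneg zero_le_numeral)
      then have "D \<le> 2 * r + D / 2" using real D by (subst (asm) ennreal_le_iff) auto
      then have "D / 4 \<le> r" by simp
      then show ?thesis using real by (simp add: d_def ennreal_leI)
    next
      case top
      then show ?thesis by (simp add: d_def)
    qed
  qed
  then have "0 < arc_length K"
    using hausdorff1_delta_le_arc_length[of 1 K] D
    by (metis ennreal_less_zero_iff divide_pos_pos less_le_trans zero_less_numeral zero_less_one)
  ultimately show ?thesis using that by blast
qed

section \<open>Paths in trees\<close>

definition adj :: "nat \<Rightarrow> triangle set \<Rightarrow> triangle \<Rightarrow> triangle \<Rightarrow> bool" where
  "adj m V A B \<longleftrightarrow> (\<exists>j. edge m V j A B)"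

text \<open>Connectedness inside \<open>V\<close>. It is applied to the cells with one cell removed,
  where it describes the branches of the tree at that cell.\<close>

definition linked :: "nat \<Rightarrow> triangle set \<Rightarrow> triangle \<Rightarrow> triangle \<Rightarrow> bool" where
  "linked m V A B \<longleftrightarrow> (\<exists>xs. path_from_to m V A B xs)"

lemma edge_sym: "edge m V j A B \<Longrightarrow> edge m V j B A"
  by (auto simp: edge_def)

lemma adj_sym: "adj m V A B \<Longrightarrow> adj m V B A"
  by (auto simp: adj_def intro: edge_sym)

lemma adj_in: "adj m V A B \<Longrightarrow> A \<in> V \<and> B \<in> V"
  by (auto simp: adj_def edge_def)

lemma adj_restrict: "adj m X A B \<longleftrightarrow> adj m V A B \<and> A \<in> X \<and> B \<in> X" if "X \<subseteq> V"
  using that by (auto simp: adj_def edge_def)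

lemma graph_path_iff:
  "graph_path m V xs \<longleftrightarrow> xs \<noteq> [] \<and> set xs \<subseteq> V \<and> distinct xs \<and> successively (adj m V) xs"
  unfolding graph_path_def successively_conv_nth adj_def by blast

lemma graph_path_set: "graph_path m V xs \<Longrightarrow> set xs \<subseteq> V"
  by (simp add: graph_path_iff)

lemma graph_path_mono: "graph_path m X xs \<Longrightarrow> X \<subseteq> V \<Longrightarrow> graph_path m V xs"
  unfolding graph_path_iff using adj_restrict[of X V m] by (auto elim: successively_mono)

lemma graph_path_restrict: "graph_path m V xs \<Longrightarrow> set xs \<subseteq> X \<Longrightarrow> X \<subseteq> V \<Longrightarrow> graph_path m X xs"
  unfolding graph_path_iff using adj_restrict[of X V m] by (auto elim!: successively_mono)

lemma graph_path_diff: "graph_path m (V - {D}) xs \<longleftrightarrow> graph_path m V xs \<and> D \<notin> set xs"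
proof
  assume "graph_path m (V - {D}) xs"
  then show "graph_path m V xs \<and> D \<notin> set xs"
    using graph_path_set[of m "V - {D}" xs] graph_path_mono[of m "V - {D}" xs V] by blast
next
  assume *: "graph_path m V xs \<and> D \<notin> set xs"
  then have "set xs \<subseteq> V - {D}" using graph_path_set[of m V xs] by blast
  then show "graph_path m (V - {D}) xs" using * graph_path_restrict[of m V xs "V - {D}"] by blast
qed

lemma path_from_to_rev: "path_from_to m V A B xs \<Longrightarrow> path_from_to m V B A (rev xs)"
  unfolding path_from_to_def graph_path_iff
  by (auto simp: hd_rev last_rev elim!: successively_mono intro: adj_sym)

lemma path_from_to_append:
  assumes "path_from_to m V A B xs" "path_from_to m V C D ys" "adj m V B C" "set xs \<inter> set ys = {}"
  shows "path_from_to m V A D (xs @ ys)"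
  using assms unfolding path_from_to_def graph_path_iff by (auto simp: successively_append_iff)

lemma path_from_to_singleton: "A \<in> V \<Longrightarrow> path_from_to m V A A [A]"
  unfolding path_from_to_def graph_path_iff by simp

lemma path_from_to_prefix:
  assumes "path_from_to m V A B (xs @ C # ys)"
  shows "path_from_to m V A C (xs @ [C])"
proof -
  have "successively (adj m V) ((xs @ [C]) @ ys)"
    using assms by (simp add: path_from_to_def graph_path_iff)
  then have "successively (adj m V) (xs @ [C])" by (simp only: successively_append_iff)
  moreover have "hd (xs @ [C]) = hd (xs @ C # ys)" by (cases xs) auto
  ultimately show ?thesis using assms by (auto simp: path_from_to_def graph_path_iff)
qed

text \<open>A walk contains a path: when the next vertex has already occurred, the path is cut
  there. Transitivity, awkward for lists of distinct vertices, follows.\<close>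

lemma linked_iff: "linked m V A B \<longleftrightarrow> A \<in> V \<and> (adj m V)\<^sup>*\<^sup>* A B"
proof
  assume "linked m V A B"
  then obtain xs where "path_from_to m V A B xs" by (auto simp: linked_def)
  then show "A \<in> V \<and> (adj m V)\<^sup>*\<^sup>* A B"
  proof (induction xs arbitrary: A)
    case Nil
    then show ?case by (simp add: path_from_to_def graph_path_iff)
  next
    case (Cons C xs)
    show ?case
    proof (cases xs)
      case Nil
      then show ?thesis using Cons.prems by (auto simp: path_from_to_def graph_path_iff)
    next
      case (Cons D ys)
      then have "path_from_to m V D B xs" "adj m V A D" "A \<in> V"
        using Cons.prems by (auto simp: path_from_to_def graph_path_iff)
      then show ?thesis using Cons.IH[of D] by (auto intro: converse_rtranclp_into_rtranclp)
    qed
  qed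
next
  assume *: "A \<in> V \<and> (adj m V)\<^sup>*\<^sup>* A B"
  then have "(adj m V)\<^sup>*\<^sup>* A B" by simp
  then show "linked m V A B"
  proof (induction rule: rtranclp_induct)
    case base
    then show ?case using * path_from_to_singleton unfolding linked_def by blast
  next
    case (step B C)
    then obtain xs where xs: "path_from_to m V A B xs" by (auto simp: linked_def)
    show ?case
    proof (cases "C \<in> set xs")
      case True
      then show ?thesis using path_from_to_prefix xs split_list[OF True] unfolding linked_def by metis
    next
      case False
      then have "path_from_to m V A C (xs @ [C])"
        using xs step adj_in[OF step(2)] by (intro path_from_to_append[OF _ path_from_to_singleton]) auto
      then show ?thesis by (auto simp: linked_def)
    qed
  qed
qed

lemma linked_trans: "linked m V A B \<Longrightarrow> linked m V B C \<Longrightarrow> linked m V A C"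
  by (auto simp: linked_iff)

lemma linked_sym: "linked m V A B \<Longrightarrow> linked m V B A"
  unfolding linked_def using path_from_to_rev by blast

lemma linked_in: "linked m V A B \<Longrightarrow> A \<in> V \<and> B \<in> V"
  using linked_sym[of m V A B] linked_iff by blast

lemma linked_adj: "adj m V A B \<Longrightarrow> linked m V A B"
  using adj_in by (auto simp: linked_iff)

lemma path_from_to_Cons:
  assumes "path_from_to m V A B (C # xs)" "xs \<noteq> []"
  shows "C = A" "adj m V A (hd xs)" "path_from_to m (V - {A}) (hd xs) B xs"
proof -
  show C: "C = A" using assms by (simp add: path_from_to_def)
  show "adj m V A (hd xs)" using assms C by (cases xs) (auto simp: path_from_to_def graph_path_iff)
  have "graph_path m V xs" "A \<notin> set xs"
    using assms C by (auto simp: path_from_to_def graph_path_iff successively_Cons)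
  then have "graph_path m (V - {A}) xs"
    by (simp add: graph_path_diff)
  then show "path_from_to m (V - {A}) (hd xs) B xs"
    using assms by (simp add: path_from_to_def)
qed

lemma linked_before:
  assumes "path_from_to m V A B xs" "Suc l < length xs"
  shows "linked m (V - {xs ! Suc l}) A (xs ! l)"
proof -
  let ?ys = "take (Suc l) xs"
  have xs: "set xs \<subseteq> V" "distinct xs" "successively (adj m V) xs" "hd xs = A" "xs \<noteq> []"
    using assms by (auto simp: path_from_to_def graph_path_iff)
  have "successively (adj m V) ?ys"
    using xs(3) by (metis append_take_drop_id successively_append_iff)
  then have "graph_path m V ?ys"
    using xs set_take_subset[of "Suc l" xs] by (auto simp: graph_path_iff)
  moreover have "xs ! Suc l \<notin> set ?ys"
    using xs(2) assms(2) by (auto simp: in_set_conv_nth nth_eq_iff_index_eq)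
  ultimately have "graph_path m (V - {xs ! Suc l}) ?ys"
    by (simp add: graph_path_diff)
  moreover have "hd ?ys = A" "last ?ys = xs ! l"
    using xs assms(2) by (simp, simp add: take_Suc_conv_app_nth del: hd_take)
  ultimately show ?thesis unfolding linked_def path_from_to_def by blast
qed

lemma linked_after:
  assumes "path_from_to m V A B xs" "Suc l < length xs"
  shows "linked m (V - {xs ! l}) (xs ! Suc l) B"
proof -
  \<comment> \<open>In the reversed list position \<open>l'\<close> holds \<open>xs ! Suc l\<close>
    and the position after it holds \<open>xs ! l\<close>.\<close>
  define l' where "l' = length xs - Suc (Suc l)"
  have l': "Suc l' < length (rev xs)" "rev xs ! Suc l' = xs ! l" "rev xs ! l' = xs ! Suc l"
    using assms(2) by (auto simp: l'_def rev_nth Suc_diff_Suc)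
  show ?thesis using linked_before[OF path_from_to_rev[OF assms(1)] l'(1)] l' by (auto intro: linked_sym)
qed

text \<open>A path from \<open>A\<close> to \<open>B\<close> that avoids their common neighbour
  \<open>D\<close> would close up through \<open>D\<close> to a cycle.\<close>

lemma tree_no_cycle:
  assumes "graph_tree m V" "adj m V D A" "adj m V D B" "linked m (V - {D}) A B"
  shows "A = B"
proof (rule ccontr)
  assume "A \<noteq> B"
  obtain xs where xs: "path_from_to m (V - {D}) A B xs" using assms(4) by (auto simp: linked_def)
  then have gp: "graph_path m (V - {D}) xs" and hl: "hd xs = A" "last xs = B" by (auto simp: path_from_to_def)
  then have gp': "graph_path m V xs" "D \<notin> set xs" "xs \<noteq> []"
    by (simp_all add: graph_path_diff) (simp add: graph_path_iff)
  have "length xs \<noteq> 1" using hl \<open>A \<noteq> B\<close> by (auto simp: length_Suc_conv)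
  then have "3 \<le> length (D # xs)" using gp'(3) by (cases xs) (auto simp: Suc_le_eq)
  moreover have "graph_path m V (D # xs)"
    using gp' assms(2) adj_in[OF assms(2)] hl by (auto simp: graph_path_iff successively_Cons)
  moreover have "\<exists>j. edge m V j (last (D # xs)) (hd (D # xs))"
    using adj_sym[OF assms(3)] hl gp' by (simp add: adj_def)
  ultimately have "graph_cycle m V (D # xs)" by (simp add: graph_cycle_def)
  with assms(1) show False by (auto simp: graph_tree_def)
qed

lemma tree_branch:
  assumes "graph_tree m V" "D \<in> V" "A \<in> V" "A \<noteq> D"
  obtains C where "adj m V D C" "linked m (V - {D}) C A"
proof -
  obtain xs where xs: "path_from_to m V D A xs" using assms unfolding graph_tree_def by blast
  then obtain ys where ys: "xs = D # ys" "ys \<noteq> []"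
    using assms(4) by (cases xs) (auto simp: path_from_to_def graph_path_iff split: if_splits)
  then show ?thesis using path_from_to_Cons[of m V D A D ys] xs that by (auto simp: linked_def)
qed

text \<open>Two paths that part at \<open>A\<close> meet again at \<open>B\<close>, so their next
  vertices are linked outside \<open>A\<close>; \<open>tree_no_cycle\<close> makes these vertices
  equal.\<close>

lemma tree_path_unique:
  assumes "graph_tree m V" "path_from_to m V A B xs" "path_from_to m V A B ys"
  shows "xs = ys"
  using assms(2,3)
proof (induction xs arbitrary: A ys)
  case Nil
  then show ?case by (simp add: path_from_to_def graph_path_iff)
next
  case (Cons C xs)
  then obtain C' ys' where ys: "ys = C' # ys'" by (cases ys) (auto simp: path_from_to_def graph_path_iff)
  have CC: "C = A" "C' = A" using Cons.prems ys by (auto simp: path_from_to_def)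
  have emp: "zs = []" if "path_from_to m V A A (A # zs)" for zs
    using that by (cases "zs = []") (auto simp: path_from_to_def graph_path_iff)
  show ?case
  proof (cases "xs = [] \<or> ys' = []")
    case True
    then have "A = B" using Cons.prems ys CC by (auto simp: path_from_to_def)
    then show ?thesis using emp Cons.prems CC ys by blast
  next
    case False
    then have p: "adj m V A (hd xs)" "path_from_to m (V - {A}) (hd xs) B xs"
       "adj m V A (hd ys')" "path_from_to m (V - {A}) (hd ys') B ys'"
      using path_from_to_Cons[of m V A B C xs] path_from_to_Cons[of m V A B C' ys'] Cons.prems ys by blast+
    have "linked m (V - {A}) (hd xs) (hd ys')"
      using linked_trans[OF _ linked_sym] p(2,4) unfolding linked_def by blast
    then have "hd xs = hd ys'" using tree_no_cycle[OF assms(1)] p by blast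
    moreover have "path_from_to m V (hd xs) B xs" "path_from_to m V (hd ys') B ys'"
      using p graph_path_mono[of m "V - {A}"] by (auto simp: path_from_to_def)
    ultimately have "xs = ys'" using Cons.IH by metis
    then show ?thesis using ys CC by simp
  qed
qed

section \<open>Collapsing the branches of a connected set\<close>

text \<open>Mapping each branch \<open>Y j\<close> to its attaching point \<open>q j\<close> is a retraction onto \<open>X\<close>.\<close>

lemma connected_Int_trunk:
  fixes X C :: "'a :: topological_space set" and Y :: "'b \<Rightarrow> 'a set"
  assumes fin: "finite J" and clX: "closed X" and clY: "\<And>j. j \<in> J \<Longrightarrow> closed (Y j)"
    and q: "\<And>j. j \<in> J \<Longrightarrow> Y j \<inter> X \<subseteq> {q j}"
    and disj: "\<And>i j. i \<in> J \<Longrightarrow> j \<in> J \<Longrightarrow> i \<noteq> j \<Longrightarrow> Y i \<inter> Y j = {}"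
    and C: "connected C" "C \<subseteq> X \<union> (\<Union>j\<in>J. Y j)"
    and ab: "a \<in> C" "b \<in> C"
    and a: "a \<in> X \<and> a' = a \<or> (\<exists>j\<in>J. a \<in> Y j - X \<and> a' = q j)"
    and b: "b \<in> X \<and> b' = b \<or> (\<exists>j\<in>J. b \<in> Y j - X \<and> b' = q j)"
    and nab: "\<And>j. j \<in> J \<Longrightarrow> a \<notin> Y j - X \<or> b \<notin> Y j - X"
  shows "connected (C \<inter> X)" "a' \<in> C \<inter> X" "b' \<in> C \<inter> X"
proof -
  define r where "r x = (if x \<in> X then x else q (THE j. j \<in> J \<and> x \<in> Y j))" for x
  have rX: "r x = x" if "x \<in> X" for x using that by (simp add: r_def)
  have rY: "r x = q j" if "j \<in> J" "x \<in> Y j" for x j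
  proof (cases "x \<in> X")
    case True
    then show ?thesis using q that by (auto simp: r_def)
  next
    case False
    have "(THE j. j \<in> J \<and> x \<in> Y j) = j" using that disj by (intro the_equality) auto
    then show ?thesis using False by (simp add: r_def)
  qed
  have cont: "continuous_on (X \<union> (\<Union>j\<in>J. Y j)) r"
  proof (rule continuous_on_closed_Un)
    show "closed (\<Union>j\<in>J. Y j)" using fin clY by blast
    show "continuous_on X r" using rX by (simp cong: continuous_on_cong)
    show "continuous_on (\<Union>j\<in>J. Y j) r"
    proof (rule continuous_on_closed_Union)
      fix j assume "j \<in> J"
      then have "continuous_on (Y j) r \<longleftrightarrow> continuous_on (Y j) (\<lambda>x. q j)"
        by (intro continuous_on_cong refl rY)
      then show "continuous_on (Y j) r" by simp
    qed (use fin clY in auto)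
  qed (use clX in auto)
  \<comment> \<open>\<open>C\<close> enters the branch \<open>Y j\<close>, but \<open>a\<close> and
    \<open>b\<close> do not both lie in it off the trunk, so \<open>C\<close> also meets the union
    \<open>Z\<close> of the trunk and the other branches. Connectedness gives a common point of
    \<open>Y j\<close> and \<open>Z\<close>, which can only be \<open>q j\<close>.\<close>
  have qC: "q j \<in> C \<inter> X" if j: "j \<in> J" and x: "x \<in> C" "x \<in> Y j" "x \<notin> X" for j x
  proof -
    define Z where "Z = X \<union> (\<Union>i\<in>J - {j}. Y i)"
    have "a \<in> Z \<or> b \<in> Z" using nab[OF j] a b unfolding Z_def by blast
    then have 1: "Z \<inter> C \<noteq> {}" using ab by blast
    have 2: "Y j \<inter> C \<noteq> {}" using x by blast
    have 3: "C \<subseteq> Y j \<union> Z" using C(2) unfolding Z_def by blast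
    have "closed Z" unfolding Z_def using clX clY fin by (intro closed_Un closed_UN) auto
    then have "Y j \<inter> Z \<inter> C \<noteq> {}" using C(1) 1 2 3 clY[OF j] unfolding connected_closed by blast
    moreover have "Y j \<inter> Z = Y j \<inter> X" using disj[OF j] unfolding Z_def by blast
    ultimately show ?thesis using q[OF j] by blast
  qed
  have rC: "r x \<in> C \<inter> X" if "x \<in> C" for x
  proof (cases "x \<in> X")
    case True
    then show ?thesis using that rX by simp
  next
    case False
    then obtain j where "j \<in> J" "x \<in> Y j" using \<open>x \<in> C\<close> C(2) by blast
    then show ?thesis using qC rY that False by metis
  qed
  have "r ` C = C \<inter> X" using rC rX by (force simp: image_iff)
  then show "connected (C \<inter> X)"
    using connected_continuous_image[OF continuous_on_subset[OF cont C(2)] C(1)] by simp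
  have "r a = a'" "r b = b'" using a b rX rY by auto
  then show "a' \<in> C \<inter> X" "b' \<in> C \<inter> X" using rC ab by blast+
qed

section \<open>Composition of cell maps\<close>

lemma cell_map_T_base: "x \<in> base \<Longrightarrow> k \<in> idx (int m - 1) \<Longrightarrow> 0 < m \<Longrightarrow> cell_map (T m k) x \<in> base"
  by (simp add: base_def bary_cell_map_T idx_iff)

lemma cell_map_T'_base:
  assumes "x \<in> base" "k \<in> idx (int m - 2)" "0 < m"
  shows "cell_map (T' m k) x \<in> base"
proof -
  have "0 \<le> real_of_int (k $ i) + 1 - bary i x" for i
    using assms(2) bary_le_1[OF assms(1), of i] by (simp add: idx_iff add_increasing)
  then show ?thesis using assms by (simp add: base_def bary_cell_map_T')
qed

lemma T_vertex_base: "k \<in> idx (int m - 1) \<Longrightarrow> 0 < m \<Longrightarrow> T m k $ i \<in> base"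
  using cell_map_T_base[OF base_P] by (simp add: cell_map_P)

lemma T'_vertex_base: "k \<in> idx (int m - 2) \<Longrightarrow> 0 < m \<Longrightarrow> T' m k $ i \<in> base"
  using cell_map_T'_base[OF base_P] by (simp add: cell_map_P)

lemma tri_image_nth: "V $ i \<in> base \<Longrightarrow> tri_image U V $ i = cell_map U (cell_map V (P $ i))"
  by (simp add: tri_image_def tri_map_eq cell_map_P)

lemma cell_map_tri_image:
  assumes "\<And>i. V $ i \<in> base"
  shows "cell_map (tri_image U V) x = cell_map U (cell_map V x)"
proof -
  have "cell_map (tri_image U V) x = (\<Sum>i\<in>UNIV. \<Sum>j\<in>UNIV. (bary i x * bary j (V $ i)) *\<^sub>R U $ j)"
    using assms unfolding cell_map_def[of _ x]
    by (simp add: tri_image_nth cell_map_P) (simp add: cell_map_def scaleR_sum_right)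
  also have "\<dots> = (\<Sum>j\<in>UNIV. (\<Sum>i\<in>UNIV. bary i x * bary j (V $ i)) *\<^sub>R U $ j)"
    unfolding scaleR_sum_left by (rule sum.swap)
  also have "\<dots> = cell_map U (cell_map V x)"
    unfolding cell_map_def by (simp add: bary_convex sum_bary)
  finally show ?thesis .
qed

lemma triangle_eqI:
  assumes "\<And>i j. bary j (cell_map U (P $ i)) = bary j (cell_map V (P $ i))"
  shows "U = V"
  unfolding vec_eq_iff using assms bary_eqI by (metis cell_map_P)

text \<open>Concatenation of base-\<open>m\<close> digits: the index of a small upright cell inside
  a larger one.\<close>

definition digits :: "nat \<Rightarrow> int ^ 3 \<Rightarrow> int ^ 3 \<Rightarrow> int ^ 3" where
  "digits m u v = (\<chi> i. int m * u $ i + v $ i)"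

text \<open>Inside a cell \<open>T'\<close> the inner digit is complemented, because the cell map
  contains a half turn.\<close>

definition codigits :: "nat \<Rightarrow> int ^ 3 \<Rightarrow> int ^ 3 \<Rightarrow> int ^ 3" where
  "codigits m u v = (\<chi> i. int m * u $ i + (int m - 1 - v $ i))"

lemma digits_nth: "digits m u v $ i = int m * u $ i + v $ i"
  by (simp add: digits_def)

lemma codigits_nth: "codigits m u v $ i = int m * u $ i + (int m - 1 - v $ i)"
  by (simp add: codigits_def)

lemma digits_idx:
  assumes "u \<in> idx s" "v \<in> idx t" "r = int m * s + t"
  shows "digits m u v \<in> idx r"
  using assms by (auto simp: idx_iff digits_def sum.distrib simp flip: sum_distrib_left)

lemma codigits_idx:
  assumes "u \<in> idx s" "v \<in> idx t" "t \<le> int m - 1" "r = int m * s + 3 * (int m - 1) - t"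
  shows "codigits m u v \<in> idx r"
proof -
  have "v $ i \<le> int m - 1" for i using idx_le[OF assms(2), of i] assms(3) by simp
  then show ?thesis using assms
    by (auto simp: idx_iff codigits_def sum.distrib sum_subtractf simp flip: sum_distrib_left)
qed

lemma tri_image_TT:
  assumes "u \<in> idx (int M - 1)" "v \<in> idx (int m - 1)" "0 < M" "0 < m"
  shows "tri_image (T M u) (T m v) = T (M * m) (digits m u v)" "digits m u v \<in> idx (int (M * m) - 1)"
proof -
  show *: "digits m u v \<in> idx (int (M * m) - 1)"
    using assms(1,2) by (rule digits_idx) (simp add: algebra_simps)
  show "tri_image (T M u) (T m v) = T (M * m) (digits m u v)"
    using assms by (intro triangle_eqI)
      (simp add: cell_map_tri_image T_vertex_base bary_cell_map_T bary_cell_map_T[OF *] digits_nth field_simps)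
qed

lemma tri_image_TT':
  assumes "u \<in> idx (int M - 1)" "v \<in> idx (int m - 2)" "0 < M" "0 < m"
  shows "tri_image (T M u) (T' m v) = T' (M * m) (digits m u v)" "digits m u v \<in> idx (int (M * m) - 2)"
proof -
  show *: "digits m u v \<in> idx (int (M * m) - 2)"
    using assms(1,2) by (rule digits_idx) (simp add: algebra_simps)
  show "tri_image (T M u) (T' m v) = T' (M * m) (digits m u v)"
    using assms by (intro triangle_eqI)
      (simp add: cell_map_tri_image T'_vertex_base bary_cell_map_T bary_cell_map_T' bary_cell_map_T'[OF *]
         digits_nth field_simps)
qed

lemma tri_image_T'T:
  assumes "u \<in> idx (int M - 2)" "v \<in> idx (int m - 1)" "0 < M" "0 < m"
  shows "tri_image (T' M u) (T m v) = T' (M * m) (codigits m u v)" "codigits m u v \<in> idx (int (M * m) - 2)"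
proof -
  show *: "codigits m u v \<in> idx (int (M * m) - 2)"
    using assms(1,2) by (rule codigits_idx) (simp_all add: algebra_simps)
  show "tri_image (T' M u) (T m v) = T' (M * m) (codigits m u v)"
    using assms by (intro triangle_eqI)
      (simp add: cell_map_tri_image T_vertex_base bary_cell_map_T bary_cell_map_T' bary_cell_map_T'[OF *]
         codigits_nth field_simps)
qed

text \<open>Two half turns cancel, so the image is upright again.\<close>

lemma tri_image_T'T':
  assumes "u \<in> idx (int M - 2)" "v \<in> idx (int m - 2)" "0 < M" "0 < m"
  shows "tri_image (T' M u) (T' m v) = T (M * m) (codigits m u v)" "codigits m u v \<in> idx (int (M * m) - 1)"
proof -
  show *: "codigits m u v \<in> idx (int (M * m) - 1)"
    using assms(1,2) by (rule codigits_idx) (simp_all add: algebra_simps)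
  show "tri_image (T' M u) (T' m v) = T (M * m) (codigits m u v)"
    using assms by (intro triangle_eqI)
      (simp add: cell_map_tri_image T'_vertex_base bary_cell_map_T' bary_cell_map_T[OF *]
         codigits_nth field_simps)
qed

section \<open>Exits\<close>

text \<open>The cell at position \<open>a\<close> along side \<open>i\<close>, parametrised as in
  the exits property. A yellow exit is a white one with \<open>a\<close> replaced by
  \<open>int M - 1 - a\<close>.\<close>

definition side_idx :: "nat \<Rightarrow> 3 \<Rightarrow> int \<Rightarrow> int ^ 3" where
  "side_idx M i a = (if i = 1 then vector [0, a, int M - 1 - a]
     else if i = 2 then vector [a, 0, int M - 1 - a] else vector [a, int M - 1 - a, 0])"

definition exit_at :: "nat \<Rightarrow> pattern_sets \<Rightarrow> 3 \<Rightarrow> int \<Rightarrow> bool" where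
  "exit_at M R i a \<longleftrightarrow> a \<in> {0..int M - 1} \<and> T M (side_idx M i a) \<in> white R \<and>
     T M (side_idx M i (int M - 1 - a)) \<in> yellow R"

lemma side_idx_in: "a \<in> {0..int M - 1} \<Longrightarrow> side_idx M i a \<in> idx (int M - 1)"
  by (auto simp: idx_def side_idx_def forall_3)

lemma side_idx_zero: "side_idx M i a $ i = 0"
  using exhaust_3[of i] by (auto simp: side_idx_def)

lemma side_idx_complement: "l \<noteq> i \<Longrightarrow> side_idx M i (int M - 1 - a) $ l = int M - 1 - side_idx M i a $ l"
  using exhaust_3[of i] exhaust_3[of l] by (auto simp: side_idx_def)

lemma side_idx_inj: "side_idx M i a = side_idx M i b \<longleftrightarrow> a = b"
  using exhaust_3[of i] by (auto simp: side_idx_def vec_eq_iff forall_3)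

lemma side_idxE:
  assumes "k \<in> idx (int M - 1)" "k $ i = 0"
  obtains a where "a \<in> {0..int M - 1}" "k = side_idx M i a"
proof
  define a where "a = (if i = 1 then k $ 2 else k $ 1)"
  show "a \<in> {0..int M - 1}" using idx_le[OF assms(1)] assms(1) by (auto simp: a_def idx_def)
  show "k = side_idx M i a"
    using assms exhaust_3[of i] by (auto simp: a_def side_idx_def vec_eq_iff forall_3 idx_def)
qed

lemma white_exit_at_eq: "white_exit_at M k i = T M (side_idx M i (k $ i))"
  using exhaust_3[of i] by (auto simp: white_exit_at_def side_idx_def)

lemma yellow_exit_at_eq: "yellow_exit_at M k i = T M (side_idx M i (int M - 1 - k $ i))"
  using exhaust_3[of i] by (auto simp: yellow_exit_at_def side_idx_def)

lemma exit_triple_iff: "exit_triple M R k \<longleftrightarrow> (\<forall>i. exit_at M R i (k $ i))"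
  by (auto simp: exit_triple_def exit_at_def white_exit_at_eq yellow_exit_at_eq)

text \<open>The conditions for the three sides are independent: exchanging one component of a valid
  triple gives a valid triple. Uniqueness can therefore be handled side by side.\<close>

lemma exit_at_unique_iff: "(\<exists>!k. exit_triple M R k) \<longleftrightarrow> (\<forall>i. \<exists>!a. exit_at M R i a)"
proof
  assume "\<exists>!k. exit_triple M R k"
  then obtain k where k: "exit_triple M R k" and uniq: "\<And>k'. exit_triple M R k' \<Longrightarrow> k' = k" by blast
  show "\<forall>i. \<exists>!a. exit_at M R i a"
  proof (intro allI ex1I)
    fix i a
    show "exit_at M R i (k $ i)" using k by (simp add: exit_triple_iff)
    assume a: "exit_at M R i a"
    have "exit_triple M R (\<chi> l. if l = i then a else k $ l)"
      using k a by (simp add: exit_triple_iff)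
    from arg_cong[OF uniq[OF this], of "\<lambda>k. k $ i"] show "a = k $ i" by simp
  qed
next
  assume *: "\<forall>i. \<exists>!a. exit_at M R i a"
  then have "exit_triple M R (\<chi> i. THE a. exit_at M R i a)"
    unfolding exit_triple_iff using theI'[of "exit_at M R i" for i] by simp
  moreover have "k = k'" if "exit_triple M R k" "exit_triple M R k'" for k k'
    using that * unfolding exit_triple_iff vec_eq_iff by blast
  ultimately show "\<exists>!k. exit_triple M R k" by blast
qed

lemma exits_eq:
  assumes "\<forall>i. \<exists>!a. exit_at M R i a" "exit_at M R i a"
  shows "white_exit M R i = T M (side_idx M i a)" "yellow_exit M R i = T M (side_idx M i (int M - 1 - a))"
proof -
  have "exit_triple M R (THE k. exit_triple M R k)"
    using assms(1) theI'[of "exit_triple M R"] unfolding exit_at_unique_iff[symmetric] by blast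
  then have "(THE k. exit_triple M R k) $ i = a" using assms unfolding exit_triple_iff by blast
  then show "white_exit M R i = T M (side_idx M i a)" "yellow_exit M R i = T M (side_idx M i (int M - 1 - a))"
    by (simp_all add: white_exit_def yellow_exit_def white_exit_at_eq yellow_exit_at_eq)
qed

lemma digits_side_idx: "digits m (side_idx M i a) (side_idx m i b) = side_idx (M * m) i (int m * a + b)"
  using exhaust_3[of i] by (auto simp: digits_def side_idx_def vec_eq_iff forall_3 algebra_simps)

section \<open>Levels\<close>

lemma UN_images: "(\<Union>W\<in>images A B. g W) = (\<Union>U\<in>A. \<Union>V\<in>B. g (tri_image U V))"
  by (auto simp: images_def)

text \<open>The Boolean is the colour, \<open>True\<close> for white. The rules of the two colours
  are exchanged by negation, so each statement is proved once for both.\<close>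

definition ups :: "pattern_sets \<Rightarrow> bool \<Rightarrow> triangle set" where
  "ups R c = (if c then white R else yellow R)"

definition downs :: "pattern_sets \<Rightarrow> bool \<Rightarrow> triangle set" where
  "downs R c = (if c then white' R else yellow' R)"

lemma ups_level:
  "ups (level S (Suc (Suc n))) c = images (ups (level S (Suc n)) c) (ups S c) \<union>
     images (downs (level S (Suc n)) c) (downs S (\<not> c))"
  by (simp add: ups_def downs_def Let_def)

lemma downs_level:
  "downs (level S (Suc (Suc n))) c = images (ups (level S (Suc n)) c) (downs S c) \<union>
     images (downs (level S (Suc n)) c) (ups S (\<not> c))"
  by (simp add: ups_def downs_def Let_def)

lemma finite_idx: "finite (idx s)"
proof -
  have "idx s \<subseteq> (\<lambda>(a, b, c). vector [a, b, c]) ` ({0..s} \<times> {0..s} \<times> {0..s})"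
  proof
    fix k assume k: "k \<in> idx s"
    have "k = vector [k $ 1, k $ 2, k $ 3]" by (simp add: vec_eq_iff forall_3)
    moreover have "k $ i \<in> {0..s}" for i using k idx_le[OF k, of i] by (auto simp: idx_def)
    ultimately show "k \<in> (\<lambda>(a, b, c). vector [a, b, c]) ` ({0..s} \<times> {0..s} \<times> {0..s})"
      by (intro image_eqI[of _ _ "(k $ 1, k $ 2, k $ 3)"]) auto
  qed
  then show ?thesis by (rule finite_subset) auto
qed

lemma INT_atLeast_1: "(\<Inter>n\<in>{1..}. X n) = (\<Inter>n. X (Suc n))"
proof -
  have "{1..} = range Suc" by (auto simp: image_iff Suc_le_eq gr0_conv_Suc)
  then show ?thesis by (simp add: image_image)
qed

locale labyrinth =
  fixes m :: nat and S :: pattern_sets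
  assumes labyrinth: "labyrinth_patterns_system m S"
begin

lemma m_ge_2: "2 \<le> m"
  using labyrinth by (simp add: labyrinth_patterns_system_def patterns_system_def)

lemma m_pos: "0 < m"
  using m_ge_2 by simp

lemma ups_subset: "ups S c \<subseteq> TT m" and downs_subset: "downs S c \<subseteq> TT' m"
  using labyrinth by (auto simp: labyrinth_patterns_system_def patterns_system_def ups_def downs_def)

definition cells :: "bool \<Rightarrow> triangle set" where
  "cells c = ups S c \<union> downs S c"

text \<open>A triangle \<open>T'\<close> of a pattern is subdivided, after a half turn, by the pattern of the other colour.\<close>

definition colour :: "bool \<Rightarrow> triangle \<Rightarrow> bool" where
  "colour c U = (if U \<in> TT m then c else \<not> c)"

lemma TT_TT'_disjoint: "U \<in> TT m \<Longrightarrow> U \<notin> TT' m"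
  using T_neq_T'[OF _ _ m_pos] by (auto simp: TT_def TT'_def)

lemma cells_cases [consumes 1, case_names up down]:
  assumes "U \<in> cells c"
  obtains k where "k \<in> idx (int m - 1)" "U = T m k" "U \<in> TT m" "U \<in> ups S c" "colour c U = c"
  | k where "k \<in> idx (int m - 2)" "U = T' m k" "U \<notin> TT m" "U \<in> downs S c" "colour c U = (\<not> c)"
proof (cases "U \<in> ups S c")
  case True
  then have "U \<in> TT m" using ups_subset by blast
  then show ?thesis using that(1) True by (auto simp: TT_def colour_def)
next
  case False
  then have "U \<in> downs S c" "U \<in> TT' m" using assms downs_subset by (auto simp: cells_def)
  moreover then have "U \<notin> TT m" using TT_TT'_disjoint by blast
  ultimately show ?thesis using that(2) by (auto simp: TT'_def colour_def)
qed

lemma finite_cells: "finite (cells c)"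
proof -
  have "cells c \<subseteq> TT m \<union> TT' m" using ups_subset downs_subset by (auto simp: cells_def)
  then show ?thesis by (rule finite_subset) (simp add: TT_def TT'_def finite_idx)
qed

lemma dist_cell_map: "U \<in> cells c \<Longrightarrow> dist (cell_map U x) (cell_map U y) = dist x y / m"
  by (cases rule: cells_cases)
    (use m_pos in \<open>auto simp: cell_map_T cell_map_T' dist_norm norm_minus_commute simp flip: scaleR_diff_right\<close>)

lemma cell_map_inj: "U \<in> cells c \<Longrightarrow> cell_map U x = cell_map U y \<longleftrightarrow> x = y"
  using dist_cell_map[of U c x y] m_pos by auto

lemma cell_map_base: "U \<in> cells c \<Longrightarrow> x \<in> base \<Longrightarrow> cell_map U x \<in> base"
  by (cases rule: cells_cases) (use m_pos in \<open>auto simp: cell_map_T_base cell_map_T'_base\<close>)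

lemma cell_vertex_base: "U \<in> cells c \<Longrightarrow> U $ i \<in> base"
  using cell_map_base[OF _ base_P] by (metis cell_map_P)

text \<open>One step of the Hutchinson operator of the graph-directed system.\<close>

definition subdivide :: "(bool \<Rightarrow> point set) \<Rightarrow> bool \<Rightarrow> point set" where
  "subdivide X c = (\<Union>U\<in>cells c. cell_map U ` X (colour c U))"

lemma subdivide_eq:
  "subdivide X c = (\<Union>U\<in>ups S c. cell_map U ` X c) \<union> (\<Union>U\<in>downs S c. cell_map U ` X (\<not> c))"
proof -
  have "colour c U = c" if "U \<in> ups S c" for U using that ups_subset by (auto simp: colour_def)
  moreover have "colour c U = (\<not> c)" if "U \<in> downs S c" for U
    using that downs_subset TT_TT'_disjoint by (auto simp: colour_def)
  ultimately show ?thesis by (auto simp: subdivide_def cells_def)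
qed

text \<open>The levels append the new cells innermost, so the induction step replaces
  \<open>X\<close> by \<open>subdivide X\<close>; this is why \<open>X\<close> is an arbitrary
  family.\<close>

lemma level_subdivide:
  "(\<Union>U\<in>ups (level S (Suc n)) c. cell_map U ` X c) \<union> (\<Union>U\<in>downs (level S (Suc n)) c. cell_map U ` X (\<not> c))
     = (subdivide ^^ Suc n) X c"
proof (induction n arbitrary: X c)
  case 0
  then show ?case by (simp add: subdivide_eq)
next
  case (Suc n)
  have *: "(\<Union>W\<in>images A B. cell_map W ` Y) = (\<Union>U\<in>A. cell_map U ` (\<Union>V\<in>B. cell_map V ` Y))"
    if "B \<subseteq> cells c'" for A B c' and Y :: "point set"
  proof -
    have "cell_map (tri_image U V) ` Y = cell_map U ` cell_map V ` Y" if "V \<in> B" for U V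
      using that \<open>B \<subseteq> cells c'\<close> cell_vertex_base[of V c'] by (simp add: image_image cell_map_tri_image subset_iff)
    then show ?thesis by (simp add: UN_images image_UN)
  qed
  have sub: "ups S c' \<subseteq> cells c'" "downs S c' \<subseteq> cells c'" for c' by (auto simp: cells_def)
  have "(\<Union>U\<in>ups (level S (Suc (Suc n))) c. cell_map U ` X c) \<union>
      (\<Union>U\<in>downs (level S (Suc (Suc n))) c. cell_map U ` X (\<not> c))
    = (\<Union>U\<in>ups (level S (Suc n)) c. cell_map U ` subdivide X c) \<union>
      (\<Union>U\<in>downs (level S (Suc n)) c. cell_map U ` subdivide X (\<not> c))"
    unfolding ups_level downs_level UN_Un *[OF sub(1)] *[OF sub(2)]
    unfolding subdivide_eq image_Un UN_Un_distrib by (simp only: Un_ac not_not)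
  also have "\<dots> = (subdivide ^^ Suc (Suc n)) X c" unfolding Suc by (simp add: funpow_swap1)
  finally show ?case .
qed

definition approx :: "nat \<Rightarrow> bool \<Rightarrow> point set" where
  "approx n = (subdivide ^^ n) (\<lambda>_. base)"

definition fractal :: "bool \<Rightarrow> point set" where
  "fractal c = (\<Inter>n. approx n c)"

lemma approx_0: "approx 0 c = base"
  by (simp add: approx_def)

lemma approx_Suc: "approx (Suc n) c = (\<Union>U\<in>cells c. cell_map U ` approx n (colour c U))"
  by (simp add: approx_def subdivide_def)

lemma approx_Suc_subset: "approx (Suc n) c \<subseteq> approx n c"
proof (induction n arbitrary: c)
  case 0
  then show ?case using cell_map_base by (force simp: approx_Suc approx_0)
next
  case (Suc n)
  then show ?case unfolding approx_Suc[of "Suc n"] approx_Suc[of n] by blast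
qed

lemma approx_mono: "n \<le> n' \<Longrightarrow> approx n' c \<subseteq> approx n c"
  using lift_Suc_antimono_le[where f = "\<lambda>n. approx n c"] approx_Suc_subset by blast

lemma compact_approx: "compact (approx n c)"
proof (induction n arbitrary: c)
  case 0
  then show ?case by (simp add: approx_0 compact_base)
next
  case (Suc n)
  then show ?case unfolding approx_Suc
    by (intro compact_UN finite_cells compact_continuous_image continuous_cell_map)
qed

lemma fractal_base: "fractal c \<subseteq> base"
  unfolding fractal_def using approx_0 by blast

lemma compact_fractal: "compact (fractal c)"
proof -
  have "closed (fractal c)"
    unfolding fractal_def by (intro closed_INT ballI compact_imp_closed compact_approx)
  then show ?thesis using fractal_base compact_base by (metis compact_Int_closed inf.absorb_iff2)
qed

text \<open>There are finitely many cells and the approximations decrease, so a single cell contains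
  \<open>x\<close> at all levels; injectivity of its map makes the preimage the same point at each
  level.\<close>

lemma fractalE:
  assumes "x \<in> fractal c"
  obtains U y where "U \<in> cells c" "y \<in> fractal (colour c U)" "x = cell_map U y"
proof -
  have "\<exists>U\<in>cells c. \<forall>n. x \<in> cell_map U ` approx n (colour c U)"
  proof (rule ccontr)
    assume "\<not> ?thesis"
    then have "\<forall>U\<in>cells c. \<exists>n. x \<notin> cell_map U ` approx n (colour c U)" by blast
    then obtain N where N: "\<And>U. U \<in> cells c \<Longrightarrow> x \<notin> cell_map U ` approx (N U) (colour c U)" by metis
    have fin: "finite (N ` cells c)" using finite_cells by blast
    have "x \<in> approx (Suc (Max (N ` cells c))) c" using assms by (simp add: fractal_def)
    then obtain U where U: "U \<in> cells c" "x \<in> cell_map U ` approx (Max (N ` cells c)) (colour c U)"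
      by (auto simp: approx_Suc)
    have "N U \<le> Max (N ` cells c)" using U(1) fin by (intro Max_ge) auto
    then show False using N[OF U(1)] U(2) approx_mono by blast
  qed
  then obtain U where U: "U \<in> cells c" "\<And>n. x \<in> cell_map U ` approx n (colour c U)" by blast
  obtain y where y: "x = cell_map U y" using U(2)[of 0] by blast
  have "y \<in> approx n (colour c U)" for n
  proof -
    obtain z where "z \<in> approx n (colour c U)" "x = cell_map U z" using U(2)[of n] by blast
    then show ?thesis using y cell_map_inj[OF U(1)] by simp
  qed
  then show ?thesis using that[OF U(1) _ y] by (simp add: fractal_def)
qed

lemma fractal_eq: "white_fractal S = fractal True" "yellow_fractal S = fractal False"
proof -
  have *: "(\<Inter>n\<in>{1..}. \<Union> (region ` (ups (level S n) c \<union> downs (level S n) c))) = fractal c" for c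
  proof -
    have "(\<Union> (region ` (ups (level S (Suc n)) c \<union> downs (level S (Suc n)) c))) = approx (Suc n) c" for n
      using level_subdivide[where X = "\<lambda>_. base"] by (simp add: approx_def region_eq image_Un del: funpow.simps)
    moreover have "(\<Inter>n. approx (Suc n) c) = fractal c"
      unfolding fractal_def using approx_Suc_subset by blast
    ultimately show ?thesis unfolding INT_atLeast_1 by simp
  qed
  show "white_fractal S = fractal True" "yellow_fractal S = fractal False"
    using *[of True] *[of False]
    by (simp_all add: white_fractal_def yellow_fractal_def white_all_def yellow_all_def ups_def downs_def)
qed

end

lemma images_TT:
  assumes "0 < M" "0 < m"
  shows "A \<subseteq> TT M \<Longrightarrow> B \<subseteq> TT m \<Longrightarrow> images A B \<subseteq> TT (M * m)"
    "A \<subseteq> TT M \<Longrightarrow> B \<subseteq> TT' m \<Longrightarrow> images A B \<subseteq> TT' (M * m)"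
    "A \<subseteq> TT' M \<Longrightarrow> B \<subseteq> TT m \<Longrightarrow> images A B \<subseteq> TT' (M * m)"
    "A \<subseteq> TT' M \<Longrightarrow> B \<subseteq> TT' m \<Longrightarrow> images A B \<subseteq> TT (M * m)"
proof -
  note im = tri_image_TT[OF _ _ assms] tri_image_TT'[OF _ _ assms]
    tri_image_T'T[OF _ _ assms] tri_image_T'T'[OF _ _ assms]
  show "A \<subseteq> TT M \<Longrightarrow> B \<subseteq> TT m \<Longrightarrow> images A B \<subseteq> TT (M * m)"
    by (fastforce simp: images_def TT_def TT'_def im simp del: of_nat_mult)
  show "A \<subseteq> TT M \<Longrightarrow> B \<subseteq> TT' m \<Longrightarrow> images A B \<subseteq> TT' (M * m)"
    by (fastforce simp: images_def TT_def TT'_def im simp del: of_nat_mult)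
  show "A \<subseteq> TT' M \<Longrightarrow> B \<subseteq> TT m \<Longrightarrow> images A B \<subseteq> TT' (M * m)"
    by (fastforce simp: images_def TT_def TT'_def im simp del: of_nat_mult)
  show "A \<subseteq> TT' M \<Longrightarrow> B \<subseteq> TT' m \<Longrightarrow> images A B \<subseteq> TT (M * m)"
    by (fastforce simp: images_def TT_def TT'_def im simp del: of_nat_mult)
qed

context labyrinth
begin

section \<open>Exit points\<close>

lemma exit_at_unique: "\<forall>i. \<exists>!a. exit_at m S i a"
  using labyrinth unfolding labyrinth_patterns_system_def exit_at_unique_iff by blast

definition exit_pos :: "3 \<Rightarrow> int" where
  "exit_pos i = (THE a. exit_at m S i a)"

definition exit_idx :: "bool \<Rightarrow> 3 \<Rightarrow> int ^ 3" where
  "exit_idx c i = side_idx m i (if c then exit_pos i else int m - 1 - exit_pos i)"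

definition exit_cell :: "bool \<Rightarrow> 3 \<Rightarrow> triangle" where
  "exit_cell c i = T m (exit_idx c i)"

text \<open>The fixed point of the map of the exit cell: a coordinate with constant digit
  \<open>k\<close> in base \<open>m\<close> equals \<open>k / (m - 1)\<close>.\<close>

definition exit_point :: "bool \<Rightarrow> 3 \<Rightarrow> point" where
  "exit_point c i = (\<Sum>l\<in>UNIV. (exit_idx c i $ l / (real m - 1)) *\<^sub>R P $ l)"

lemma exit_pos: "exit_at m S i (exit_pos i)"
  unfolding exit_pos_def using exit_at_unique by (blast intro: theI')

lemma exit_idx: "exit_idx c i \<in> idx (int m - 1)"
  unfolding exit_idx_def using exit_pos[of i] by (intro side_idx_in) (auto simp: exit_at_def)

lemma exit_idx_zero: "exit_idx c i $ i = 0"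
  by (simp add: exit_idx_def side_idx_zero)

lemma exit_idx_complement: "l \<noteq> i \<Longrightarrow> exit_idx (\<not> c) i $ l = int m - 1 - exit_idx c i $ l"
  using side_idx_complement[of l i m] by (cases c) (auto simp: exit_idx_def)

lemma exit_cell_ups: "exit_cell c i \<in> ups S c"
  using exit_pos[of i] by (auto simp: exit_cell_def exit_idx_def exit_at_def ups_def)

lemma exit_cell_cells: "exit_cell c i \<in> cells c"
  using exit_cell_ups by (simp add: cells_def)

lemma exit_cell_TT: "exit_cell c i \<in> TT m"
  using exit_cell_ups ups_subset by blast

lemma exit_cell_eq: "white_exit m S i = exit_cell True i" "yellow_exit m S i = exit_cell False i"
  using exits_eq[OF exit_at_unique exit_pos] by (simp_all add: exit_cell_def exit_idx_def)

text \<open>Cells of the two colours in mirror positions on side \<open>i\<close> satisfy the exit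
  condition, so uniqueness identifies them with the exits.\<close>

lemma exit_idx_eqI:
  assumes "k \<in> idx (int m - 1)" "k' \<in> idx (int m - 1)" "k $ i = 0" "k' $ i = 0"
    and "\<And>l. l \<noteq> i \<Longrightarrow> k' $ l = int m - 1 - k $ l" "T m k \<in> ups S c" "T m k' \<in> ups S (\<not> c)"
  shows "k = exit_idx c i"
proof -
  obtain a where a: "a \<in> {0..int m - 1}" "k = side_idx m i a" using side_idxE assms(1,3) by blast
  have k': "k' = side_idx m i (int m - 1 - a)"
    unfolding vec_eq_iff
  proof
    fix l show "k' $ l = side_idx m i (int m - 1 - a) $ l"
      using assms a side_idx_complement[of l i m a] by (cases "l = i") (auto simp: side_idx_zero)
  qed
  show ?thesis
  proof (cases c)
    case True
    then have "exit_at m S i a" using a assms k' by (simp add: exit_at_def ups_def)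
    then have "a = exit_pos i" using exit_pos exit_at_unique by blast
    then show ?thesis using True a by (simp add: exit_idx_def)
  next
    case False
    then have "exit_at m S i (int m - 1 - a)" using a assms k' by (simp add: exit_at_def ups_def)
    then have "int m - 1 - a = exit_pos i" using exit_pos exit_at_unique by blast
    then have "a = int m - 1 - exit_pos i" by simp
    then show ?thesis using False a by (simp add: exit_idx_def)
  qed
qed

lemma real_m: "1 < real m"
  using m_ge_2 by simp

lemma bary_exit_point: "bary l (exit_point c i) = exit_idx c i $ l / (real m - 1)"
  unfolding exit_point_def
proof (rule bary_Pcomb)
  show "(\<Sum>l\<in>UNIV. exit_idx c i $ l / (real m - 1)) = 1"
    using idx_sum_real[OF exit_idx] real_m by (simp flip: sum_divide_distrib)
qed

lemma exit_point_base: "exit_point c i \<in> base"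
  using exit_idx[of c i] real_m by (simp add: base_def bary_exit_point idx_iff)

lemma bary_exit_point_zero: "bary i (exit_point c i) = 0"
  by (simp add: bary_exit_point exit_idx_zero)

lemma bary_exit_point_complement: "l \<noteq> i \<Longrightarrow> bary l (exit_point (\<not> c) i) = 1 - bary l (exit_point c i)"
  using real_m by (simp add: bary_exit_point exit_idx_complement diff_divide_distrib)

lemma exit_point_fixed: "cell_map (exit_cell c i) (exit_point c i) = exit_point c i"
  by (rule bary_eqI)
    (use real_m in \<open>simp add: exit_cell_def bary_cell_map_T[OF exit_idx m_pos] bary_exit_point field_simps\<close>)

lemma colour_exit_cell: "colour c (exit_cell c i) = c"
  by (simp add: colour_def exit_cell_TT)

lemma exit_point_fractal: "exit_point c i \<in> fractal c"
proof -
  have "exit_point c i \<in> approx n c" for n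
  proof (induction n)
    case 0
    then show ?case by (simp add: approx_0 exit_point_base)
  next
    case (Suc n)
    have "cell_map (exit_cell c i) (exit_point c i) \<in> approx (Suc n) c"
      unfolding approx_Suc using Suc exit_cell_cells by (intro UN_I imageI) (auto simp: colour_exit_cell)
    then show ?case by (simp add: exit_point_fixed)
  qed
  then show ?thesis by (simp add: fractal_def)
qed

lemma eq_0_if_le_powers: "(\<And>n. d \<le> (1 / real m) ^ n) \<Longrightarrow> d \<le> 0"
  using real_arch_pow_inv[of d "1 / real m"] real_m by (force simp: not_le[symmetric])

lemma eq_exit_pointI:
  assumes "\<And>n. x \<in> (cell_map (exit_cell c i) ^^ n) ` base"
  shows "x = exit_point c i"
proof -
  have d: "dist ((cell_map (exit_cell c i) ^^ n) y) (exit_point c i) = dist y (exit_point c i) * (1 / real m) ^ n" for n y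
  proof (induction n)
    case (Suc n)
    then show ?case
      using dist_cell_map[OF exit_cell_cells, of c i "(cell_map (exit_cell c i) ^^ n) y" "exit_point c i"]
      by (simp add: exit_point_fixed)
  qed simp
  have "dist x (exit_point c i) \<le> (1 / real m) ^ n" for n
  proof -
    obtain y where y: "y \<in> base" "x = (cell_map (exit_cell c i) ^^ n) y" using assms[of n] by blast
    show ?thesis unfolding y(2) d using dist_base[OF y(1) exit_point_base, of c i]
      by (intro mult_left_le_one_le) auto
  qed
  then have "dist x (exit_point c i) \<le> 0" by (rule eq_0_if_le_powers)
  then show ?thesis by simp
qed

lemma exit_regions:
  "(\<Inter>n. (cell_map (exit_cell c i) ^^ Suc n) ` base) = {exit_point c i}"
proof (intro set_eqI iffI)
  fix x assume x: "x \<in> (\<Inter>n. (cell_map (exit_cell c i) ^^ Suc n) ` base)"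
  have "x \<in> (cell_map (exit_cell c i) ^^ n) ` base" for n
  proof (cases n)
    case 0
    have "x \<in> cell_map (exit_cell c i) ` base" using INT_D[OF x, of 0] by simp
    then show ?thesis using 0 cell_map_base[OF exit_cell_cells] by auto
  next
    case (Suc k)
    then show ?thesis using INT_D[OF x, of k] by simp
  qed
  then show "x \<in> {exit_point c i}" using eq_exit_pointI by blast
next
  fix x assume x: "x \<in> {exit_point c i}"
  have "(cell_map (exit_cell c i) ^^ n) (exit_point c i) = exit_point c i" for n
    by (induction n) (simp_all add: exit_point_fixed)
  then have "exit_point c i \<in> (cell_map (exit_cell c i) ^^ Suc n) ` base" for n
    using exit_point_base by (metis imageI)
  then show "x \<in> (\<Inter>n. (cell_map (exit_cell c i) ^^ Suc n) ` base)" using x by blast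
qed

section \<open>Exits of all levels\<close>

lemma level_triangles:
  "ups (level S (Suc n)) c \<subseteq> TT (m ^ Suc n)" "downs (level S (Suc n)) c \<subseteq> TT' (m ^ Suc n)"
proof (induction n arbitrary: c)
  case 0
  { case 1 then show ?case using ups_subset by simp }
  { case 2 then show ?case using downs_subset by simp }
next
  case (Suc n)
  have M: "0 < m ^ Suc n" "m ^ Suc (Suc n) = m ^ Suc n * m" using m_pos by simp_all
  { case 1
    show ?case unfolding ups_level M(2)
      using Suc ups_subset downs_subset images_TT(1,4)[OF M(1) m_pos] by simp }
  { case 2
    show ?case unfolding downs_level M(2)
      using Suc ups_subset downs_subset images_TT(2,3)[OF M(1) m_pos] by simp }
qed

text \<open>A cell \<open>T'\<close> inside a cell \<open>T'\<close> has a complemented digit of at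
  least 1 in direction \<open>i\<close>. Hence a cell on side \<open>i\<close> is always a side cell
  inside a side cell.\<close>

lemma level_side_cell:
  assumes "T (m ^ Suc (Suc n)) k \<in> ups (level S (Suc (Suc n))) c" "k \<in> idx (int (m ^ Suc (Suc n)) - 1)" "k $ i = 0"
  obtains a b where "a \<in> {0..int (m ^ Suc n) - 1}" "b \<in> {0..int m - 1}"
    "T (m ^ Suc n) (side_idx (m ^ Suc n) i a) \<in> ups (level S (Suc n)) c" "T m (side_idx m i b) \<in> ups S c"
    "k = side_idx (m ^ Suc n * m) i (int m * a + b)"
proof -
  define M where "M = m ^ Suc n"
  have M: "0 < M" "m ^ Suc (Suc n) = M * m" using m_pos by (simp_all add: M_def)
  note k = assms[unfolded M(2)]
  note lv = level_triangles[of n, folded M_def]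
  consider U V where "U \<in> ups (level S (Suc n)) c" "V \<in> ups S c" "T (M * m) k = tri_image U V"
    | U V where "U \<in> downs (level S (Suc n)) c" "V \<in> downs S (\<not> c)" "T (M * m) k = tri_image U V"
    using k(1) unfolding ups_level images_def by blast
  then show ?thesis
  proof cases
    case 1
    obtain u where u: "u \<in> idx (int M - 1)" "U = T M u" using 1 lv(1) unfolding TT_def by blast
    obtain v where v: "v \<in> idx (int m - 1)" "V = T m v" using 1 ups_subset unfolding TT_def by blast
    have d: "k = digits m u v"
      using T_inj[OF _ k(2)] tri_image_TT[OF u(1) v(1) M(1) m_pos] 1(3) u(2) v(2) M(1) m_pos by simp
    have "0 \<le> u $ i" "0 \<le> v $ i" using u(1) v(1) by (auto simp: idx_iff)
    then have "u $ i = 0" "v $ i = 0" using d k(3) m_pos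
      by (auto simp: digits_nth add_nonneg_eq_0_iff)
    then obtain a b where "a \<in> {0..int M - 1}" "u = side_idx M i a" "b \<in> {0..int m - 1}" "v = side_idx m i b"
      using side_idxE u(1) v(1) by metis
    then show ?thesis using that[of a b] 1 u v d digits_side_idx by (simp add: M_def)
  next
    case 2
    obtain u where u: "u \<in> idx (int M - 2)" "U = T' M u" using 2 lv(2) unfolding TT'_def by blast
    obtain v where v: "v \<in> idx (int m - 2)" "V = T' m v" using 2 downs_subset unfolding TT'_def by blast
    have d: "k = codigits m u v"
      using T_inj[OF _ k(2)] tri_image_T'T'[OF u(1) v(1) M(1) m_pos] 2(3) u(2) v(2) M(1) m_pos by simp
    have "v $ i \<le> int m - 2" "0 \<le> int m * u $ i" using idx_le[OF v(1)] u(1) by (auto simp: idx_iff)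
    then have "0 < k $ i" by (simp add: d codigits_nth)
    then show ?thesis using k(3) by simp
  qed
qed

lemma level_side_cell_image:
  assumes "a \<in> {0..int (m ^ Suc n) - 1}" "b \<in> {0..int m - 1}"
  shows "T (m ^ Suc (Suc n)) (side_idx (m ^ Suc (Suc n)) i (int m * a + b)) =
     tri_image (T (m ^ Suc n) (side_idx (m ^ Suc n) i a)) (T m (side_idx m i b))"
proof -
  have M: "0 < m ^ Suc n" "m ^ Suc (Suc n) = m ^ Suc n * m" using m_pos by simp_all
  show ?thesis
    unfolding M(2) tri_image_TT(1)[OF side_idx_in[OF assms(1)] side_idx_in[OF assms(2)] M(1) m_pos]
      digits_side_idx ..
qed

text \<open>The hypothesis equates a multiple of \<open>m\<close> with
  \<open>b + b' + 1 - m\<close>, whose absolute value is less than \<open>m\<close>. Both vanish, so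
  complements are formed digit by digit.\<close>

lemma complement_digits:
  fixes a b a' b' :: int
  assumes "0 \<le> b" "b \<le> int m - 1" "0 \<le> b'" "b' \<le> int m - 1"
    "int m * a' + b' = int M * int m - 1 - (int m * a + b)"
  shows "b' = int m - 1 - b" "a' = int M - 1 - a"
proof -
  have eq: "int m * (int M - 1 - a - a') = b + b' + 1 - int m"
    using assms(5) by (simp add: algebra_simps)
  have "\<bar>b + b' + 1 - int m\<bar> < int m" using assms m_pos by auto
  then have "\<bar>int M - 1 - a - a'\<bar> < 1"
    unfolding eq[symmetric] abs_mult using m_pos by simp
  then have "int M - 1 - a - a' = 0" by simp
  then show "b' = int m - 1 - b" "a' = int M - 1 - a" using eq by auto
qed

text \<open>White and yellow side cells both split into digits, and the mirror condition does so
  too. Existence and uniqueness of exits thus pass to the next level.\<close>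

lemma exit_at_level_Suc:
  "exit_at (m ^ Suc (Suc n)) (level S (Suc (Suc n))) i d \<longleftrightarrow>
     (\<exists>a b. exit_at (m ^ Suc n) (level S (Suc n)) i a \<and> exit_at m S i b \<and> d = int m * a + b)"
proof -
  define M where "M = m ^ Suc n"
  have M: "0 < M" "m ^ Suc (Suc n) = M * m" using m_pos by (simp_all add: M_def)
  show ?thesis
  proof
    assume "exit_at (m ^ Suc (Suc n)) (level S (Suc (Suc n))) i d"
    then have d: "d \<in> {0..int (m ^ Suc (Suc n)) - 1}"
      "T (m ^ Suc (Suc n)) (side_idx (m ^ Suc (Suc n)) i d) \<in> ups (level S (Suc (Suc n))) True"
      "T (m ^ Suc (Suc n)) (side_idx (m ^ Suc (Suc n)) i (int (m ^ Suc (Suc n)) - 1 - d)) \<in> ups (level S (Suc (Suc n))) False"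
      by (auto simp: exit_at_def ups_def)
    obtain a b where ab: "a \<in> {0..int M - 1}" "b \<in> {0..int m - 1}"
      "T M (side_idx M i a) \<in> ups (level S (Suc n)) True" "T m (side_idx m i b) \<in> ups S True"
      and abd: "side_idx (M * m) i d = side_idx (M * m) i (int m * a + b)"
      by (rule level_side_cell[OF d(2) side_idx_in[OF d(1)] side_idx_zero, folded M_def, unfolded M(2)])
    have d': "int (m ^ Suc (Suc n)) - 1 - d \<in> {0..int (m ^ Suc (Suc n)) - 1}" using d(1) by simp
    obtain a' b' where ab': "a' \<in> {0..int M - 1}" "b' \<in> {0..int m - 1}"
      "T M (side_idx M i a') \<in> ups (level S (Suc n)) False" "T m (side_idx m i b') \<in> ups S False"
      and abd': "side_idx (M * m) i (int (M * m) - 1 - d) = side_idx (M * m) i (int m * a' + b')"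
      by (rule level_side_cell[OF d(3) side_idx_in[OF d'] side_idx_zero, folded M_def, unfolded M(2)])
    note dd = abd[unfolded side_idx_inj] abd'[unfolded side_idx_inj]
    have "b' = int m - 1 - b" "a' = int M - 1 - a"
      using complement_digits[of b b' a' M a] ab ab' dd by auto
    then show "\<exists>a b. exit_at (m ^ Suc n) (level S (Suc n)) i a \<and> exit_at m S i b \<and> d = int m * a + b"
      using ab ab' dd unfolding exit_at_def M_def[symmetric] by (auto simp: ups_def)
  next
    assume "\<exists>a b. exit_at (m ^ Suc n) (level S (Suc n)) i a \<and> exit_at m S i b \<and> d = int m * a + b"
    then obtain a b where ab: "exit_at M (level S (Suc n)) i a" "exit_at m S i b" "d = int m * a + b"
      unfolding M_def by blast
    have r: "a \<in> {0..int M - 1}" "b \<in> {0..int m - 1}" using ab by (auto simp: exit_at_def)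
    then have r': "int M - 1 - a \<in> {0..int M - 1}" "int m - 1 - b \<in> {0..int m - 1}" by auto
    have "int m * a \<le> int m * (int M - 1)" using r by (intro mult_left_mono) auto
    then have "d \<in> {0..int (M * m) - 1}" using r ab(3) m_pos by (auto simp: algebra_simps)
    moreover have compl: "int (M * m) - 1 - d = int m * (int M - 1 - a) + (int m - 1 - b)"
      using ab(3) by (simp add: algebra_simps)
    moreover have "tri_image (T M (side_idx M i a)) (T m (side_idx m i b)) \<in> ups (level S (Suc (Suc n))) True"
      "tri_image (T M (side_idx M i (int M - 1 - a))) (T m (side_idx m i (int m - 1 - b)))
        \<in> ups (level S (Suc (Suc n))) False"
      unfolding ups_level using ab(1,2) by (auto simp: exit_at_def ups_def images_def simp del: level.simps)
    ultimately show "exit_at (m ^ Suc (Suc n)) (level S (Suc (Suc n))) i d"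
      using level_side_cell_image[of a n b i, folded M_def, unfolded M(2), OF r]
        level_side_cell_image[of "int M - 1 - a" n "int m - 1 - b" i, folded M_def, unfolded M(2), OF r']
      unfolding exit_at_def M(2) ab(3)[symmetric] compl[symmetric] by (simp add: ups_def del: level.simps)
  qed
qed

lemma exit_at_level_unique: "\<forall>i. \<exists>!a. exit_at (m ^ Suc n) (level S (Suc n)) i a"
proof (induction n)
  case 0
  then show ?case using exit_at_unique by simp
next
  case (Suc n)
  then show ?case using exit_at_unique unfolding exit_at_level_Suc by metis
qed

lemma exit_level_Suc:
  "white_exit (m ^ Suc (Suc n)) (level S (Suc (Suc n))) i =
     tri_image (white_exit (m ^ Suc n) (level S (Suc n)) i) (exit_cell True i)" (is ?w)
  "yellow_exit (m ^ Suc (Suc n)) (level S (Suc (Suc n))) i =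
     tri_image (yellow_exit (m ^ Suc n) (level S (Suc n)) i) (exit_cell False i)" (is ?y)
proof -
  obtain a where a: "exit_at (m ^ Suc n) (level S (Suc n)) i a" using exit_at_level_unique by blast
  define b where "b = exit_pos i"
  have b: "exit_at m S i b" unfolding b_def by (rule exit_pos)
  have d: "exit_at (m ^ Suc (Suc n)) (level S (Suc (Suc n))) i (int m * a + b)"
    unfolding exit_at_level_Suc using a b by blast
  have r: "a \<in> {0..int (m ^ Suc n) - 1}" "b \<in> {0..int m - 1}" using a b by (auto simp: exit_at_def)
  then have r': "int (m ^ Suc n) - 1 - a \<in> {0..int (m ^ Suc n) - 1}" "int m - 1 - b \<in> {0..int m - 1}" by auto
  have eq: "int (m ^ Suc (Suc n)) - 1 - (int m * a + b) = int m * (int (m ^ Suc n) - 1 - a) + (int m - 1 - b)"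
    by (simp add: algebra_simps)
  show ?w ?y
    unfolding exits_eq[OF exit_at_level_unique d] exits_eq[OF exit_at_level_unique a] eq
      level_side_cell_image[OF r] level_side_cell_image[OF r']
    by (simp_all add: exit_cell_def exit_idx_def b_def)
qed

lemma cell_map_exit_level:
  "cell_map (white_exit (m ^ Suc n) (level S (Suc n)) i) = cell_map (exit_cell True i) ^^ Suc n"
  "cell_map (yellow_exit (m ^ Suc n) (level S (Suc n)) i) = cell_map (exit_cell False i) ^^ Suc n"
proof (induction n)
  case 0
  { case 1 then show ?case by (simp add: exit_cell_eq) }
  { case 2 then show ?case by (simp add: exit_cell_eq) }
next
  case (Suc n)
  have *: "cell_map (tri_image U (exit_cell c i)) = cell_map U \<circ> cell_map (exit_cell c i)" for U c
    using cell_vertex_base[OF exit_cell_cells] by (intro ext) (simp only: cell_map_tri_image o_apply)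
  { case 1
    show ?case unfolding exit_level_Suc * Suc funpow_Suc_right[of "Suc n"] .. }
  { case 2
    show ?case unfolding exit_level_Suc * Suc funpow_Suc_right[of "Suc n"] .. }
qed

lemma exit_point_eq:
  "white_exit_point m S i = exit_point True i" "yellow_exit_point m S i = exit_point False i"
  unfolding white_exit_point_def yellow_exit_point_def INT_atLeast_1 region_eq cell_map_exit_level exit_regions
  by auto

end

section \<open>Intersections of cells\<close>

lemma bary_eq_1: "x \<in> base \<Longrightarrow> bary i x = 1 \<Longrightarrow> x = P $ i"
proof (rule bary_eqI)
  fix l assume x: "x \<in> base" "bary i x = 1"
  have "(\<Sum>l\<in>UNIV - {i}. bary l x) = 0"
    using sum_bary[of x] x(2) by (simp add: sum.remove[of _ i])
  then have "\<forall>l\<in>UNIV - {i}. bary l x = 0"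
    using x(1) by (subst (asm) sum_nonneg_eq_0_iff) (auto simp: base_def)
  then show "bary l x = bary l (P $ i)" using x(2) by (auto simp: bary_P)
qed

text \<open>The differences are integers with sum 0 and not all zero, so one coordinate rises and
  another falls by at least 1; within the triangle both moves run between vertices. This serves
  cells of equal orientation.\<close>

lemma integral_difference:
  assumes "x \<in> base" "y \<in> base" "\<And>i. bary i x - bary i y \<in> \<int>" "x \<noteq> y"
  obtains p q where "p \<noteq> q" "x = P $ p" "y = P $ q"
proof -
  have big: "\<exists>i. bary i x - bary i y \<ge> 1" if ne: "x \<noteq> y" and int: "\<And>i. bary i x - bary i y \<in> \<int>" for x y
  proof (rule ccontr)
    assume "\<not> ?thesis"
    then have lt: "bary i x - bary i y < 1" for i by (simp add: not_le)
    have le: "bary i x - bary i y \<le> 0" for i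
    proof -
      obtain n where "bary i x - bary i y = of_int n" using int[of i] by (auto elim: Ints_cases)
      then show ?thesis using lt[of i] by simp
    qed
    have "(\<Sum>i\<in>UNIV. bary i y - bary i x) = 0" by (simp add: sum_subtractf sum_bary)
    then have "\<forall>i\<in>UNIV. bary i y - bary i x = 0" using le by (subst (asm) sum_nonneg_eq_0_iff) auto
    then show False using ne bary_eqI[of x y] by auto
  qed
  obtain p where p: "bary p x - bary p y \<ge> 1" using big assms(3,4) by blast
  obtain q where q: "bary q y - bary q x \<ge> 1"
    using big[of y x] assms(3,4) Ints_minus[of "bary i x - bary i y" for i] by force
  have "0 \<le> bary p y" "0 \<le> bary q x" using assms(1,2) by (auto simp: base_def)
  then have pq: "bary p x = 1" "bary q y = 1" "bary p y = 0"
    using p q bary_le_1[OF assms(1), of p] bary_le_1[OF assms(2), of q] by auto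
  then have "p \<noteq> q" by auto
  then show ?thesis using that pq bary_eq_1 assms(1,2) by blast
qed

lemma integral_coords:
  assumes "x \<in> base" "\<And>i. bary i x \<in> \<int>"
  obtains p where "x = P $ p"
proof -
  have "(\<Sum>i\<in>UNIV. bary i x) \<noteq> 0" by (simp add: sum_bary)
  then obtain i where "bary i x \<noteq> 0" by (meson sum.neutral)
  moreover have "0 \<le> bary i x" "bary i x \<le> 1" using assms(1) bary_le_1 by (auto simp: base_def)
  ultimately have "bary i x = 1" using assms(2)[of i] by (auto elim!: Ints_cases)
  then show ?thesis using that bary_eq_1 assms(1) by blast
qed

text \<open>The three sums are integers between 0 and 2 with total 2, so they are 2, 0, 0 or 1, 1, 0
  in some order: a common vertex or a common side. This serves cells of opposite
  orientation.\<close>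

lemma integral_sum:
  assumes "x \<in> base" "y \<in> base" "\<And>i. bary i x + bary i y \<in> \<int>"
  obtains p where "x = P $ p" "y = P $ p"
  | j where "bary j x = 0" "bary j y = 0" "\<And>l. l \<noteq> j \<Longrightarrow> bary l x + bary l y = 1"
proof -
  have r: "0 \<le> bary i x" "bary i x \<le> 1" "0 \<le> bary i y" "bary i y \<le> 1" for i
    using assms(1,2) bary_le_1 by (auto simp: base_def)
  have val: "bary i x + bary i y = 0 \<or> bary i x + bary i y = 1 \<or> bary i x + bary i y = 2" for i
  proof -
    obtain n where n: "bary i x + bary i y = of_int n" using assms(3)[of i] by (auto elim: Ints_cases)
    have "0 \<le> n" "n \<le> 2" using r[of i] n by linarith+
    then have "n = 0 \<or> n = 1 \<or> n = 2" by auto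
    then show ?thesis using n by auto
  qed
  show ?thesis
  proof (cases "\<exists>p. bary p x + bary p y = 2")
    case True
    then obtain p where "bary p x + bary p y = 2" by blast
    then have "bary p x = 1" "bary p y = 1" using r[of p] by linarith+
    then show ?thesis using that(1) bary_eq_1 assms(1,2) by blast
  next
    case False
    have sum2: "(\<Sum>i\<in>UNIV. bary i x + bary i y) = 2" by (simp add: sum.distrib sum_bary)
    have "\<exists>j. bary j x + bary j y = 0"
    proof (rule ccontr)
      assume "\<not> ?thesis"
      then have "bary i x + bary i y = 1" for i using val[of i] False by blast
      then show False using sum2 by simp
    qed
    then obtain j where j: "bary j x + bary j y = 0" by blast
    have "bary l x + bary l y = 1" if "l \<noteq> j" for l
    proof (rule ccontr)
      assume "bary l x + bary l y \<noteq> 1"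
      then have l: "bary l x + bary l y = 0" using val[of l] False by blast
      obtain k where k: "k \<noteq> l" "k \<noteq> j" by (rule third_label)
      then have "bary k x + bary k y = 2" using sum2 sum_three[of l j k "\<lambda>i. bary i x + bary i y"] that j l by auto
      then show False using False by blast
    qed
    then show ?thesis using that(2)[of j] j r[of j] by force
  qed
qed

context labyrinth
begin

section \<open>Corners of the fractals and points shared by two cells\<close>

lemma corner_idx_unique:
  assumes "k \<in> idx (int m - 1)" "k $ p = int m - 1"
  shows "k $ l = (if l = p then int m - 1 else 0)"
proof (cases "l = p")
  case False
  have "(\<Sum>i\<in>UNIV - {p}. k $ i) = 0"
    using assms by (simp add: idx_iff sum.remove[of _ p])
  then have "\<forall>i\<in>UNIV - {p}. k $ i = 0"
    using assms(1) by (subst (asm) sum_nonneg_eq_0_iff) (auto simp: idx_iff)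
  then show ?thesis using False by auto
qed (use assms in simp)

text \<open>A cell \<open>T'\<close> does not reach a corner, since its coordinates are at most
  \<open>(m - 1) / m\<close>. So the corner comes from a corner cell of the pattern, and the corners
  property carries over to the fractals.\<close>

lemma fractal_corner:
  assumes "P $ p \<in> fractal c"
  obtains k where "k \<in> idx (int m - 1)" "k $ p = int m - 1" "T m k \<in> corners (ups S c)"
proof -
  obtain U y where U: "U \<in> cells c" "y \<in> fractal (colour c U)" "P $ p = cell_map U y"
    using fractalE[OF assms] .
  have y: "y \<in> base" using U(2) fractal_base by blast
  from U(1) show ?thesis
  proof (cases rule: cells_cases)
    case (up k)
    have "(k $ p + bary p y) / m = 1"
      using bary_cell_map_T[OF up(1) m_pos, of p y] U(3)[symmetric] up(2) by (simp add: bary_P)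
    then have "k $ p + bary p y = m" using m_pos by (simp add: field_simps)
    moreover have "k $ p \<le> int m - 1" using idx_le[OF up(1)] .
    ultimately have "k $ p = int m - 1" using bary_le_1[OF y, of p] by linarith
    moreover have "P $ p \<in> region U" unfolding region_eq U(3) using y by blast
    ultimately show ?thesis using that[of k] up by (auto simp: corners_def)
  next
    case (down k)
    have "(k $ p + 1 - bary p y) / m = 1"
      using bary_cell_map_T'[OF down(1) m_pos, of p y] U(3)[symmetric] down(2) by (simp add: bary_P)
    then have "k $ p + 1 - bary p y = m" using m_pos by (simp add: field_simps)
    moreover have "k $ p \<le> int m - 2" using idx_le[OF down(1)] .
    moreover have "0 \<le> bary p y" using y by (simp add: base_def)
    ultimately show ?thesis by linarith
  qed
qed

lemma corner_unique:
  assumes "P $ p \<in> fractal c" "P $ q \<in> fractal c"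
  shows "p = q"
proof -
  obtain k where k: "k \<in> idx (int m - 1)" "k $ p = int m - 1" "T m k \<in> corners (ups S c)"
    using fractal_corner[OF assms(1)] .
  obtain l where l: "l \<in> idx (int m - 1)" "l $ q = int m - 1" "T m l \<in> corners (ups S c)"
    using fractal_corner[OF assms(2)] .
  have "\<forall>U\<in>corners (ups S c). \<forall>V\<in>corners (ups S c). U = V"
    using labyrinth by (cases c) (auto simp: labyrinth_patterns_system_def ups_def)
  then have "T m k = T m l" using k l by blast
  then have "k = l" using T_inj k(1) l(1) m_pos by blast
  then have "k $ q = int m - 1" using l by simp
  then show ?thesis using corner_idx_unique[OF k(1,2), of q] m_ge_2 by (auto split: if_splits)
qed

lemma corner_disjoint: "P $ p \<in> fractal c \<Longrightarrow> P $ p \<notin> fractal (\<not> c)"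
proof
  assume *: "P $ p \<in> fractal c" "P $ p \<in> fractal (\<not> c)"
  obtain k where k: "k \<in> idx (int m - 1)" "k $ p = int m - 1" "T m k \<in> corners (ups S c)"
    using fractal_corner[OF *(1)] .
  obtain l where l: "l \<in> idx (int m - 1)" "l $ p = int m - 1" "T m l \<in> corners (ups S (\<not> c))"
    using fractal_corner[OF *(2)] .
  have "corners (ups S c) \<inter> corners (ups S (\<not> c)) = {}"
    using labyrinth by (cases c) (auto simp: labyrinth_patterns_system_def ups_def)
  moreover have "k = l"
    using corner_idx_unique[OF k(1,2)] corner_idx_unique[OF l(1,2)] by (simp add: vec_eq_iff)
  ultimately show False using k l by blast
qed

text \<open>\<open>y\<close> and \<open>z\<close> are positions of one point on the common side of two \<open>j\<close>-neighbours.\<close>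

definition facing :: "bool \<Rightarrow> 3 \<Rightarrow> point \<Rightarrow> point \<Rightarrow> bool" where
  "facing c j y z \<longleftrightarrow> y \<in> fractal c \<and> z \<in> fractal (\<not> c) \<and> bary j y = 0 \<and> bary j z = 0 \<and>
     (\<forall>l. l \<noteq> j \<longrightarrow> bary l y + bary l z = 1)"

text \<open>If \<open>y\<close> or \<open>z\<close> lay in a cell \<open>T'\<close>, it would be the
  image of the vertex \<open>P $ j\<close>, and the corners property would be violated. Hence both
  lie in upright cells on side \<open>j\<close>; their indices are complementary, so the cells are
  the exits, and the preimages face each other again.\<close>

lemma facing_descend:
  assumes "facing c j y z"
  obtains y' z' where "facing c j y' z'" "y = cell_map (exit_cell c j) y'"
proof -
  have f: "y \<in> fractal c" "z \<in> fractal (\<not> c)" "bary j y = 0" "bary j z = 0"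
    "\<And>l. l \<noteq> j \<Longrightarrow> bary l y + bary l z = 1" using assms by (auto simp: facing_def)
  obtain U y' where U: "U \<in> cells c" "y' \<in> fractal (colour c U)" "y = cell_map U y'" using fractalE[OF f(1)] .
  obtain V z' where V: "V \<in> cells (\<not> c)" "z' \<in> fractal (colour (\<not> c) V)" "z = cell_map V z'"
    using fractalE[OF f(2)] .
  note yU = U(2) and eqU = U(3) and zV = V(2) and eqV = V(3)
  have base: "y' \<in> base" "z' \<in> base" using U V fractal_base by blast+
  have sum_int: "real m * bary l y + real m * bary l z \<in> \<int>" for l
  proof (cases "l = j")
    case False
    have "real m * bary l y + real m * bary l z = real m"
      using f(5)[OF False] by (simp flip: distrib_left)
    then show ?thesis by simp
  qed (simp add: f)
  have up: "real m * bary l (cell_map (T m k) x) = k $ l + bary l x" if "k \<in> idx (int m - 1)" for k l x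
    using bary_cell_map_T[OF that m_pos] m_pos by simp
  have down: "real m * bary l (cell_map (T' m k) x) = k $ l + 1 - bary l x" if "k \<in> idx (int m - 2)" for k l x
    using bary_cell_map_T'[OF that m_pos] m_pos by simp
  have zero_up: "k $ j = 0 \<and> bary j x = 0"
    if "k \<in> idx (int m - 1)" "bary j (cell_map (T m k) x) = 0" "x \<in> base" for k x
  proof -
    have "0 \<le> k $ j" "0 \<le> bary j x" using that by (auto simp: idx_iff base_def)
    then show ?thesis using up[OF that(1), of j x] that(2) by (simp add: add_nonneg_eq_0_iff)
  qed
  have zero_down: "x = P $ j"
    if "k \<in> idx (int m - 2)" "bary j (cell_map (T' m k) x) = 0" "x \<in> base" for k x
  proof -
    have "0 \<le> k $ j" "bary j x \<le> 1" using that bary_le_1 by (auto simp: idx_iff)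
    then have "bary j x = 1" using down[OF that(1), of j x] that(2) by simp
    then show ?thesis using bary_eq_1 that(3) by blast
  qed
  from U(1) show ?thesis
  proof (cases rule: cells_cases)
    case U: (up k)
    have y'0: "k $ j = 0" "bary j y' = 0" using zero_up[OF U(1)] f(3) eqU U(2) base by auto
    have y'c: "y' \<in> fractal c" using yU U by simp
    from V(1) show ?thesis
    proof (cases rule: cells_cases)
      case V: (up l)
      have z'0: "l $ j = 0" "bary j z' = 0" using zero_up[OF V(1)] f(4) eqV V(2) base by auto
      have z'c: "z' \<in> fractal (\<not> c)" using zV V by simp
      have int: "bary i y' + bary i z' \<in> \<int>" for i
      proof -
        have "bary i y' + bary i z' = real m * bary i y + real m * bary i z - k $ i - l $ i"
          using up[OF U(1), of i y'] up[OF V(1), of i z'] U(2) V(2) eqU eqV by simp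
        then show ?thesis using sum_int[of i] by simp
      qed
      from integral_sum[OF base int] show ?thesis
      proof cases
        case (1 p)
        then show ?thesis using y'c z'c corner_disjoint by blast
      next
        case (2 j')
        have "j' = j" using 2(3)[of j] y'0 z'0 by (cases "j' = j") auto
        have "l $ i = int m - 1 - k $ i" if "i \<noteq> j" for i
        proof -
          have "real_of_int (k $ i) + l $ i = real m - 1"
            using up[OF U(1), of i y'] up[OF V(1), of i z'] U(2) V(2) eqU eqV
              f(5)[OF that] 2(3)[of i] that \<open>j' = j\<close> distrib_left[of "real m" "bary i y" "bary i z"] by simp
          then have "k $ i + l $ i = int m - 1" by linarith
          then show ?thesis by simp
        qed
        then have "k = exit_idx c j" using exit_idx_eqI[OF U(1) V(1)] y'0 z'0 U V by auto
        then have "U = exit_cell c j" using U(2) by (simp add: exit_cell_def)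
        then show ?thesis using that[of y' z'] y'c z'c y'0 z'0 2(3) \<open>j' = j\<close> eqU by (auto simp: facing_def)
      qed
    next
      case V: (down l)
      have z': "z' = P $ j" using zero_down[OF V(1)] f(4) eqV V(2) base by auto
      have "bary i y' \<in> \<int>" for i
      proof -
        have "bary i y' = (real m * bary i y + real m * bary i z) - k $ i - (l $ i + 1 - bary i (P $ j))"
          using up[OF U(1), of i y'] down[OF V(1), of i z'] U(2) V(2) eqU eqV z' by simp
        then show ?thesis using sum_int[of i] by (auto simp: bary_P)
      qed
      then obtain p where p: "y' = P $ p" using integral_coords base(1) by metis
      have "P $ j \<in> fractal c" using zV V z' by simp
      then have "p = j" using corner_unique y'c p by blast
      then show ?thesis using y'0 p by (simp add: bary_P)
    qed
  next
    case U: (down k)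
    have y': "y' = P $ j" using zero_down[OF U(1)] f(3) eqU U(2) base by auto
    have y'c: "P $ j \<in> fractal (\<not> c)" using yU U y' by simp
    from V(1) show ?thesis
    proof (cases rule: cells_cases)
      case V: (up l)
      have z'0: "l $ j = 0" "bary j z' = 0" using zero_up[OF V(1)] f(4) eqV V(2) base by auto
      have "bary i z' \<in> \<int>" for i
      proof -
        have "bary i z' = (real m * bary i y + real m * bary i z) - l $ i - (k $ i + 1 - bary i (P $ j))"
          using up[OF V(1), of i z'] down[OF U(1), of i y'] U(2) V(2) eqU eqV y' by simp
        then show ?thesis using sum_int[of i] by (auto simp: bary_P)
      qed
      then obtain p where p: "z' = P $ p" using integral_coords base(2) by metis
      have "z' \<in> fractal (\<not> c)" using zV V by simp
      then have "p = j" using corner_unique y'c p by blast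
      then show ?thesis using z'0 p by (simp add: bary_P)
    next
      case V: (down l)
      have "z' = P $ j" using zero_down[OF V(1)] f(4) eqV V(2) base by auto
      then have "P $ j \<in> fractal c" using zV V by simp
      then show ?thesis using y'c corner_disjoint by blast
    qed
  qed
qed

text \<open>Infinite descent: \<open>y\<close> lies in all nested images of the exit cell, which
  shrink to the exit point. The relation is symmetric under exchanging the colours, which handles
  \<open>z\<close>.\<close>

lemma facing_exit: "facing c j y z \<Longrightarrow> y = exit_point c j \<and> z = exit_point (\<not> c) j"
proof -
  have *: "y = exit_point c j" if "facing c j y z" for c y z
  proof (rule eq_exit_pointI)
    fix n show "y \<in> (cell_map (exit_cell c j) ^^ n) ` base"
      using that
    proof (induction n arbitrary: y z)
      case 0
      then show ?case using fractal_base by (auto simp: facing_def)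
    next
      case (Suc n)
      obtain y' z' where "facing c j y' z'" "y = cell_map (exit_cell c j) y'" using facing_descend[OF Suc.prems] .
      then show ?case using Suc.IH[of y' z'] by auto
    qed
  qed
  assume f: "facing c j y z"
  then have "facing (\<not> c) j z y" by (auto simp: facing_def add.commute)
  then show ?thesis using * f by blast
qed

text \<open>For equal orientation a common point would produce two distinct corners of one fractal.
  For opposite orientation a common vertex is a corner of both fractals; this leaves a common side,
  where the two positions face each other and hence are exit points.\<close>

lemma cells_Int:
  assumes U: "U \<in> cells c" and V: "V \<in> cells c" and "U \<noteq> V"
    and y: "y \<in> fractal (colour c U)" and z: "z \<in> fractal (colour c V)" and eq: "cell_map U y = cell_map V z"
  obtains j where "edge m (cells c) j U V" "y = exit_point (colour c U) j" "z = exit_point (colour c V) j"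
proof -
  have *: "\<exists>j. edge m (cells c) j U V \<and> y = exit_point (colour c U) j \<and> z = exit_point (colour c V) j"
    if U: "U \<in> cells c" and V: "V \<in> cells c" and yz: "y \<in> fractal (colour c U)" "z \<in> fractal (colour c V)"
      and eq: "cell_map U y = cell_map V z"
      and k: "k \<in> idx (int m - 1)" "U = T m k" "colour c U = c"
      and l: "l \<in> idx (int m - 2)" "V = T' m l" "colour c V = (\<not> c)" for U V y z k l
  proof -
    have base: "y \<in> base" "z \<in> base" using yz fractal_base by blast+
    have sum: "bary i y + bary i z = real_of_int (l $ i + 1 - k $ i)" for i
      using bary_cell_map_T[OF k(1) m_pos, of i y] bary_cell_map_T'[OF l(1) m_pos, of i z] eq k(2) l(2) m_pos
      by simp
    then have "bary i y + bary i z \<in> \<int>" for i by simp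
    from integral_sum[OF base this] show ?thesis
    proof cases
      case (1 p)
      then show ?thesis using yz k(3) l(3) corner_disjoint[of p c] by simp
    next
      case (2 j)
      have "k $ j = l $ j + 1" using sum[of j] 2(1,2) by simp
      moreover have "k $ i = l $ i" if "i \<noteq> j" for i using sum[of i] 2(3)[OF that] by simp
      ultimately have "k $ j = l $ j + 1" "\<forall>i. i \<noteq> j \<longrightarrow> k $ i = l $ i" by blast+
      then have "edge m (cells c) j U V" using U V k l unfolding edge_def neighbours_def by blast
      moreover have "facing c j y z" using yz 2 k l by (simp add: facing_def)
      ultimately show ?thesis using facing_exit[of c j y z] k(3) l(3) by (intro exI[of _ j]) simp
    qed
  qed
  have fb: "y \<in> base" "z \<in> base" using y z fractal_base by blast+
  have same: False if col: "colour c U = colour c V" and ne: "y \<noteq> z" and int: "\<And>i. bary i y - bary i z \<in> \<int>"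
  proof -
    obtain p q where "p \<noteq> q" "y = P $ p" "z = P $ q" by (rule integral_difference[OF fb int ne])
    then show False using corner_unique[of p "colour c U" q] y z col by simp
  qed
  from U show ?thesis
  proof (cases rule: cells_cases)
    case up: (up k)
    from V show ?thesis
    proof (cases rule: cells_cases)
      case up': (up l)
      have "bary i y - bary i z = real_of_int (l $ i - k $ i)" for i
        using bary_cell_map_T[OF up(1) m_pos, of i y] bary_cell_map_T[OF up'(1) m_pos, of i z] eq up(2) up'(2) m_pos
        by simp
      then have d: "bary i y - bary i z \<in> \<int>" "y = z \<Longrightarrow> k $ i = l $ i" for i by auto
      have "y = z \<Longrightarrow> k = l" using d(2) by (simp add: vec_eq_iff)
      then have "y \<noteq> z" using \<open>U \<noteq> V\<close> up(2) up'(2) by auto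
      then show ?thesis using same[OF _ _ d(1)] up(5) up'(5) by simp
    next
      case (down l)
      then show ?thesis using * U V y z eq up that by blast
    qed
  next
    case down: (down k)
    from V show ?thesis
    proof (cases rule: cells_cases)
      case (up l)
      then show ?thesis using *[OF V U z y eq[symmetric]] down that edge_sym by blast
    next
      case down': (down l)
      have "bary i y - bary i z = real_of_int (k $ i - l $ i)" for i
        using bary_cell_map_T'[OF down(1) m_pos, of i y] bary_cell_map_T'[OF down'(1) m_pos, of i z] eq down(2) down'(2) m_pos
        by simp
      then have d: "bary i y - bary i z \<in> \<int>" "y = z \<Longrightarrow> k $ i = l $ i" for i by auto
      have "y = z \<Longrightarrow> k = l" using d(2) by (simp add: vec_eq_iff)
      then have "y \<noteq> z" using \<open>U \<noteq> V\<close> down(2) down'(2) by auto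
      then show ?thesis using same[OF _ _ d(1)] down(5) down'(5) by simp
    qed
  qed
qed

section \<open>Indices and edge labels\<close>

definition index :: "triangle \<Rightarrow> int ^ 3" where
  "index U = (if U \<in> TT m then THE k. k \<in> idx (int m - 1) \<and> U = T m k
     else THE k. k \<in> idx (int m - 2) \<and> U = T' m k)"

lemma index_T: "k \<in> idx (int m - 1) \<Longrightarrow> index (T m k) = k"
  unfolding index_def using T_inj[OF _ _ _ m_pos] by (auto simp: TT_def intro!: the_equality)

lemma index_T': 
  assumes "k \<in> idx (int m - 2)" shows "index (T' m k) = k"
proof -
  have "T' m k \<notin> TT m" using TT_TT'_disjoint assms by (auto simp: TT'_def)
  then show ?thesis unfolding index_def using T'_inj[OF _ _ _ m_pos] assms by (auto intro!: the_equality)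
qed

lemma index_exit_cell: "index (exit_cell c i) = exit_idx c i"
  unfolding exit_cell_def using exit_idx by (rule index_T)

lemma index_eqI:
  assumes "U \<in> cells c" "V \<in> cells c" "U \<in> TT m \<longleftrightarrow> V \<in> TT m" "index U = index V"
  shows "U = V"
  using assms(1)
proof (cases rule: cells_cases)
  case up: (up k)
  from assms(2) show ?thesis
    by (cases rule: cells_cases) (use up assms in \<open>auto simp: index_T\<close>)
next
  case down: (down k)
  from assms(2) show ?thesis
    by (cases rule: cells_cases) (use down assms in \<open>auto simp: index_T'\<close>)
qed

lemma index_nonneg: "U \<in> cells c \<Longrightarrow> 0 \<le> index U $ i"
  by (cases rule: cells_cases) (auto simp: index_T index_T' idx_iff)

lemma strip_iff:
  assumes "U \<in> cells c"
  shows "U \<in> strip m i K \<longleftrightarrow> index U $ i = K"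
  using assms
proof (cases rule: cells_cases)
  case (up k)
  then have "U \<notin> TT' m" using TT_TT'_disjoint by blast
  moreover have "k = l" if "U = T m l" "l \<in> idx (int m - 1)" for l using that up T_inj m_pos by blast
  ultimately have "U \<in> strip m i K \<longleftrightarrow> k $ i = K" using up(1,2) unfolding strip_def TT'_def by blast
  then show ?thesis using up by (simp add: index_T)
next
  case (down k)
  have "k = l" if "U = T' m l" "l \<in> idx (int m - 2)" for l using that down T'_inj m_pos by blast
  then have "U \<in> strip m i K \<longleftrightarrow> k $ i = K" using down(1-3) unfolding strip_def TT_def by blast
  then show ?thesis using down by (simp add: index_T')
qed

lemma neighbours_iff:
  assumes "U \<in> cells c" "V \<in> cells c"
  shows "neighbours m j U V \<longleftrightarrow> U \<in> TT m \<and> V \<notin> TT m \<and>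
     index U $ j = index V $ j + 1 \<and> (\<forall>i. i \<noteq> j \<longrightarrow> index U $ i = index V $ i)"
proof
  assume "neighbours m j U V"
  then obtain k l where kl: "k \<in> idx (int m - 1)" "l \<in> idx (int m - 2)" "U = T m k" "V = T' m l"
    "k $ j = l $ j + 1" "\<forall>i. i \<noteq> j \<longrightarrow> k $ i = l $ i" by (auto simp: neighbours_def)
  then have "U \<in> TT m" "V \<notin> TT m" using TT_TT'_disjoint by (auto simp: TT_def TT'_def)
  then show "U \<in> TT m \<and> V \<notin> TT m \<and> index U $ j = index V $ j + 1 \<and>
      (\<forall>i. i \<noteq> j \<longrightarrow> index U $ i = index V $ i)"
    using kl by (auto simp: index_T index_T')
next
  assume *: "U \<in> TT m \<and> V \<notin> TT m \<and> index U $ j = index V $ j + 1 \<and>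
     (\<forall>i. i \<noteq> j \<longrightarrow> index U $ i = index V $ i)"
  obtain k where k: "k \<in> idx (int m - 1)" "U = T m k" using assms(1) * by (cases rule: cells_cases) auto
  obtain l where l: "l \<in> idx (int m - 2)" "V = T' m l" using assms(2) * by (cases rule: cells_cases) auto
  have "index U = k" "index V = l" using k l by (simp_all add: index_T index_T')
  then show "neighbours m j U V" using * k l unfolding neighbours_def by blast
qed

lemma edge_up_down: "edge m (cells c) j U V \<Longrightarrow> U \<in> TT m \<longleftrightarrow> V \<notin> TT m"
  unfolding edge_def using neighbours_iff[of _ c] by blast

lemma edge_up:
  "edge m (cells c) j U V \<Longrightarrow> U \<in> TT m \<Longrightarrow> index V $ i = index U $ i - (if i = j then 1 else 0)"
  unfolding edge_def using neighbours_iff[of U c V j] neighbours_iff[of V c U j] by auto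

lemma edge_down:
  "edge m (cells c) j U V \<Longrightarrow> U \<notin> TT m \<Longrightarrow> index V $ i = index U $ i + (if i = j then 1 else 0)"
  using edge_up[OF edge_sym, of c j U V i] edge_up_down[of c j U V] by auto

lemma edge_label_unique: "edge m (cells c) i U V \<Longrightarrow> edge m (cells c) j U V \<Longrightarrow> i = j"
  using edge_up[of c i U V i] edge_up[of c j U V i] edge_down[of c i U V i] edge_down[of c j U V i]
  by (cases "U \<in> TT m") (auto split: if_splits)

lemma edge_target_unique:
  assumes "edge m (cells c) j U V" "edge m (cells c) j U W"
  shows "V = W"
proof (rule index_eqI)
  show "V \<in> cells c" "W \<in> cells c" using assms by (auto simp: edge_def)
  show "V \<in> TT m \<longleftrightarrow> W \<in> TT m" using assms edge_up_down by blast
  show "index V = index W"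
    using edge_up[OF assms(1)] edge_up[OF assms(2)] edge_down[OF assms(1)] edge_down[OF assms(2)]
    by (cases "U \<in> TT m") (simp_all add: vec_eq_iff)
qed

text \<open>The two cells carry opposite colours, and exit points of opposite colours are
  complementary in the directions other than \<open>j\<close>, just as the half turn
  requires.\<close>

lemma edge_common_point:
  assumes "edge m (cells c) j U V"
  shows "cell_map U (exit_point (colour c U) j) = cell_map V (exit_point (colour c V) j)"
proof -
  have *: "cell_map U (exit_point (colour c U) j) = cell_map V (exit_point (colour c V) j)"
    if e: "edge m (cells c) j U V" and up: "U \<in> TT m" for U V
  proof (rule bary_eqI)
    fix i
    have V: "V \<notin> TT m" using edge_up_down e up by blast
    have UV: "U \<in> cells c" "V \<in> cells c" using e by (auto simp: edge_def)
    obtain k where k: "k \<in> idx (int m - 1)" "U = T m k" "colour c U = c" using UV(1) up by (cases rule: cells_cases) auto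
    obtain l where l: "l \<in> idx (int m - 2)" "V = T' m l" "colour c V = (\<not> c)"
      using UV(2) V by (cases rule: cells_cases) auto
    have "l $ i = k $ i - (if i = j then 1 else 0)" using edge_up[OF e up, of i] k l by (simp add: index_T index_T')
    then show "bary i (cell_map U (exit_point (colour c U) j)) = bary i (cell_map V (exit_point (colour c V) j))"
      unfolding k(3) l(3) unfolding k(2) l(2) bary_cell_map_T[OF k(1) m_pos] bary_cell_map_T'[OF l(1) m_pos]
      using bary_exit_point_complement[of i j c] by (cases "i = j") (simp_all add: bary_exit_point_zero)
  qed
  show ?thesis
  proof (cases "U \<in> TT m")
    case False
    then have "V \<in> TT m" using assms edge_up_down by blast
    then show ?thesis using *[OF edge_sym[OF assms]] by simp
  qed (use * assms in blast)
qed

text \<open>The neighbour would lie outside the large triangle, with index -1.\<close>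

lemma exit_cell_no_edge: "\<not> edge m (cells c) i (exit_cell c i) V"
proof
  assume e: "edge m (cells c) i (exit_cell c i) V"
  then have "index V $ i = -1" using edge_up[OF e exit_cell_TT, of i] by (simp add: index_exit_cell exit_idx_zero)
  moreover have "V \<in> cells c" using e by (auto simp: edge_def)
  ultimately show False using index_nonneg[of V c i] by simp
qed

text \<open>Coinciding exit points are the third corner; complementation then makes the exit points
  of the other colour two different corners of one fractal.\<close>

lemma exit_points_distinct:
  assumes "i \<noteq> j"
  shows "exit_point c i \<noteq> exit_point c j"
proof
  assume eq: "exit_point c i = exit_point c j"
  obtain k where k: "k \<noteq> i" "k \<noteq> j" by (rule third_label)
  have b: "bary k (exit_point c i) = 1"
    using sum_bary[of "exit_point c i"] sum_three[of i j k "\<lambda>l. bary l (exit_point c i)"] assms k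
      bary_exit_point_zero[of i c] bary_exit_point_zero[of j c] eq by simp
  have "bary j (exit_point (\<not> c) i) = 1" "bary i (exit_point (\<not> c) j) = 1"
    using bary_exit_point_complement[of j i c] bary_exit_point_complement[of i j c] assms eq
      bary_exit_point_zero[of i c] bary_exit_point_zero[of j c] by simp_all
  then have "exit_point (\<not> c) i = P $ j" "exit_point (\<not> c) j = P $ i"
    using bary_eq_1 exit_point_base by blast+
  then have "P $ j \<in> fractal (\<not> c)" "P $ i \<in> fractal (\<not> c)"
    using exit_point_fractal by metis+
  then show False using corner_unique assms by blast
qed

end

section \<open>Joining finitely many paths\<close>

fun join_list :: "(real \<Rightarrow> 'a :: topological_space) list \<Rightarrow> real \<Rightarrow> 'a" where
  "join_list [] = undefined"
| "join_list [g] = g"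
| "join_list (g # h # gs) = g +++ join_list (h # gs)"

lemma join_list:
  assumes "gs \<noteq> []" "\<And>g. g \<in> set gs \<Longrightarrow> path g"
    and "\<And>l. Suc l < length gs \<Longrightarrow> pathfinish (gs ! l) = pathstart (gs ! Suc l)"
  shows "path (join_list gs) \<and> pathstart (join_list gs) = pathstart (hd gs) \<and>
     pathfinish (join_list gs) = pathfinish (last gs) \<and> path_image (join_list gs) \<subseteq> (\<Union>g\<in>set gs. path_image g)"
  using assms
proof (induction gs rule: join_list.induct)
  case (3 g h gs)
  have "path (join_list (h # gs)) \<and> pathstart (join_list (h # gs)) = pathstart h \<and>
     pathfinish (join_list (h # gs)) = pathfinish (last (h # gs)) \<and>
     path_image (join_list (h # gs)) \<subseteq> (\<Union>g\<in>set (h # gs). path_image g)"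
    using 3(1,3) 3(4)[of "Suc l" for l] by simp
  moreover have "path g" "pathfinish g = pathstart h" using 3(3)[of g] 3(4)[of 0] by auto
  ultimately show ?case by (auto simp: path_image_join)
qed auto

lemma dist_join_list:
  fixes gs :: "(real \<Rightarrow> 'a :: metric_space) list"
  assumes "list_all2 (\<lambda>g h. \<forall>t\<in>{0..1}. dist (g t) (h t) \<le> B) gs hs" "gs \<noteq> []" "t \<in> {0..1}"
  shows "dist (join_list gs t) (join_list hs t) \<le> B"
  using assms
proof (induction gs arbitrary: hs t rule: join_list.induct)
  case (2 g)
  then show ?case by (auto simp: list_all2_Cons1)
next
  case (3 g g' gs)
  then obtain h h' hs' where hs: "hs = h # h' # hs'" by (auto simp: list_all2_Cons1)
  show ?case
  proof (cases "t \<le> 1 / 2")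
    case True
    then show ?thesis using 3 hs by (auto simp: joinpaths_def)
  next
    case False
    then have "dist (join_list (g' # gs) (2 * t - 1)) (join_list (h' # hs') (2 * t - 1)) \<le> B"
      using 3 hs by auto
    then show ?thesis using False hs by (simp add: joinpaths_def)
  qed
qed simp

text \<open>Pulled back along the arc, the set becomes a connected subset of the unit interval
  containing 0 and 1.\<close>

lemma arc_subset_connected:
  fixes g :: "real \<Rightarrow> 'a :: t2_space"
  assumes "arc g" "connected C" "C \<subseteq> path_image g" "pathstart g \<in> C" "pathfinish g \<in> C"
  shows "path_image g \<subseteq> C"
proof -
  obtain h where h: "homeomorphism {0..1} (path_image g) g h" using homeomorphism_arc[OF assms(1)] .
  have hg: "h (g t) = t" if "t \<in> {0..1}" for t using h that by (simp add: homeomorphism_def)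
  have gh: "g (h x) = x" if "x \<in> path_image g" for x using h that by (simp add: homeomorphism_def)
  have "continuous_on C h" using h assms(3) continuous_on_subset unfolding homeomorphism_def by blast
  then have con: "connected (h ` C)" using assms(2) connected_continuous_image by blast
  have "0 \<in> h ` C" "1 \<in> h ` C"
    using assms(4,5) hg[of 0] hg[of 1] by (force simp: pathstart_def pathfinish_def)+
  then have sub: "{0..1} \<subseteq> h ` C" using connected_contains_Icc[OF con] by simp
  show ?thesis
  proof
    fix x assume "x \<in> path_image g"
    then obtain t where t: "t \<in> {0..1}" "x = g t" by (auto simp: path_image_def)
    then obtain y where "y \<in> C" "t = h y" using sub by blast
    then show "x \<in> C" using t gh[of y] assms(3) by auto
  qed
qed

context labyrinth
begin

section \<open>The paths between two exits\<close>

lemma cells_eq: "cells True = white_all S" "cells False = yellow_all S"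
  by (simp_all add: cells_def ups_def downs_def white_all_def yellow_all_def)

lemma tree: "graph_tree m (cells c)"
  using labyrinth by (cases c) (auto simp: cells_eq labyrinth_patterns_system_def)

definition exit_path :: "bool \<Rightarrow> 3 \<Rightarrow> 3 \<Rightarrow> triangle list" where
  "exit_path c i j = (THE xs. path_from_to m (cells c) (exit_cell c i) (exit_cell c j) xs)"

lemma exit_path: "path_from_to m (cells c) (exit_cell c i) (exit_cell c j) (exit_path c i j)"
proof -
  obtain xs where "path_from_to m (cells c) (exit_cell c i) (exit_cell c j) xs"
    using tree exit_cell_cells unfolding graph_tree_def by blast
  then show ?thesis unfolding exit_path_def using tree_path_unique[OF tree] by (blast intro: theI)
qed

lemma exit_path_eqI:
  "path_from_to m (cells c) (exit_cell c i) (exit_cell c j) xs \<Longrightarrow> exit_path c i j = xs"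
  using tree_path_unique[OF tree exit_path] .

lemma exit_path_eq: "white_path m S i j = exit_path True i j" "yellow_path m S i j = exit_path False i j"
  by (simp_all add: white_path_def yellow_path_def exit_path_def exit_cell_eq cells_eq)

lemma exit_path_rev: "exit_path c j i = rev (exit_path c i j)"
  using path_from_to_rev[OF exit_path] by (rule exit_path_eqI)

abbreviation steps :: "bool \<Rightarrow> 3 \<Rightarrow> 3 \<Rightarrow> nat" where
  "steps c i j \<equiv> length (exit_path c i j)"

abbreviation node :: "bool \<Rightarrow> 3 \<Rightarrow> 3 \<Rightarrow> nat \<Rightarrow> triangle" where
  "node c i j l \<equiv> exit_path c i j ! l"

abbreviation shade :: "bool \<Rightarrow> 3 \<Rightarrow> 3 \<Rightarrow> nat \<Rightarrow> bool" where
  "shade c i j l \<equiv> colour c (node c i j l)"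

text \<open>The \<open>l\<close>-th cell of the path is entered through its side \<open>port c i j l\<close> and left through its
  side \<open>port c i j (Suc l)\<close>.\<close>

definition port :: "bool \<Rightarrow> 3 \<Rightarrow> 3 \<Rightarrow> nat \<Rightarrow> 3" where
  "port c i j l = (if l = 0 then i else if l = steps c i j then j
     else THE p. edge m (cells c) p (node c i j (l - 1)) (node c i j l))"

lemma steps_pos: "0 < steps c i j"
  using exit_path[of c i j] by (auto simp: path_from_to_def graph_path_iff)

lemma node_cells: "l < steps c i j \<Longrightarrow> node c i j l \<in> cells c"
  using exit_path[of c i j] nth_mem by (auto simp: path_from_to_def graph_path_iff)

lemma node_inj: "l < steps c i j \<Longrightarrow> l' < steps c i j \<Longrightarrow> node c i j l = node c i j l' \<longleftrightarrow> l = l'"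
  using exit_path[of c i j] by (simp add: path_from_to_def graph_path_iff nth_eq_iff_index_eq)

lemma node_first: "node c i j 0 = exit_cell c i"
  using exit_path[of c i j] steps_pos[of c i j] by (simp add: path_from_to_def hd_conv_nth)

lemma node_last: "node c i j (steps c i j - 1) = exit_cell c j"
  using exit_path[of c i j] steps_pos[of c i j] by (simp add: path_from_to_def last_conv_nth)

lemma port_0: "port c i j 0 = i"
  by (simp add: port_def)

lemma port_last: "port c i j (steps c i j) = j"
  using steps_pos[of c i j] by (auto simp: port_def)

lemma edge_port:
  assumes "Suc l < steps c i j"
  shows "edge m (cells c) (port c i j (Suc l)) (node c i j l) (node c i j (Suc l))"
proof -
  have "\<exists>p. edge m (cells c) p (node c i j l) (node c i j (Suc l))"
    using exit_path[of c i j] assms by (auto simp: path_from_to_def graph_path_def)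
  then have "\<exists>!p. edge m (cells c) p (node c i j l) (node c i j (Suc l))"
    using edge_label_unique by blast
  from theI'[OF this] show ?thesis using assms by (simp add: port_def)
qed

text \<open>An end cell has no neighbour across its own exit side, and elsewhere a repeated side
  would lead back to the cell just left.\<close>

lemma port_distinct:
  assumes "i \<noteq> j" "l < steps c i j"
  shows "port c i j l \<noteq> port c i j (Suc l)"
proof
  assume eq: "port c i j l = port c i j (Suc l)"
  show False
  proof (cases l)
    case 0
    show False
    proof (cases "Suc l < steps c i j")
      case True
      then show False using edge_port[OF True] 0 eq exit_cell_no_edge by (simp add: port_0 node_first)
    next
      case False
      then have "Suc l = steps c i j" using assms(2) by simp
      then show False using eq assms(1) 0 port_last[of c i j] by (simp add: port_0)
    qed
  next
    case (Suc l')
    then have e: "edge m (cells c) (port c i j l) (node c i j l) (node c i j l')"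
      using edge_port[of l' c i j] edge_sym assms(2) by simp
    show False
    proof (cases "Suc l < steps c i j")
      case True
      then have "node c i j l' = node c i j (Suc l)"
        using edge_target_unique[OF e] edge_port[OF True] eq by simp
      then show False using node_inj[of l' c i j "Suc l"] True Suc by simp
    next
      case False
      then have l: "Suc l = steps c i j" using assms(2) by simp
      then have "node c i j l = exit_cell c j" using node_last[of c i j] by (metis diff_Suc_1)
      then show False using e eq l exit_cell_no_edge by (simp add: port_last)
    qed
  qed
qed

section \<open>The curve between two exits\<close>

text \<open>The object of the given family that belongs to the \<open>l\<close>-th cell of a path.\<close>

abbreviation leg :: "(bool \<Rightarrow> 3 \<Rightarrow> 3 \<Rightarrow> 'x) \<Rightarrow> bool \<Rightarrow> 3 \<Rightarrow> 3 \<Rightarrow> nat \<Rightarrow> 'x" where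
  "leg X c i j l \<equiv> X (shade c i j l) (port c i j l) (port c i j (Suc l))"

primrec links :: "nat \<Rightarrow> bool \<Rightarrow> 3 \<Rightarrow> 3 \<Rightarrow> point set list" where
  "links 0 c i j = [base]"
| "links (Suc n) c i j = concat (map (\<lambda>l. map ((`) (cell_map (node c i j l)))
     (leg (links n) c i j l)) [0..<steps c i j])"

definition chain :: "nat \<Rightarrow> bool \<Rightarrow> 3 \<Rightarrow> 3 \<Rightarrow> point set" where
  "chain n c i j = \<Union> (set (links n c i j))"

definition curve :: "bool \<Rightarrow> 3 \<Rightarrow> 3 \<Rightarrow> point set" where
  "curve c i j = (\<Inter>n. chain n c i j)"

lemma chain_0: "chain 0 c i j = base"
  by (simp add: chain_def)

lemma chain_Suc:
  "chain (Suc n) c i j = (\<Union>l<steps c i j.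
     cell_map (node c i j l) ` leg (chain n) c i j l)"
  unfolding chain_def by (simp add: image_Union atLeast0LessThan) blast

lemma chain_approx: "chain n c i j \<subseteq> approx n c"
proof (induction n arbitrary: c i j)
  case 0
  then show ?case by (simp add: chain_0 approx_0)
next
  case (Suc n)
  then show ?case unfolding chain_Suc approx_Suc using node_cells[of _ c i j] by blast
qed

lemma chain_base: "chain n c i j \<subseteq> base"
  using chain_approx[of n c i j] approx_mono[of 0 n c] approx_0 by blast

lemma chain_Suc_subset: "chain (Suc n) c i j \<subseteq> chain n c i j"
proof (induction n arbitrary: c i j)
  case 0
  then show ?case using chain_base[of "Suc 0"] unfolding chain_0 .
next
  case (Suc n)
  show ?case unfolding chain_Suc[of "Suc n" c i j] chain_Suc[of n c i j]
    by (intro UN_mono image_mono Suc order_refl)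
qed

lemma chain_antimono: "n \<le> n' \<Longrightarrow> chain n' c i j \<subseteq> chain n c i j"
  using lift_Suc_antimono_le[where f = "\<lambda>n. chain n c i j"] chain_Suc_subset by blast

lemma compact_chain: "compact (chain n c i j)"
proof (induction n arbitrary: c i j)
  case 0
  then show ?case by (simp add: chain_0 compact_base)
next
  case (Suc n)
  then show ?case unfolding chain_Suc
    by (intro compact_UN compact_continuous_image continuous_cell_map) auto
qed

lemma compact_curve: "compact (curve c i j)"
proof -
  have "closed (curve c i j)"
    unfolding curve_def by (intro closed_INT ballI compact_imp_closed compact_chain)
  moreover have "curve c i j \<subseteq> base" unfolding curve_def using chain_0 by blast
  ultimately show ?thesis using compact_base by (metis compact_Int_closed inf.absorb_iff2)
qed

lemma curve_fractal: "curve c i j \<subseteq> fractal c"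
  unfolding curve_def fractal_def using chain_approx by blast

lemma curve_step:
  assumes "l < steps c i j"
  shows "cell_map (node c i j l) ` leg curve c i j l \<subseteq> curve c i j"
proof -
  have "cell_map (node c i j l) ` leg curve c i j l \<subseteq> chain n c i j" for n
  proof -
    have "cell_map (node c i j l) ` leg curve c i j l \<subseteq> chain (Suc n) c i j"
      unfolding chain_Suc curve_def using assms by blast
    then show ?thesis using chain_Suc_subset by blast
  qed
  then show ?thesis unfolding curve_def[of c i j] by blast
qed

text \<open>Approximating curves made of segments between exit points inside the cells of level
  \<open>n\<close>. Consecutive pieces fit because neighbouring cells share these points.\<close>

primrec polygon :: "nat \<Rightarrow> bool \<Rightarrow> 3 \<Rightarrow> 3 \<Rightarrow> real \<Rightarrow> point" where
  "polygon 0 c i j = linepath (exit_point c i) (exit_point c j)"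
| "polygon (Suc n) c i j = join_list (map (\<lambda>l. cell_map (node c i j l) \<circ>
     leg (polygon n) c i j l) [0..<steps c i j])"

lemma polygon:
  "path (polygon n c i j) \<and> pathstart (polygon n c i j) = exit_point c i \<and>
   pathfinish (polygon n c i j) = exit_point c j \<and> path_image (polygon n c i j) \<subseteq> chain n c i j"
proof (induction n arbitrary: c i j)
  case 0
  have "closed_segment (exit_point c i) (exit_point c j) \<subseteq> base"
    using closed_segment_subset[OF exit_point_base exit_point_base convex_base] .
  then show ?case by (simp add: chain_0)
next
  case (Suc n)
  let ?g = "\<lambda>l. cell_map (node c i j l) \<circ> leg (polygon n) c i j l"
  let ?gs = "map ?g [0..<steps c i j]"
  have start: "pathstart (?g l) = cell_map (node c i j l) (exit_point (shade c i j l) (port c i j l))" for l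
    using Suc by (simp add: pathstart_compose)
  have finish: "pathfinish (?g l) = cell_map (node c i j l) (exit_point (shade c i j l) (port c i j (Suc l)))" for l
    using Suc by (simp add: pathfinish_compose)
  have "path (?g l)" for l
    using Suc path_continuous_image[OF _ continuous_cell_map] by blast
  moreover have "pathfinish (?gs ! l) = pathstart (?gs ! Suc l)" if "Suc l < length ?gs" for l
    using that edge_common_point[OF edge_port[of l c i j]] start finish by simp
  ultimately have *: "path (join_list ?gs) \<and> pathstart (join_list ?gs) = pathstart (hd ?gs) \<and>
     pathfinish (join_list ?gs) = pathfinish (last ?gs) \<and> path_image (join_list ?gs) \<subseteq> (\<Union>g\<in>set ?gs. path_image g)"
    using steps_pos[of c i j] by (intro join_list) auto
  have "pathstart (hd ?gs) = pathstart (?g 0)" using steps_pos[of c i j] by (simp add: hd_map)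
  then have 1: "pathstart (hd ?gs) = exit_point c i"
    unfolding start by (simp add: node_first port_0 colour_exit_cell exit_point_fixed)
  have "pathfinish (last ?gs) = pathfinish (?g (steps c i j - 1))" using steps_pos[of c i j] by (simp add: last_map)
  then have 2: "pathfinish (last ?gs) = exit_point c j"
    unfolding finish using steps_pos[of c i j]
    by (simp add: node_last[simplified] port_last colour_exit_cell exit_point_fixed)
  have "(\<Union>g\<in>set ?gs. path_image g) \<subseteq> chain (Suc n) c i j"
  proof -
    have "(\<Union>g\<in>set ?gs. path_image g) = (\<Union>l<steps c i j. cell_map (node c i j l) `
        path_image (leg (polygon n) c i j l))"
      by (simp add: path_image_compose atLeast0LessThan)
    also have "\<dots> \<subseteq> chain (Suc n) c i j"
      unfolding chain_Suc using Suc by (intro UN_mono image_mono) auto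
    finally show ?thesis .
  qed
  then show ?case using * 1 2 by auto
qed

lemma dist_polygon_Suc:
  assumes "t \<in> {0..1}"
  shows "dist (polygon (Suc n) c i j t) (polygon n c i j t) \<le> (1 / m) ^ n"
  using assms
proof (induction n arbitrary: c i j t)
  case 0
  have "polygon n c i j t \<in> base" for n
  proof -
    have "polygon n c i j t \<in> path_image (polygon n c i j)" unfolding path_image_def using 0 by blast
    then show ?thesis using polygon[of n c i j] chain_base[of n c i j] by blast
  qed
  then show ?case using dist_base by (metis power_0)
next
  case (Suc n)
  have "dist (cell_map (node c i j l) (polygon (Suc n) c' p q s)) (cell_map (node c i j l) (polygon n c' p q s))
      \<le> (1 / m) ^ Suc n" if "l < steps c i j" "s \<in> {0..1}" for l c' p q s
  proof -
    have "dist (polygon (Suc n) c' p q s) (polygon n c' p q s) / m \<le> (1 / m) ^ n / m"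
      using Suc.IH[OF that(2)] by (rule divide_right_mono) simp
    then show ?thesis using dist_cell_map[OF node_cells[OF that(1)]] by simp
  qed
  then show ?case unfolding polygon.simps(2)[of "Suc n"] polygon.simps(2)[of n]
    using steps_pos[of c i j] Suc.prems
    by (intro dist_join_list) (auto simp: list_all2_conv_all_nth simp del: polygon.simps power_Suc)
qed

text \<open>The distances of successive polygons are bounded by a geometric series, so the
  telescoping sum converges uniformly. The chains are closed and decreasing, hence contain the
  limit.\<close>

lemma curve_path:
  obtains g where "path g" "pathstart g = exit_point c i" "pathfinish g = exit_point c j" "path_image g \<subseteq> curve c i j"
proof -
  define f where "f k t = polygon (Suc k) c i j t - polygon k c i j t" for k t
  define g where "g t = (\<Sum>k. f k t) + polygon 0 c i j t" for t
  have "uniform_limit {0..1} (\<lambda>n t. \<Sum>k<n. f k t) (\<lambda>t. \<Sum>k. f k t) sequentially"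
  proof (rule Weierstrass_m_test)
    show "norm (f n t) \<le> (1 / m) ^ n" if "t \<in> {0..1}" for n t
      using dist_polygon_Suc[OF that] by (simp add: f_def dist_norm)
    show "summable (\<lambda>n. (1 / real m) ^ n)" using real_m by (intro summable_geometric) simp
  qed
  then have "uniform_limit {0..1} (\<lambda>n t. (\<Sum>k<n. f k t) + polygon 0 c i j t) g sequentially"
    unfolding g_def by (intro uniform_limit_add uniform_limit_const)
  moreover have "(\<lambda>n t. (\<Sum>k<n. f k t) + polygon 0 c i j t) = (\<lambda>n. polygon n c i j)"
    unfolding f_def using sum_lessThan_telescope[of "\<lambda>k. polygon k c i j t" for t]
    by (intro ext) (simp del: polygon.simps)
  ultimately have lim: "uniform_limit {0..1} (\<lambda>n. polygon n c i j) g sequentially" by simp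
  have pw: "(\<lambda>n. polygon n c i j t) \<longlonglongrightarrow> g t" if "t \<in> {0..1}" for t
    using tendsto_uniform_limitI[OF lim that] .
  have "continuous_on {0..1} g"
    using polygon lim by (intro uniform_limit_theorem[OF _ lim]) (auto simp: path_def)
  then have "path g" by (simp add: path_def)
  moreover have "(\<lambda>n. polygon n c i j 0) = (\<lambda>n. exit_point c i)" "(\<lambda>n. polygon n c i j 1) = (\<lambda>n. exit_point c j)"
    using polygon[of _ c i j] by (auto simp: pathstart_def pathfinish_def)
  then have "pathstart g = exit_point c i" "pathfinish g = exit_point c j"
    using pw[of 0] pw[of 1] LIMSEQ_unique tendsto_const by (auto simp: pathstart_def pathfinish_def)
  moreover have "g t \<in> chain n c i j" if t: "t \<in> {0..1}" for n t
  proof (rule Lim_in_closed_set[OF compact_imp_closed[OF compact_chain] _ _ pw[OF t]])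
    have "polygon n' c i j t \<in> chain n c i j" if "n \<le> n'" for n'
    proof -
      have "polygon n' c i j t \<in> path_image (polygon n' c i j)" unfolding path_image_def using t by blast
      then show ?thesis using polygon[of n' c i j] chain_antimono[OF that, of c i j] by blast
    qed
    then show "\<forall>\<^sub>F n' in sequentially. polygon n' c i j t \<in> chain n c i j"
      unfolding eventually_sequentially by blast
  qed simp
  then have "path_image g \<subseteq> curve c i j" by (auto simp: path_image_def curve_def)
  ultimately show ?thesis using that by blast
qed

section \<open>Uniqueness of the arc between two exits\<close>

text \<open>The component of the tree without \<open>U\<close> that is entered across side
  \<open>p\<close>.\<close>

definition branch :: "bool \<Rightarrow> triangle \<Rightarrow> 3 \<Rightarrow> triangle set" where
  "branch c U p = {V. \<exists>W. edge m (cells c) p U W \<and> linked m (cells c - {U}) W V}"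

lemma branch_cells: "V \<in> branch c U p \<Longrightarrow> V \<in> cells c \<and> V \<noteq> U"
  using linked_in by (auto simp: branch_def)

lemma branch_adj:
  assumes "V \<in> branch c U p" "edge m (cells c) q U V"
  shows "q = p"
proof -
  obtain W where W: "edge m (cells c) p U W" "linked m (cells c - {U}) W V"
    using assms by (auto simp: branch_def)
  then have "W = V" using tree_no_cycle[OF tree] assms(2) by (metis adj_def)
  then show ?thesis using edge_label_unique W assms(2) by blast
qed

text \<open>A common cell or an edge between two branches would close a cycle through
  \<open>U\<close>.\<close>

lemma branch_disjoint:
  assumes "V \<in> branch c U p" "V' \<in> branch c U q" "V = V' \<or> adj m (cells c) V V'"
  shows "p = q"
proof -
  obtain W where W: "edge m (cells c) p U W" "linked m (cells c - {U}) W V"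
    using assms by (auto simp: branch_def)
  obtain W' where W': "edge m (cells c) q U W'" "linked m (cells c - {U}) W' V'"
    using assms by (auto simp: branch_def)
  have "linked m (cells c - {U}) V V'"
  proof (cases "V = V'")
    case True
    then show ?thesis using linked_trans[OF linked_sym[OF W(2)] W(2)] by simp
  next
    case False
    then have "adj m (cells c - {U}) V V'"
      using assms branch_cells by (auto simp: adj_restrict[of "cells c - {U}" "cells c"])
    then show ?thesis by (rule linked_adj)
  qed
  then have "linked m (cells c - {U}) W W'" using linked_trans W(2) linked_sym[OF W'(2)] by blast
  then have "W = W'" using tree_no_cycle[OF tree] W(1) W'(1) by (metis adj_def)
  then show ?thesis using edge_label_unique W W' by blast
qed

lemma branch_cover: "U \<in> cells c \<Longrightarrow> V \<in> cells c \<Longrightarrow> V \<noteq> U \<Longrightarrow> \<exists>p. V \<in> branch c U p"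
  using tree_branch[OF tree, of U c V] unfolding branch_def adj_def by blast

lemma first_in_branch: "Suc l < steps c i j \<Longrightarrow> exit_cell c i \<in> branch c (node c i j (Suc l)) (port c i j (Suc l))"
  using linked_sym[OF linked_before[OF exit_path]] edge_sym[OF edge_port] unfolding branch_def by blast

lemma last_in_branch: "Suc l < steps c i j \<Longrightarrow> exit_cell c j \<in> branch c (node c i j l) (port c i j (Suc l))"
  using linked_after[OF exit_path] edge_port unfolding branch_def by blast

definition cell_part :: "bool \<Rightarrow> triangle \<Rightarrow> point set" where
  "cell_part c U = cell_map U ` fractal (colour c U)"

lemma compact_cell_part: "compact (cell_part c U)"
  unfolding cell_part_def by (intro compact_continuous_image continuous_cell_map compact_fractal)

lemma exit_point_cell_part: "exit_point c i \<in> cell_part c (exit_cell c i)"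
  unfolding cell_part_def colour_exit_cell using exit_point_fixed exit_point_fractal by (metis imageI)

lemma cell_part_Int:
  assumes "U \<in> cells c" "V \<in> cells c" "U \<noteq> V" "x \<in> cell_part c U" "x \<in> cell_part c V"
  obtains p where "edge m (cells c) p U V" "x = cell_map U (exit_point (colour c U) p)"
proof -
  obtain y where y: "y \<in> fractal (colour c U)" "x = cell_map U y" using assms(4) by (auto simp: cell_part_def)
  obtain z where z: "z \<in> fractal (colour c V)" "x = cell_map V z" using assms(5) by (auto simp: cell_part_def)
  have "cell_map U y = cell_map V z" using y z by simp
  from cells_Int[OF assms(1-3) y(1) z(1) this] show ?thesis using that y(2) by blast
qed

text \<open>The trunk is the part of the fractal in the node, the branches are the parts across its
  three sides. The two exits attach at the entry and at the way out of the node, so \<open>C\<close>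
  contains both contact points.\<close>

lemma connected_Int_cell_part:
  assumes C: "connected C" "C \<subseteq> fractal c" "exit_point c i \<in> C" "exit_point c j \<in> C"
    and ij: "i \<noteq> j" and l: "l < steps c i j"
  shows "connected (C \<inter> cell_part c (node c i j l))"
    "cell_map (node c i j l) (exit_point (shade c i j l) (port c i j l)) \<in> C"
    "cell_map (node c i j l) (exit_point (shade c i j l) (port c i j (Suc l))) \<in> C"
proof -
  define U where "U = node c i j l"
  define q where "q p = cell_map U (exit_point (colour c U) p)" for p
  define X where "X = cell_part c U"
  define Y where "Y p = (\<Union>V\<in>branch c U p. cell_part c V)" for p
  have U: "U \<in> cells c" unfolding U_def by (rule node_cells[OF l])
  have finb: "finite (branch c U p)" for p
    by (rule finite_subset[OF _ finite_cells]) (use branch_cells in blast)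
  have Y: "Y p \<inter> X \<subseteq> {q p}" for p
  proof
    fix x assume "x \<in> Y p \<inter> X"
    then obtain V where V: "V \<in> branch c U p" "x \<in> cell_part c V" "x \<in> cell_part c U" by (auto simp: Y_def X_def)
    then obtain p' where "edge m (cells c) p' U V" "x = q p'"
      using cell_part_Int[OF U] branch_cells[OF V(1)] unfolding q_def by metis
    then show "x \<in> {q p}" using branch_adj[OF V(1)] by blast
  qed
  have disj: "Y p \<inter> Y p' = {}" if "p \<noteq> p'" for p p'
  proof (rule ccontr)
    assume "Y p \<inter> Y p' \<noteq> {}"
    then obtain x V V' where V: "V \<in> branch c U p" "x \<in> cell_part c V" "V' \<in> branch c U p'" "x \<in> cell_part c V'"
      by (auto simp: Y_def)
    have "V = V' \<or> adj m (cells c) V V'"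
      using cell_part_Int[of V c V' x] V branch_cells[OF V(1)] branch_cells[OF V(3)] unfolding adj_def by blast
    then show False using branch_disjoint V that by blast
  qed
  have cover: "C \<subseteq> X \<union> (\<Union>p\<in>UNIV. Y p)"
  proof
    fix x assume "x \<in> C"
    then obtain V y where V: "V \<in> cells c" "y \<in> fractal (colour c V)" "x = cell_map V y"
      using C(2) fractalE by blast
    then have "x \<in> cell_part c V" by (simp add: cell_part_def)
    then show "x \<in> X \<union> (\<Union>p\<in>UNIV. Y p)"
      using branch_cover[OF U V(1)] unfolding X_def Y_def by (cases "V = U") auto
  qed
  let ?a = "exit_point c i" and ?b = "exit_point c j"
  let ?p = "port c i j l" and ?p' = "port c i j (Suc l)"
  \<comment> \<open>At the first node the exit point is its own entry point, being fixed by the map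
    of the exit cell. At a later node it lies in the branch across the entry side, and if it also
    belongs to the node it is the contact point.\<close>
  have a: "?a \<in> X \<and> q ?p = ?a \<or> ?a \<in> Y ?p - X"
  proof (cases l)
    case 0
    then have "U = exit_cell c i" by (simp add: U_def node_first)
    then have "q ?p = ?a" "?a \<in> X"
      using 0 exit_point_cell_part[of c i] by (simp_all add: X_def q_def port_0 colour_exit_cell exit_point_fixed)
    then show ?thesis by blast
  next
    case (Suc l')
    have "exit_cell c i \<in> branch c U ?p"
      using first_in_branch[of l' c i j] l Suc by (simp add: U_def)
    then have "?a \<in> Y ?p" using exit_point_cell_part[of c i] unfolding Y_def by blast
    then show ?thesis using Y[of ?p] by (cases "?a \<in> X") auto
  qed
  have b: "?b \<in> X \<and> q ?p' = ?b \<or> ?b \<in> Y ?p' - X"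
  proof (cases "Suc l < steps c i j")
    case False
    then have l': "Suc l = steps c i j" using l by simp
    then have "U = exit_cell c j" unfolding U_def using node_last[of c i j] by (metis diff_Suc_1)
    then have "q ?p' = ?b" "?b \<in> X"
      using l' exit_point_cell_part[of c j] by (simp_all add: X_def q_def port_last colour_exit_cell exit_point_fixed)
    then show ?thesis by blast
  next
    case True
    then have "exit_cell c j \<in> branch c U ?p'" using last_in_branch by (simp add: U_def)
    then have "?b \<in> Y ?p'" using exit_point_cell_part[of c j] unfolding Y_def by blast
    then show ?thesis using Y[of ?p'] by (cases "?b \<in> X") auto
  qed
  have clX: "closed X" unfolding X_def using compact_cell_part compact_imp_closed by blast
  have clY: "closed (Y p)" for p
    unfolding Y_def using finb compact_cell_part by (intro compact_imp_closed compact_UN) auto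
  \<comment> \<open>The entry side differs from the side of departure, so the two ends are never in
    the same branch.\<close>
  have nab: "?a \<notin> Y p - X \<or> ?b \<notin> Y p - X" for p
    using a b disj[of p ?p] disj[of p ?p'] port_distinct[OF ij l] by blast
  have a': "?a \<in> X \<and> q ?p = ?a \<or> (\<exists>p\<in>UNIV. ?a \<in> Y p - X \<and> q ?p = q p)" using a by blast
  have b': "?b \<in> X \<and> q ?p' = ?b \<or> (\<exists>p\<in>UNIV. ?b \<in> Y p - X \<and> q ?p' = q p)" using b by blast
  have trunk: "connected (C \<inter> X)" "q ?p \<in> C \<inter> X" "q ?p' \<in> C \<inter> X"
    using connected_Int_trunk[OF finite_class.finite_UNIV clX clY Y disj C(1) cover C(3,4) a' b' nab] by simp_all
  then show "connected (C \<inter> cell_part c (node c i j l))"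
    "cell_map (node c i j l) (exit_point (shade c i j l) (port c i j l)) \<in> C"
    "cell_map (node c i j l) (exit_point (shade c i j l) (port c i j (Suc l))) \<in> C"
    unfolding X_def q_def U_def by blast+
qed

text \<open>The part of \<open>C\<close> in a node, pulled back by the inverse cell map, is again
  connected and contains two exit points; this inverse is continuous because the fractal is compact.
  The distance shrinks by \<open>1 / m\<close> at each level.\<close>

lemma chain_near_connected:
  assumes "connected C" "C \<subseteq> fractal c" "exit_point c i \<in> C" "exit_point c j \<in> C" "i \<noteq> j" "x \<in> chain n c i j"
  shows "\<exists>y\<in>C. dist x y \<le> (1 / m) ^ n"
  using assms
proof (induction n arbitrary: c i j C x)
  case 0
  then show ?case using dist_base[OF _ exit_point_base] by (metis chain_0 power_0)
next
  case (Suc n)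
  obtain l x' where l: "l < steps c i j"
    and x': "x = cell_map (node c i j l) x'" "x' \<in> leg (chain n) c i j l"
    using Suc.prems(6) unfolding chain_Suc by blast
  define U where "U = node c i j l"
  define D where "D = {y \<in> fractal (colour c U). cell_map U y \<in> C}"
  have U: "U \<in> cells c" unfolding U_def by (rule node_cells[OF l])
  note trunk = connected_Int_cell_part[OF Suc.prems(1-5) l, folded U_def]
  define h where "h = inv_into UNIV (cell_map U)"
  have inj: "inj (cell_map U)" using cell_map_inj[OF U] by (auto simp: inj_def)
  then have h: "h (cell_map U y) = y" for y by (simp add: h_def)
  have "continuous_on (cell_part c U) h"
    unfolding cell_part_def using compact_fractal h by (intro continuous_on_inv continuous_cell_map) auto
  then have "connected (h ` (C \<inter> cell_part c U))"
    using trunk(1) by (intro connected_continuous_image) (auto intro: continuous_on_subset)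
  moreover have "h ` (C \<inter> cell_part c U) = D" unfolding D_def cell_part_def by (force simp: h image_iff)
  ultimately have D: "connected D" by simp
  have "exit_point (colour c U) (port c i j l) \<in> D" "exit_point (colour c U) (port c i j (Suc l)) \<in> D"
    using trunk exit_point_fractal by (auto simp: D_def)
  then obtain y where y: "y \<in> D" "dist x' y \<le> (1 / m) ^ n"
    using Suc.IH[OF D, of "colour c U"] port_distinct[OF Suc.prems(5) l] x'(2) unfolding U_def D_def by blast
  have "dist x (cell_map U y) \<le> (1 / m) ^ Suc n"
    using dist_cell_map[OF U, of x' y] divide_right_mono[OF y(2), of m] x'(1) by (simp add: U_def)
  then show ?case using y(1) unfolding D_def by blast
qed

lemma curve_subset_connected:
  assumes "closed C" "connected C" "C \<subseteq> fractal c" "exit_point c i \<in> C" "exit_point c j \<in> C" "i \<noteq> j"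
  shows "curve c i j \<subseteq> C"
proof
  fix x assume x: "x \<in> curve c i j"
  have "infdist x C \<le> (1 / m) ^ n" for n
  proof -
    have "x \<in> chain n c i j" using x by (simp add: curve_def)
    then obtain y where "y \<in> C" "dist x y \<le> (1 / m) ^ n" using chain_near_connected assms(2-6) by blast
    then show ?thesis using infdist_le2 by blast
  qed
  then have "infdist x C = 0" using eq_0_if_le_powers[of "infdist x C"] infdist_nonneg[of x C] by (auto intro: antisym)
  then show "x \<in> C" using in_closed_iff_infdist_zero[OF assms(1)] assms(4) by blast
qed

text \<open>Any arc inside the curve between the exit points is closed and connected, hence contains
  the whole curve by minimality.\<close>

lemma curve_arc:
  assumes "i \<noteq> j"
  obtains g where "arc g" "pathstart g = exit_point c i" "pathfinish g = exit_point c j" "path_image g = curve c i j"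
proof -
  obtain p where p: "path p" "pathstart p = exit_point c i" "pathfinish p = exit_point c j" "path_image p \<subseteq> curve c i j"
    using curve_path .
  obtain g where g: "arc g" "path_image g \<subseteq> path_image p" "pathstart g = exit_point c i" "pathfinish g = exit_point c j"
    using path_contains_arc[OF p(1-3) exit_points_distinct[OF assms]] by blast
  have "curve c i j \<subseteq> path_image g"
  proof (rule curve_subset_connected)
    show "closed (path_image g)" "connected (path_image g)"
      using g(1) by (simp_all add: arc_imp_path closed_path_image connected_path_image)
    show "path_image g \<subseteq> fractal c" using g p curve_fractal by blast
    show "exit_point c i \<in> path_image g" "exit_point c j \<in> path_image g"
      using g pathstart_in_path_image pathfinish_in_path_image by metis+
  qed fact
  then show ?thesis using that g p by blast
qed

text \<open>A competing arc in the fractal contains the curve by minimality, and an arc has no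
  proper connected subset containing both of its ends.\<close>

lemma arc_between_exits:
  assumes "i \<noteq> j"
  shows "arc_between (fractal c) (exit_point c i) (exit_point c j) = curve c i j"
  unfolding arc_between_def
proof (rule the_equality)
  obtain g where g: "arc g" "pathstart g = exit_point c i" "pathfinish g = exit_point c j" "path_image g = curve c i j"
    using curve_arc[OF assms] .
  then show "curve c i j \<subseteq> fractal c \<and>
      (\<exists>g. arc g \<and> pathstart g = exit_point c i \<and> pathfinish g = exit_point c j \<and> path_image g = curve c i j)"
    using curve_fractal by blast
  fix A assume "A \<subseteq> fractal c \<and>
      (\<exists>g. arc g \<and> pathstart g = exit_point c i \<and> pathfinish g = exit_point c j \<and> path_image g = A)"
  then obtain h where h: "arc h" "pathstart h = exit_point c i" "pathfinish h = exit_point c j" "path_image h = A"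
    "A \<subseteq> fractal c" by blast
  have hA: "exit_point c i \<in> path_image h" "exit_point c j \<in> path_image h"
    using h pathstart_in_path_image pathfinish_in_path_image by metis+
  have "curve c i j \<subseteq> path_image h"
    using h hA assms by (intro curve_subset_connected) (auto simp: arc_imp_path closed_path_image connected_path_image)
  moreover have "path_image h \<subseteq> path_image g"
  proof (rule arc_subset_connected[OF h(1)])
    show "connected (path_image g)" using g(1) by (simp add: arc_imp_path connected_path_image)
    show "path_image g \<subseteq> path_image h" using calculation g(4) by simp
    show "pathstart h \<in> path_image g" "pathfinish h \<in> path_image g"
      using g h pathstart_in_path_image pathfinish_in_path_image by metis+
  qed
  ultimately show "A = curve c i j" using g h by blast
qed

text \<open>Each of the two curves is a closed connected set through both exit points, so minimality
  gives both inclusions; no comparison of the links is made.\<close>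

lemma curve_sym:
  assumes "i \<noteq> j"
  shows "curve c j i = curve c i j"
proof -
  have *: "curve c j i \<subseteq> curve c i j" if ne: "i \<noteq> j" for i j
  proof -
    obtain g where g: "arc g" "pathstart g = exit_point c i" "pathfinish g = exit_point c j" "path_image g = curve c i j"
      using curve_arc[OF ne] .
    then have "exit_point c i \<in> curve c i j" "exit_point c j \<in> curve c i j"
      using pathstart_in_path_image pathfinish_in_path_image by metis+
    moreover have "connected (curve c i j)" using g by (metis arc_imp_path connected_path_image)
    ultimately show ?thesis using ne compact_imp_closed[OF compact_curve, of c i j] curve_fractal[of c i j]
      using curve_subset_connected[of "curve c i j" c j i] by simp
  qed
  then show ?thesis using assms by (metis subset_antisym)
qed

lemma arcs_eq: "i \<noteq> j \<Longrightarrow> white_arc m S i j = curve True i j" "i \<noteq> j \<Longrightarrow> yellow_arc m S i j = curve False i j"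
  by (simp_all add: white_arc_def yellow_arc_def fractal_eq exit_point_eq arc_between_exits)

end

section \<open>Counting the cells of straight paths\<close>

lemma sum_alternate: "(\<Sum>l<Suc (2 * h). if even l then a else b) = Suc h * a + h * (b :: nat)"
  by (induction h) auto

fun link_count :: "(bool \<Rightarrow> nat) \<Rightarrow> nat \<Rightarrow> bool \<Rightarrow> nat" where
  "link_count h 0 c = 1"
| "link_count h (Suc n) c = Suc (h c) * link_count h n c + h c * link_count h n (\<not> c)"

text \<open>The column sums of the recursion are all \<open>m\<close>, so the total over both
  colours is multiplied by exactly \<open>m\<close>, starting from 2.\<close>

lemma link_count_sum: "Suc (h True + h False) = m \<Longrightarrow> link_count h n True + link_count h n False = 2 * m ^ n"
proof (induction n)
  case (Suc n)
  have "link_count h (Suc n) True + link_count h (Suc n) False =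
    Suc (h True + h False) * (link_count h n True + link_count h n False)"
    by (simp add: algebra_simps)
  then show ?case using Suc by simp
qed simp

context labyrinth
begin

section \<open>Parity along a path\<close>

lemma node_up: "l < steps c i j \<Longrightarrow> node c i j l \<in> TT m \<longleftrightarrow> even l"
proof (induction l)
  case 0
  then show ?case using exit_cell_TT by (simp add: node_first)
next
  case (Suc l)
  then show ?case using edge_up_down[OF edge_port[OF Suc.prems]] by auto
qed

lemma colour_node: "l < steps c i j \<Longrightarrow> shade c i j l = (if even l then c else \<not> c)"
  using node_up by (simp add: colour_def)

lemma odd_steps: "odd (steps c i j)"
proof -
  have "even (steps c i j - 1)"
    using node_up[of "steps c i j - 1" c i j] node_last[of c i j] exit_cell_TT[of c j] steps_pos[of c i j] by simp
  then show ?thesis using steps_pos[of c i j] by (cases "steps c i j") auto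
qed

lemma index_node_Suc:
  assumes "Suc l < steps c i j"
  shows "index (node c i j (Suc l)) $ p = index (node c i j l) $ p +
     (if port c i j (Suc l) = p then (if even l then -1 else 1) else 0)"
proof (cases "even l")
  case True
  then have "node c i j l \<in> TT m" using node_up[of l] assms by simp
  then show ?thesis using edge_up[OF edge_port[OF assms]] True by auto
next
  case False
  then have "node c i j l \<notin> TT m" using node_up[of l] assms by simp
  then show ?thesis using edge_down[OF edge_port[OF assms]] False by auto
qed

section \<open>Paths that are not blocked\<close>

definition straight :: "bool \<Rightarrow> 3 \<Rightarrow> 3 \<Rightarrow> 3 \<Rightarrow> bool" where
  "straight c i j k \<longleftrightarrow> (\<forall>U\<in>set (exit_path c i j). \<forall>V\<in>set (exit_path c i j). index U $ k = index V $ k)"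

lemma straight_rev: "straight c i j k \<longleftrightarrow> straight c j i k"
  unfolding straight_def exit_path_rev[of c j i] by simp

lemma set_exit_path: "set (exit_path c i j) \<subseteq> cells c"
  using exit_path[of c i j] by (auto simp: path_from_to_def graph_path_iff)

lemma index_le:
  assumes "U \<in> cells c"
  shows "index U $ i \<le> int m - 1"
  using assms
proof (cases rule: cells_cases)
  case (up k)
  then show ?thesis using idx_le[of k "int m - 1" i] by (simp add: index_T)
next
  case (down k)
  then show ?thesis using idx_le[of k "int m - 2" i] by (simp add: index_T')
qed

lemma path_blocked_iff: "path_blocked m k (exit_path c i j) \<longleftrightarrow> \<not> straight c i j k"
proof -
  have "(\<exists>K\<in>{0..int m - 1}. U \<in> strip m k K \<and> V \<in> strip m k K) \<longleftrightarrow> index U $ k = index V $ k"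
    if "U \<in> set (exit_path c i j)" "V \<in> set (exit_path c i j)" for U V
  proof -
    have U: "U \<in> cells c" and V: "V \<in> cells c" using that set_exit_path by blast+
    show ?thesis unfolding strip_iff[OF U] strip_iff[OF V]
      using index_nonneg[OF U, of k] index_le[OF U, of k] by auto
  qed
  then show ?thesis unfolding path_blocked_def straight_def by blast
qed

lemma not_blocked_iff:
  assumes "i \<noteq> j" "i \<noteq> k" "j \<noteq> k"
  shows "\<not> blocked m S {i, j} \<longleftrightarrow> (\<forall>c. straight c i j k)"
proof -
  have third: "k' = k" if "{k'} = UNIV - {i, j}" for k'
  proof -
    have "k \<in> UNIV - {i, j}" using assms by simp
    then have "k \<in> {k'}" unfolding that .
    then show ?thesis by simp
  qed
  have k: "{k} = UNIV - {i, j}" using three_cases[OF assms] assms by blast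
  have "blocked m S {i, j} \<longleftrightarrow> \<not> straight True i j k \<or> \<not> straight False i j k"
  proof
    assume "blocked m S {i, j}"
    then have "\<exists>i' j' k'. {i, j} = {i', j'} \<and> {k'} = UNIV - {i', j'} \<and>
        (\<not> straight True i' j' k' \<or> \<not> straight False i' j' k')"
      unfolding blocked_def exit_path_eq path_blocked_iff .
    then obtain i' j' k' where *: "{i, j} = {i', j'}" "{k'} = UNIV - {i', j'}"
      "\<not> straight True i' j' k' \<or> \<not> straight False i' j' k'"
      by (elim exE conjE)
    then have "k' = k" using third[of k'] by simp
    moreover have "i' = i \<and> j' = j \<or> i' = j \<and> j' = i" using *(1) assms by (auto simp: doubleton_eq_iff)
    ultimately show "\<not> straight True i j k \<or> \<not> straight False i j k" using *(3) straight_rev by blast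
  next
    assume "\<not> straight True i j k \<or> \<not> straight False i j k"
    then show "blocked m S {i, j}"
      unfolding blocked_def exit_path_eq path_blocked_iff using k
      by (intro exI[of _ i] exI[of _ j] exI[of _ k]) simp
  qed
  moreover have "(\<forall>c. straight c i j k) \<longleftrightarrow> straight True i j k \<and> straight False i j k"
  proof safe
    fix c assume "straight True i j k" "straight False i j k"
    then show "straight c i j k" by (cases c) simp_all
  qed simp_all
  ultimately show ?thesis by simp
qed

text \<open>A constant index of type \<open>k\<close> means that side \<open>k\<close> is never
  crossed; consecutive sides differ, so \<open>i\<close> and \<open>j\<close> alternate.\<close>

lemma straight_ports:
  assumes "i \<noteq> j" "i \<noteq> k" "j \<noteq> k" "straight c i j k" "l \<le> steps c i j"
  shows "port c i j l = (if even l then i else j)"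
  using assms(5)
proof (induction l)
  case 0
  then show ?case by (simp add: port_0)
next
  case (Suc l)
  have "port c i j (Suc l) \<noteq> k"
  proof (cases "Suc l = steps c i j")
    case True
    then show ?thesis using assms(3) port_last[of c i j] by simp
  next
    case False
    then have l: "Suc l < steps c i j" using Suc.prems by simp
    then have "index (node c i j (Suc l)) $ k = index (node c i j l) $ k"
      using assms(4) unfolding straight_def by (meson Suc_lessD nth_mem)
    then show ?thesis using index_node_Suc[OF l, of k] by (auto split: if_splits)
  qed
  moreover have "port c i j (Suc l) \<noteq> port c i j l" using port_distinct[OF assms(1)] Suc.prems by (metis Suc_le_eq)
  ultimately show ?case using Suc three_cases[OF assms(1-3), of "port c i j (Suc l)"] by auto
qed

lemma straight_exit_idx:
  assumes "straight c i j k"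
  shows "exit_idx c i $ k = exit_idx c j $ k"
proof -
  have "exit_cell c i \<in> set (exit_path c i j)" "exit_cell c j \<in> set (exit_path c i j)"
    using node_first[of c i j] node_last[of c i j] steps_pos[of c i j]
    by (metis nth_mem, metis nth_mem diff_less zero_less_one)
  then show ?thesis using assms unfolding straight_def by (metis index_exit_cell)
qed

text \<open>Each entry into a cell \<open>T'\<close> lowers the index of type \<open>j\<close> by 1,
  down to 0 at the exit on side \<open>j\<close>. The number of these cells is thus the initial
  index, and by the mirror symmetry of the exits this is the strip number of the other
  colour.\<close>

lemma straight_steps:
  assumes "i \<noteq> j" "i \<noteq> k" "j \<noteq> k" "straight c i j k"
  shows "int (steps c i j div 2) = exit_idx (\<not> c) i $ k"
proof -
  have ind: "index (node c i j l) $ j = exit_idx c i $ j - int ((l + 1) div 2)" if "l < steps c i j" for l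
    using that
  proof (induction l)
    case 0
    then show ?case by (simp add: node_first index_exit_cell)
  next
    case (Suc l)
    then show ?case using index_node_Suc[OF Suc.prems, of j] straight_ports[OF assms, of "Suc l"] assms(1)
      by (cases "even l") (auto elim!: evenE oddE)
  qed
  define r where "r = steps c i j - 1"
  have r: "r < steps c i j" "Suc r = steps c i j" using steps_pos[of c i j] by (auto simp: r_def)
  have "0 = exit_idx c i $ j - int (steps c i j div 2)"
    using ind[OF r(1)] r(2) node_last[of c i j] unfolding r_def by (simp add: index_exit_cell exit_idx_zero)
  moreover have "exit_idx c i $ j + exit_idx c i $ k = int m - 1"
    using exit_idx[of c i] sum_three[OF assms(1-3), of "\<lambda>l. exit_idx c i $ l"]
    by (simp add: idx_iff exit_idx_zero)
  ultimately show ?thesis using exit_idx_complement[of k i c] assms(2) by simp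
qed

section \<open>Finite length\<close>

lemma links_diameter: "U \<in> set (links n c i j) \<Longrightarrow> bounded U \<and> diameter U \<le> (1 / m) ^ n"
proof
  assume U: "U \<in> set (links n c i j)"
  then have "U \<subseteq> base" using chain_base[of n c i j] unfolding chain_def by blast
  then show "bounded U" using compact_base compact_imp_bounded bounded_subset by blast
  have "dist x y \<le> (1 / m) ^ n" if "U \<in> set (links n c i j)" "x \<in> U" "y \<in> U" for U x y
    using that
  proof (induction n arbitrary: c i j U x y)
    case 0
    then show ?case using dist_base by simp
  next
    case (Suc n)
    then obtain l V x' y' where l: "l < steps c i j" and
      V: "V \<in> set (leg (links n) c i j l)" "x' \<in> V" "y' \<in> V"
      "x = cell_map (node c i j l) x'" "y = cell_map (node c i j l) y'"
      by auto
    have "dist x y = dist x' y' / m" using dist_cell_map[OF node_cells[OF l]] V by simp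
    also have "\<dots> \<le> (1 / m) ^ n / m" using Suc.IH[OF V(1-3)] by (intro divide_right_mono) auto
    finally show ?case by simp
  qed
  then show "diameter U \<le> (1 / m) ^ n" using U by (intro diameter_le) (auto simp: dist_norm)
qed

text \<open>The cells \<open>T'\<close> of a straight path from \<open>i\<close> to \<open>j\<close>
  are traversed from \<open>j\<close> to \<open>i\<close>, so both orders are counted in one
  induction.\<close>

lemma length_links:
  assumes "i \<noteq> j" "i \<noteq> k" "j \<noteq> k" "\<And>c. straight c i j k" "\<And>c. h c = steps c i j div 2"
  shows "length (links n c i j) = link_count h n c \<and> length (links n c j i) = link_count h n c"
proof (induction n arbitrary: c)
  case 0
  then show ?case by simp
next
  case (Suc n)
  have *: "length (links (Suc n) c i' j') = link_count h (Suc n) c"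
    if ij: "i' = i \<and> j' = j \<or> i' = j \<and> j' = i" for i' j'
  proof -
    have d: "i' \<noteq> j'" "i' \<noteq> k" "j' \<noteq> k" "straight c i' j' k" using ij assms straight_rev by auto
    have h: "h c = steps c i' j' div 2" using ij assms(5) exit_path_rev[of c i' j'] by auto
    have "length (links (Suc n) c i' j') = (\<Sum>l<steps c i' j'. length (leg (links n) c i' j' l))"
      by (simp add: length_concat o_def sum_list_distinct_conv_sum_set atLeast0LessThan
          flip: sum_set_upt_conv_sum_list_nat)
    also have "\<dots> = (\<Sum>l<steps c i' j'. if even l then link_count h n c else link_count h n (\<not> c))"
    proof (rule sum.cong[OF refl])
      fix l assume "l \<in> {..<steps c i' j'}"
      then have l: "l < steps c i' j'" by simp
      show "length (leg (links n) c i' j' l) =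
        (if even l then link_count h n c else link_count h n (\<not> c))"
        using straight_ports[OF d, of l] straight_ports[OF d, of "Suc l"] l ij Suc[of c] Suc[of "\<not> c"]
        by (auto simp: colour_node)
    qed
    also have "steps c i' j' = Suc (2 * h c)" using odd_steps[of c i' j'] h by (auto elim!: oddE)
    finally show ?thesis by (simp only: sum_alternate link_count.simps)
  qed
  then show ?case by blast
qed

text \<open>Level \<open>n\<close> covers the curve by at most \<open>2 * m ^ n\<close> sets of
  diameter at most \<open>(1 / m) ^ n\<close>, which bounds the length by 2.\<close>

lemma arc_length_finite:
  assumes "i \<noteq> j" "i \<noteq> k" "j \<noteq> k" "\<And>c. straight c i j k"
  shows "arc_length (curve c i j) < \<infinity>"
proof -
  define h where "h c = steps c i j div 2" for c
  have "int (h True + h False) = int m - 1"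
    using straight_steps[OF assms(1-3) assms(4)[of True]] straight_steps[OF assms(1-3) assms(4)[of False]]
      exit_idx_complement[of k i True] assms(2) by (simp add: h_def)
  then have "Suc (h True + h False) = m" by linarith
  then have cnt: "link_count h n c \<le> 2 * m ^ n" for n
    using link_count_sum[of h m n] by (cases c) auto
  have len: "real (length (links n c i j)) \<le> 2 * real m ^ n" for n
  proof -
    have "length (links n c i j) \<le> 2 * m ^ n" using length_links[OF assms h_def, of n c] cnt[of n] by simp
    then have "real (length (links n c i j)) \<le> real (2 * m ^ n)" by (rule of_nat_mono)
    then show ?thesis by simp
  qed
  have "hausdorff1_delta \<delta> (curve c i j) \<le> ennreal 2" if \<delta>: "0 < \<delta>" for \<delta>
  proof -
    obtain n where n: "(1 / real m) ^ n < \<delta>" using real_arch_pow_inv[OF \<delta>, of "1 / real m"] real_m by auto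
    have "hausdorff1_delta \<delta> (curve c i j) \<le> hausdorff1_delta ((1 / m) ^ n) (curve c i j)"
      using n by (intro hausdorff1_delta_antimono) simp
    also have "\<dots> \<le> ennreal (real (length (links n c i j)) * (1 / m) ^ n)"
      using links_diameter by (intro hausdorff1_delta_le_list) (auto simp: curve_def chain_def)
    also have "\<dots> \<le> ennreal 2"
    proof (rule ennreal_leI)
      have "real (length (links n c i j)) * (1 / m) ^ n \<le> 2 * real m ^ n * (1 / m) ^ n"
        using len by (intro mult_right_mono) auto
      also have "\<dots> = 2" using real_m by (simp add: power_divide)
      finally show "real (length (links n c i j)) * (1 / m) ^ n \<le> 2" .
    qed
    finally show ?thesis .
  qed
  then have "arc_length (curve c i j) \<le> ennreal 2"
    unfolding arc_length_def by (intro SUP_least) auto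
  then show ?thesis using ennreal_less_top le_less_trans by (metis infinity_ennreal_def)
qed

end

text \<open>A bound for all choices passes to the suprema one index at a time. The term
  \<open>a\<close> accumulates the choices already fixed.\<close>

lemma sum_SUP_le:
  fixes f :: "'b \<Rightarrow> ennreal"
  assumes "finite I" "\<And>i. i \<in> I \<Longrightarrow> A i \<noteq> {}"
    and "\<And>\<kappa>. (\<And>i. i \<in> I \<Longrightarrow> \<kappa> i \<in> A i) \<Longrightarrow> (\<Sum>i\<in>I. f (\<kappa> i)) + a \<le> B"
  shows "(\<Sum>i\<in>I. SUP k\<in>A i. f k) + a \<le> B"
  using assms
proof (induction I arbitrary: a rule: finite_induct)
  case empty
  then show ?case by simp
next
  case (insert i I)
  have *: "f k + ((\<Sum>i\<in>I. SUP k\<in>A i. f k) + a) \<le> B" if k: "k \<in> A i" for k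
  proof -
    have "(\<Sum>i\<in>I. SUP k\<in>A i. f k) + (f k + a) \<le> B"
    proof (rule insert.IH)
      fix \<kappa> assume \<kappa>: "\<And>i. i \<in> I \<Longrightarrow> \<kappa> i \<in> A i"
      have "(\<Sum>l\<in>insert i I. f ((\<kappa>(i := k)) l)) + a \<le> B"
        by (rule insert.prems(2)) (use \<kappa> k in auto)
      moreover have "(\<Sum>l\<in>I. f ((\<kappa>(i := k)) l)) = (\<Sum>l\<in>I. f (\<kappa> l))"
        using insert.hyps by (intro sum.cong) auto
      ultimately show "(\<Sum>i\<in>I. f (\<kappa> i)) + (f k + a) \<le> B" using insert.hyps by (simp add: ac_simps)
    qed (use insert.prems in auto)
    then show ?thesis by (simp add: ac_simps)
  qed
  have "(SUP k\<in>A i. f k) + ((\<Sum>i\<in>I. SUP k\<in>A i. f k) + a) =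
      (SUP k\<in>A i. f k + ((\<Sum>i\<in>I. SUP k\<in>A i. f k) + a))"
    using insert.prems(1) by (intro ennreal_SUP_add_left[symmetric]) auto
  also have "\<dots> \<le> B" using * by (rule SUP_least)
  finally show ?case using insert.hyps by (simp add: ac_simps)
qed

context labyrinth
begin

section \<open>A superadditive lower bound for the length\<close>

text \<open>Removing the exit points makes the parts of a curve in different cells disjoint, so that no
  measurability argument is needed for superadditivity.\<close>

definition inner_length :: "bool \<Rightarrow> 3 \<Rightarrow> 3 \<Rightarrow> ennreal" where
  "inner_length c i j = (SUP K\<in>{K. compact K \<and> K \<subseteq> curve c i j - range (exit_point c)}. arc_length K)"

lemma inner_length_le: "inner_length c i j \<le> arc_length (curve c i j)"
  unfolding inner_length_def by (intro SUP_least arc_length_mono) auto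

lemma inner_length_sym: "i \<noteq> j \<Longrightarrow> inner_length c j i = inner_length c i j"
  unfolding inner_length_def by (simp add: curve_sym)

lemma inner_length_pos:
  assumes "i \<noteq> j"
  shows "0 < inner_length c i j"
proof -
  obtain g where g: "arc g" "pathstart g = exit_point c i" "pathfinish g = exit_point c j" "path_image g = curve c i j"
    using curve_arc[OF assms] .
  have con: "connected (curve c i j)" using g by (metis arc_imp_path connected_path_image)
  have ends: "exit_point c i \<in> curve c i j" "exit_point c j \<in> curve c i j"
    using g pathstart_in_path_image pathfinish_in_path_image by metis+
  have fin: "finite (range (exit_point c))" by simp
  obtain K where K: "compact K" "K \<subseteq> curve c i j - range (exit_point c)" "0 < arc_length K"
    using connected_arc_length_pos[OF compact_curve con ends exit_points_distinct[OF assms] fin] .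
  have "arc_length K \<le> inner_length c i j"
    unfolding inner_length_def using K by (intro SUP_upper) auto
  then show ?thesis using K(3) by (rule less_le_trans[rotated])
qed

text \<open>Compact sets chosen in the cells are mapped to disjoint compact subsets of the curve.
  The factor \<open>m\<close> is the Lipschitz constant of the inverse cell maps, which bring the
  images back to the original size.\<close>

lemma inner_length_superadditive:
  "(\<Sum>l<steps c i j. leg inner_length c i j l)
     \<le> of_nat m * inner_length c i j"
proof -
  define A where "A l = {K. compact K \<and> K \<subseteq> leg curve c i j l -
    range (exit_point (shade c i j l))}" for l
  have "(\<Sum>l<steps c i j. SUP K\<in>A l. arc_length K) + 0 \<le> of_nat m * inner_length c i j"
  proof (rule sum_SUP_le)
    have "{} \<in> A l" for l by (simp add: A_def)
    then show "A l \<noteq> {}" for l by blast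
  next
    fix K assume K': "\<And>l. l \<in> {..<steps c i j} \<Longrightarrow> K l \<in> A l"
    define W where "W l = cell_map (node c i j l) ` K l" for l
    have K: "compact (K l)" "K l \<subseteq> leg curve c i j l"
      "\<And>p. exit_point (shade c i j l) p \<notin> K l" if "l < steps c i j" for l
      using K'[of l] that by (auto simp: A_def)
    have W: "compact (W l)" "W l \<subseteq> curve c i j" "W l \<subseteq> cell_part c (node c i j l)" if "l < steps c i j" for l
    proof -
      show "compact (W l)" unfolding W_def by (rule compact_continuous_image[OF continuous_cell_map K(1)[OF that]])
      show "W l \<subseteq> curve c i j" unfolding W_def using curve_step[OF that] K(2)[OF that] by blast
      show "W l \<subseteq> cell_part c (node c i j l)" unfolding W_def cell_part_def using K(2)[OF that] curve_fractal by blast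
    qed
    have avoid: "x \<notin> W l" if l: "l < steps c i j" and V: "V \<in> cells c" "V \<noteq> node c i j l" "x \<in> cell_part c V" for l V x
    proof
      assume x: "x \<in> W l"
      then have "x \<in> cell_part c (node c i j l)" using W(3)[OF l] by blast
      then obtain p where "x = cell_map (node c i j l) (exit_point (shade c i j l) p)"
        using cell_part_Int[OF node_cells[OF l] V(1) V(2)[symmetric]] V(3) by blast
      moreover obtain y where y: "y \<in> K l" "x = cell_map (node c i j l) y" using x unfolding W_def by blast
      ultimately have "y = exit_point (shade c i j l) p" using cell_map_inj[OF node_cells[OF l]] by simp
      then show False using K(3)[OF l] y(1) by blast
    qed
    have disj: "disjoint_family_on W {..<steps c i j}"
      unfolding disjoint_family_on_def
    proof (intro ballI impI)
      fix l l' assume l: "l \<in> {..<steps c i j}" "l' \<in> {..<steps c i j}" "l \<noteq> l'"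
      then have "node c i j l' \<noteq> node c i j l" using node_inj by simp
      then show "W l \<inter> W l' = {}" using avoid[of l "node c i j l'"] W(3)[of l'] l node_cells[of l' c i j] by auto
    qed
    \<comment> \<open>The union must again be admissible for \<open>inner_length\<close>. In its own
      exit cell an exit point is the image of itself, which is removed from \<open>K l\<close>; any
      other cell meets it at most in a removed contact point.\<close>
    have no_exit: "exit_point c p \<notin> W l" if l: "l < steps c i j" for l p
    proof (cases "exit_cell c p = node c i j l")
      case False
      then show ?thesis using avoid[OF l exit_cell_cells] exit_point_cell_part by blast
    next
      case True
      show ?thesis
      proof
        assume "exit_point c p \<in> W l"
        then obtain y where y: "y \<in> K l" "exit_point c p = cell_map (exit_cell c p) y"
          unfolding W_def True by blast
        then have "y = exit_point c p" using cell_map_inj[OF exit_cell_cells] exit_point_fixed by metis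
        then show False using y(1) K(3)[OF l, of p] colour_exit_cell[of c p] True by simp
      qed
    qed
    have union: "(\<Union>l<steps c i j. W l) \<in> {K. compact K \<and> K \<subseteq> curve c i j - range (exit_point c)}"
    proof (intro CollectI conjI)
      show "compact (\<Union>l<steps c i j. W l)" using W(1) by (intro compact_UN) auto
      show "(\<Union>l<steps c i j. W l) \<subseteq> curve c i j - range (exit_point c)"
        using W(2) no_exit by blast
    qed
    have "arc_length (K l) \<le> of_nat m * arc_length (W l)" if l: "l < steps c i j" for l
    proof -
      define h where "h = inv_into UNIV (cell_map (node c i j l))"
      have h: "h (cell_map (node c i j l) y) = y" for y
        using cell_map_inj[OF node_cells[OF l]] by (simp add: h_def inj_def)
      have "(real m)-lipschitz_on (W l) h"
        using dist_cell_map[OF node_cells[OF l]] m_pos unfolding W_def by (intro lipschitz_onI) (auto simp: h)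
      moreover have "h ` W l = K l" by (simp add: W_def image_image h)
      ultimately show ?thesis using arc_length_lipschitz[of "real m" "W l" h] m_pos
        by (simp add: ennreal_of_nat_eq_real_of_nat)
    qed
    then have "(\<Sum>l<steps c i j. arc_length (K l)) \<le> (\<Sum>l<steps c i j. of_nat m * arc_length (W l))"
      by (intro sum_mono) simp
    also have "\<dots> = of_nat m * (\<Sum>l<steps c i j. arc_length (W l))" by (simp add: sum_distrib_left)
    also have "\<dots> \<le> of_nat m * arc_length (\<Union>l<steps c i j. W l)"
      using W(1) disj by (intro mult_left_mono arc_length_disjoint_family) auto
    also have "\<dots> \<le> of_nat m * inner_length c i j"
      unfolding inner_length_def using union by (intro mult_left_mono SUP_upper) auto
    finally show "(\<Sum>l<steps c i j. arc_length (K l)) + 0 \<le> of_nat m * inner_length c i j" by simp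
  qed simp
  then show ?thesis by (simp add: A_def inner_length_def)
qed

section \<open>Counting the crossings of strips\<close>

text \<open>A path that ends at the side \<open>k\<close> has to leave every strip of type \<open>k\<close> from its starting strip
  onwards, each time from a triangle \<open>T\<close> into a triangle \<open>T'\<close>.\<close>

lemma crossings_from:
  assumes "l < steps c i k"
  shows "index (node c i k l) $ k + 1 \<le>
      (\<Sum>r\<in>{l..<steps c i k}. if even r \<and> port c i k (Suc r) = k then 1 else 0) \<and>
    index (node c i k l) $ k + (if odd l \<and> port c i k l = k then 1 else 0) \<le>
      (\<Sum>r\<in>{l..<steps c i k}. if odd r \<and> port c i k r = k then 1 else 0)"
proof -
  define N where "N = steps c i k - 1"
  have N: "Suc N = steps c i k" "l \<le> N" using assms by (auto simp: N_def)
  have split: "(\<Sum>r\<in>{n..<steps c i k}. f r) = f n + (\<Sum>r\<in>{Suc n..<steps c i k}. f r)" if "n < steps c i k" for n and f :: "nat \<Rightarrow> int"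
    using that by (rule sum.atLeast_Suc_lessThan)
  show ?thesis
    using N(2)
  \<comment> \<open>Backwards from the last cell: it has index 0 and is left through side
    \<open>k\<close>, which gives the \<open>+ 1\<close>. The extra summand for an odd cell entered
    through \<open>k\<close> compensates the drop of the index at its entry.\<close>
  proof (induction l rule: inc_induct)
    case base
    have "even N" using odd_steps[of c i k] unfolding N(1)[symmetric] by simp
    moreover have "index (node c i k N) $ k = 0"
      using node_last[of c i k] by (simp add: N_def index_exit_cell exit_idx_zero)
    moreover have "{N..<steps c i k} = {N}" unfolding N(1)[symmetric] by auto
    moreover have "port c i k (Suc N) = k" unfolding N(1) by (rule port_last)
    ultimately show ?case by simp
  next
    case (step n)
    then have n: "Suc n < steps c i k" using N(1) by simp
    show ?case
      unfolding split[OF Suc_lessD[OF n]] using step.IH index_node_Suc[OF n, of k]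
      by (auto split: if_splits)
  qed
qed

lemma crossings:
  "exit_idx c i $ k + 1 \<le> (\<Sum>r<steps c i k. if even r \<and> port c i k (Suc r) = k then 1 else 0)"
  "exit_idx c i $ k \<le> (\<Sum>r<steps c i k. if odd r \<and> port c i k r = k then 1 else 0)"
  using crossings_from[OF steps_pos, of c i k] by (simp_all add: node_first index_exit_cell atLeast0LessThan)

section \<open>Infinite length\<close>

text \<open>If both paths began by crossing side \<open>k\<close>, the path from \<open>i\<close> to
  \<open>k\<close> would leave the straight path at its very first cell. The path from
  \<open>j\<close> to \<open>k\<close> would then run back along the whole straight path, whose
  steps never cross side \<open>k\<close>.\<close>

lemma tripod:
  assumes "i \<noteq> j" "i \<noteq> k" "j \<noteq> k" "straight c i j k" "1 < steps c i j" "1 < steps c i k" "1 < steps c j k"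
  shows "port c i k 1 \<noteq> k \<or> port c j k 1 \<noteq> k"
proof (rule ccontr)
  assume "\<not> ?thesis"
  then have p: "port c i k 1 = k" "port c j k 1 = k" by auto
  define U where "U = exit_cell c i"
  obtain xs where xs: "exit_path c i j = U # xs" "xs \<noteq> []"
    using node_first[of c i j] assms(5) by (cases "exit_path c i j") (auto simp: U_def)
  obtain ys where ys: "exit_path c i k = U # ys" "ys \<noteq> []"
    using node_first[of c i k] assms(6) by (cases "exit_path c i k") (auto simp: U_def)
  note px = path_from_to_Cons[OF exit_path[of c i j, unfolded xs(1)] xs(2), folded U_def]
  note py = path_from_to_Cons[OF exit_path[of c i k, unfolded ys(1)] ys(2), folded U_def]
  have ex: "edge m (cells c) j U (hd xs)"
    using edge_port[of 0 c i j] assms(5) straight_ports[OF assms(1-4), of 1] xs by (simp add: hd_conv_nth)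
  have ey: "edge m (cells c) k U (hd ys)"
    using edge_port[of 0 c i k] assms(6) p(1) ys by (simp add: hd_conv_nth)
  have prefix: "linked m (cells c - {U}) (hd zs) V"
    if "path_from_to m (cells c - {U}) (hd zs) B zs" "V \<in> set zs" for zs B V
    using path_from_to_prefix that split_list[OF that(2)] unfolding linked_def by metis
  have "V \<notin> set ys" if "V \<in> set xs" for V
  proof
    assume "V \<in> set ys"
    then have "linked m (cells c - {U}) (hd xs) (hd ys)"
      using prefix[OF px(3) that] prefix[OF py(3)] linked_trans linked_sym by blast
    then have "hd xs = hd ys" using tree_no_cycle[OF tree px(2) py(2)] by blast
    then show False using edge_label_unique ex ey assms(3) by metis
  qed
  moreover have "U \<notin> set ys"
    using exit_path[of c i k] unfolding ys(1) path_from_to_def graph_path_iff distinct.simps by blast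
  ultimately have disj: "set (rev (exit_path c i j)) \<inter> set ys = {}" unfolding xs(1) by auto
  have "path_from_to m (cells c) (exit_cell c j) U (rev (exit_path c i j))"
    using path_from_to_rev[OF exit_path[of c i j]] by (simp add: U_def)
  moreover have "path_from_to m (cells c) (hd ys) (exit_cell c k) ys"
    using py(3) by (simp add: path_from_to_def graph_path_diff)
  ultimately have "path_from_to m (cells c) (exit_cell c j) (exit_cell c k) (rev (exit_path c i j) @ ys)"
    using py(2) disj by (rule path_from_to_append)
  then have eq: "exit_path c j k = rev (exit_path c i j) @ ys" by (rule exit_path_eqI)
  define N where "N = steps c i j"
  have N: "1 < N" using assms(5) by (simp add: N_def)
  have "node c j k 0 = node c i j (N - 1)" "node c j k 1 = node c i j (N - 2)"
    unfolding eq using N by (auto simp: nth_append rev_nth N_def numeral_2_eq_2)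
  then have "edge m (cells c) k (node c i j (N - 1)) (node c i j (N - 2))"
    using edge_port[of 0 c j k] assms(7) p(2) by simp
  moreover have "edge m (cells c) (port c i j (N - 1)) (node c i j (N - 2)) (node c i j (N - 1))"
    using edge_port[of "N - 2" c i j] N by (simp add: N_def Suc_diff_Suc numeral_2_eq_2)
  ultimately have "k = port c i j (N - 1)" using edge_label_unique edge_sym by blast
  then show False using straight_ports[OF assms(1-4), of "N - 1"] assms(2,3) by (auto simp: N_def split: if_splits)
qed

text \<open>Along the paths of type \<open>{i, k}\<close> and \<open>{j, k}\<close> at least \<open>K c + 1\<close> parts of colour \<open>c\<close> and \<open>K c\<close>
  parts of the other colour touch the side \<open>k\<close>, where \<open>K c + K (\<not> c) = m - 1\<close>. Hence the least
  lengths of either colour, if finite, leave no room for any other part.\<close>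

lemma tight:
  assumes ijk: "i \<noteq> j" "i \<noteq> k" "j \<noteq> k"
    and str: "\<And>c. straight c i j k"
    and \<mu>: "\<And>c. \<mu> c = min (inner_length c i k) (inner_length c j k)" "\<And>c. \<mu> c < \<infinity>"
    and \<tau>: "\<And>c. \<tau> c \<in> {i, j}" "\<And>c. inner_length c (\<tau> c) k = \<mu> c"
    and l: "l < steps c (\<tau> c) k"
  shows "if even l then port c (\<tau> c) k (Suc l) = k \<and> inner_length c (port c (\<tau> c) k l) k = \<mu> c
    else port c (\<tau> c) k l = k \<and> inner_length (\<not> c) (port c (\<tau> c) k (Suc l)) k = \<mu> (\<not> c)"
proof -
  define r where "r c = enn2real (\<mu> c)" for c
  define K where "K c = exit_idx c (\<tau> c) $ k" for c
  have r0: "0 \<le> r c" for c by (simp add: r_def)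
  have \<mu>r: "\<mu> c = ennreal (r c)" for c using \<mu>(2)[of c] by (simp add: r_def less_top)
  have \<tau>k: "\<tau> c \<noteq> k" for c using \<tau>(1)[of c] ijk by auto
  have K: "K c + K (\<not> c) = int m - 1" for c
  proof -
    have "K c = exit_idx c i $ k" for c
      using \<tau>(1)[of c] straight_exit_idx[OF str[of c]] by (auto simp: K_def)
    then show ?thesis using exit_idx_complement[of k i c] ijk(2) by simp
  qed
  have K0: "0 \<le> K c" for c using exit_idx[of c "\<tau> c"] by (simp add: K_def idx_iff)
  define L where "L c l = inner_length (colour c (node c (\<tau> c) k l)) (port c (\<tau> c) k l) (port c (\<tau> c) k (Suc l))" for c l
  \<comment> \<open>The guaranteed share of the \<open>l\<close>-th part in the lower bound: the
    least length of its colour if a cell \<open>T\<close> is left through \<open>k\<close>, or a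
    cell \<open>T'\<close> is entered through \<open>k\<close>, and 0 otherwise. These are the
    crossings counted in \<open>crossings\<close>.\<close>
  define w where "w c l = (if even l \<and> port c (\<tau> c) k (Suc l) = k then r c else 0) +
     (if odd l \<and> port c (\<tau> c) k l = k then r (\<not> c) else 0)" for c l
  have sumL: "(\<Sum>l<steps c (\<tau> c) k. L c l) \<le> ennreal (m * r c)" for c
    using inner_length_superadditive[of c "\<tau> c" k] unfolding L_def \<tau>(2) \<mu>r
    by (simp add: ennreal_mult ennreal_of_nat_eq_real_of_nat r0)
  have Lfin: "L c l < top" if "l < steps c (\<tau> c) k" for c l
  proof -
    have "L c l \<le> (\<Sum>l<steps c (\<tau> c) k. L c l)" using that by (intro member_le_sum) auto
    also have "\<dots> \<le> ennreal (m * r c)" by (rule sumL)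
    finally show ?thesis using ennreal_less_top le_less_trans by blast
  qed
  define e where "e c l = enn2real (L c l)" for c l
  have Le: "L c l = ennreal (e c l)" if "l < steps c (\<tau> c) k" for c l
    using Lfin[OF that] by (simp add: e_def)
  have e0: "0 \<le> e c l" for c l by (simp add: e_def)
  have epos: "0 < e c l" if "l < steps c (\<tau> c) k" for c l
    using inner_length_pos[OF port_distinct[OF \<tau>k that]] Lfin[OF that]
    by (simp add: e_def enn2real_positive_iff L_def)
  have sume: "(\<Sum>l<steps c (\<tau> c) k. e c l) \<le> m * r c" for c
  proof -
    have "(\<Sum>l<steps c (\<tau> c) k. L c l) = ennreal (\<Sum>l<steps c (\<tau> c) k. e c l)"
      using Le e0 by simp
    then show ?thesis using sumL[of c] r0 e0 by (simp add: ennreal_le_iff)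
  qed
  have \<mu>_le: "\<mu> c \<le> inner_length c p k" if "p \<noteq> k" for c p
    using three_cases[OF ijk, of p] that \<mu>(1)[of c] by auto
  have we: "w c l \<le> e c l" if l: "l < steps c (\<tau> c) k" for c l
  proof -
    have pd: "port c (\<tau> c) k l \<noteq> port c (\<tau> c) k (Suc l)" using port_distinct[OF \<tau>k l] .
    have "ennreal (w c l) \<le> L c l"
    proof (cases "even l")
      case True
      then show ?thesis
        using \<mu>_le[of "port c (\<tau> c) k l" c] pd by (auto simp: w_def L_def colour_node[OF l] \<mu>r)
    next
      case False
      then show ?thesis
        using \<mu>_le[of "port c (\<tau> c) k (Suc l)" "\<not> c"] pd inner_length_sym[OF pd, of "\<not> c"]
        by (auto simp: w_def L_def colour_node[OF l] \<mu>r)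
    qed
    then show ?thesis using Le[OF l] e0 by simp
  qed
  have sumw: "(K c + 1) * r c + K c * r (\<not> c) \<le> (\<Sum>l<steps c (\<tau> c) k. w c l)" for c
  proof -
    let ?a = "\<Sum>l<steps c (\<tau> c) k. if even l \<and> port c (\<tau> c) k (Suc l) = k then 1 else 0 :: int"
    let ?b = "\<Sum>l<steps c (\<tau> c) k. if odd l \<and> port c (\<tau> c) k l = k then 1 else 0 :: int"
    have "K c + 1 \<le> ?a" "K c \<le> ?b" using crossings[of c "\<tau> c" k] unfolding K_def by blast+
    then have "real_of_int (K c + 1) \<le> real_of_int ?a" "real_of_int (K c) \<le> real_of_int ?b"
      unfolding of_int_le_iff .
    then have "real_of_int (K c + 1) * r c + K c * r (\<not> c) \<le> real_of_int ?a * r c + real_of_int ?b * r (\<not> c)"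
      using r0 by (intro add_mono mult_right_mono)
    then have "(K c + 1) * r c + K c * r (\<not> c) \<le> real_of_int ?a * r c + real_of_int ?b * r (\<not> c)" .
    also have "\<dots> = (\<Sum>l<steps c (\<tau> c) k. w c l)"
      unfolding w_def sum.distrib of_int_sum sum_distrib_right by (intro arg_cong2[of _ _ _ _ "(+)"] sum.cong) auto
    finally show ?thesis .
  qed
  \<comment> \<open>Over both colours together the coefficient of \<open>r c\<close> in the lower
    bound is \<open>K c + 1 + K (\<not> c) = m\<close>, the same as in the upper bound; hence there
    is no slack.\<close>
  have "(\<Sum>l<steps True (\<tau> True) k. e True l - w True l) + (\<Sum>l<steps False (\<tau> False) k. e False l - w False l) \<le> 0"
  proof -
    have KT: "real_of_int (K False) = real m - 1 - K True" using K[of True] by simp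
    show ?thesis
      unfolding sum_subtractf using sume[of True] sume[of False] sumw[of True] sumw[of False] m_pos
      by (simp add: KT algebra_simps of_nat_diff)
  qed
  moreover have nn: "0 \<le> (\<Sum>l<steps c (\<tau> c) k. e c l - w c l)" for c
    using we by (intro sum_nonneg) simp
  ultimately have "(\<Sum>l<steps c (\<tau> c) k. e c l - w c l) +
      (\<Sum>l<steps (\<not> c) (\<tau> (\<not> c)) k. e (\<not> c) l - w (\<not> c) l) \<le> 0"
    by (cases c) (simp_all add: add.commute)
  then have "(\<Sum>l<steps c (\<tau> c) k. e c l - w c l) = 0"
    using nn[of c] nn[of "\<not> c"] by linarith
  then have "\<forall>l\<in>{..<steps c (\<tau> c) k}. e c l - w c l = 0"
    using we by (subst (asm) sum_nonneg_eq_0_iff) auto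
  then have eq: "e c l = w c l" using l by auto
  \<comment> \<open>Every part has positive length, so its share is not 0: each cell is one of the
    counted crossings, and its part has the least length of its colour.\<close>
  then have "0 < w c l" using epos[OF l] by simp
  moreover have "L c l = ennreal (w c l)" using Le[OF l] eq by simp
  ultimately show ?thesis
    using port_distinct[OF \<tau>k l]
      inner_length_sym[OF port_distinct[OF \<tau>k l], of "\<not> c"]
    by (cases "even l") (auto simp: w_def L_def colour_node[OF l] \<mu>r split: if_splits)
qed

text \<open>For finite length, \<open>tight\<close> and \<open>tripod\<close> single out one minimal
  side per colour, and it is the same for both. The minimal paths then alternate between this side
  and \<open>k\<close>, which makes a blocked type straight for both colours.\<close>

lemma inner_length_infinite:
  assumes ijk: "i \<noteq> j" "i \<noteq> k" "j \<noteq> k"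
    and str: "\<And>c. straight c i j k" and bl: "\<exists>c. \<not> straight c i k j" "\<exists>c. \<not> straight c j k i"
    and p: "p \<in> {i, j}"
  shows "inner_length c p k = \<infinity>"
proof (rule ccontr)
  assume "inner_length c p k \<noteq> \<infinity>"
  then have fin: "inner_length c p k < \<infinity>" by (simp add: less_top)
  define \<mu> where "\<mu> c = min (inner_length c i k) (inner_length c j k)" for c
  define K where "K c = exit_idx c i $ k" for c
  have K: "exit_idx c q $ k = K c" if "q \<in> {i, j}" for c q
    using that straight_exit_idx[OF str[of c]] by (auto simp: K_def)
  have Kc: "K (\<not> c) = int m - 1 - K c" for c
    using exit_idx_complement[of k i c] ijk(2) by (simp add: K_def)
  \<comment> \<open>For \<open>K c = m - 1\<close> both exits would be the cell at corner
    \<open>k\<close>, and their exit points would coincide.\<close>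
  have K_less: "K c < int m - 1" for c
  proof (rule ccontr)
    assume "\<not> ?thesis"
    then have *: "exit_idx c i $ k = int m - 1" "exit_idx c j $ k = int m - 1"
      using idx_le[OF exit_idx, of c i k] K[of i c] K[of j c] by auto
    have "exit_idx c i = exit_idx c j"
      using corner_idx_unique[OF exit_idx *(1)] corner_idx_unique[OF exit_idx *(2)] by (simp add: vec_eq_iff)
    then have "exit_point c i = exit_point c j" by (simp add: exit_point_def)
    then show False using exit_points_distinct ijk(1) by blast
  qed
  have Kpos: "0 < K c" for c using K_less[of "\<not> c"] Kc[of c] by simp
  have crossed: "\<exists>l<steps c q k. odd l \<and> port c q k l = k" if "q \<in> {i, j}" for c q
  proof (rule ccontr)
    assume "\<not> ?thesis"
    then have "(\<Sum>l<steps c q k. if odd l \<and> port c q k l = k then 1 else 0 :: int) = 0"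
      by (intro sum.neutral) auto
    then show False using crossings(2)[of c q k] K[OF that, of c] Kpos[of c] by simp
  qed
  have steps2: "2 < steps c q k" if q: "q \<in> {i, j}" for c q
  proof -
    obtain l where "l < steps c q k" "odd l" using crossed[OF q] by blast
    then have "1 < steps c q k" by (cases l) auto
    then show ?thesis using odd_steps[of c q k] by (cases "steps c q k = 2") auto
  qed
  \<comment> \<open>Finiteness spreads to the other colour: a cell \<open>T'\<close> entered through
    \<open>k\<close> carries a curve of the other colour ending at side \<open>k\<close>, and
    superadditivity bounds its length.\<close>
  have \<mu>fin: "\<mu> c' < \<infinity>" for c'
  proof -
    have 1: "\<mu> c < \<infinity>" using fin p by (auto simp: \<mu>_def min_less_iff_disj)
    have pk: "p \<noteq> k" using p ijk by auto
    obtain l where l: "l < steps c p k" "odd l" "port c p k l = k" using crossed[OF p] by blast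
    define q where "q = port c p k (Suc l)"
    have qk: "q \<noteq> k" using port_distinct[OF pk l(1)] l(3) by (simp add: q_def)
    have "inner_length (\<not> c) k q = leg inner_length c p k l"
      using l by (simp add: colour_node q_def)
    also have "\<dots> \<le> (\<Sum>l<steps c p k. leg inner_length c p k l)"
      using l(1) by (intro member_le_sum) auto
    also have "\<dots> \<le> of_nat m * inner_length c p k" by (rule inner_length_superadditive)
    also have "\<dots> < \<infinity>" using fin by (simp add: ennreal_mult_less_top less_top ennreal_of_nat_eq_real_of_nat)
    finally have "inner_length (\<not> c) q k < \<infinity>" using inner_length_sym[OF qk] by simp
    then have 2: "\<mu> (\<not> c) < \<infinity>"
      using three_cases[OF ijk, of q] qk by (auto simp: \<mu>_def min_less_iff_disj)
    show ?thesis using 1 2 by (cases "c' = c") auto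
  qed
  define \<tau> where "\<tau> c = (if inner_length c i k \<le> inner_length c j k then i else j)" for c
  have \<tau>: "\<tau> c \<in> {i, j}" "inner_length c (\<tau> c) k = \<mu> c" for c
    by (auto simp: \<tau>_def \<mu>_def min_def)
  note tight' = tight[OF ijk str \<mu>_def \<mu>fin]
  have first: "port c q k 1 = k" if q: "q \<in> {i, j}" "inner_length c q k = \<mu> c" for c q
  proof -
    \<comment> \<open>\<open>tight\<close> accepts any choice of minimisers, so the choice for
      colour \<open>c\<close> may be changed to \<open>q\<close>.\<close>
    have "(\<tau>(c := q)) c' \<in> {i, j}" "inner_length c' ((\<tau>(c := q)) c') k = \<mu> c'" for c'
      using \<tau>[of c'] q by auto
    from tight'[OF this, of 0 c] show ?thesis using steps_pos[of c q k] by simp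
  qed
  \<comment> \<open>If both sides were minimal, the paths from both would leave their first cell
    through \<open>k\<close>, which the tripod excludes.\<close>
  have only: "q = \<tau> c" if q: "q \<in> {i, j}" "inner_length c q k = \<mu> c" for c q
  proof (rule ccontr)
    assume "q \<noteq> \<tau> c"
    then have ij: "inner_length c i k = \<mu> c" "inner_length c j k = \<mu> c" using q \<tau>[of c] by auto
    have "1 < steps c i j"
    proof -
      have "steps c i j \<noteq> 1"
        using straight_steps[OF ijk str[of c]] Kpos[of "\<not> c"] by (auto simp: K_def)
      then show ?thesis using steps_pos[of c i j] by linarith
    qed
    moreover have "1 < steps c i k" "1 < steps c j k" using steps2[of i c] steps2[of j c] by auto
    ultimately show False using tripod[OF ijk str[of c]] first[of i c] first[of j c] ij by auto
  qed
  have even_port: "port c (\<tau> c) k l = \<tau> c" if l: "l < steps c (\<tau> c) k" "even l" for c l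
  proof -
    have \<tau>k: "\<tau> c \<noteq> k" using \<tau>(1)[of c] ijk by auto
    have "port c (\<tau> c) k (Suc l) = k" "inner_length c (port c (\<tau> c) k l) k = \<mu> c"
      using tight'[OF \<tau> l(1)] l(2) by auto
    moreover have "port c (\<tau> c) k l \<noteq> k" using port_distinct[OF \<tau>k l(1)] calculation by simp
    ultimately show ?thesis using only three_cases[OF ijk] by blast
  qed
  have odd_port: "port c (\<tau> c) k l = k" "port c (\<tau> c) k (Suc l) = \<tau> (\<not> c)" if l: "l < steps c (\<tau> c) k" "odd l" for c l
  proof -
    have \<tau>k: "\<tau> c \<noteq> k" using \<tau>(1)[of c] ijk by auto
    show 1: "port c (\<tau> c) k l = k" using tight'[OF \<tau> l(1)] l(2) by auto
    have "inner_length (\<not> c) (port c (\<tau> c) k (Suc l)) k = \<mu> (\<not> c)" using tight'[OF \<tau> l(1)] l(2) by auto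
    moreover have "port c (\<tau> c) k (Suc l) \<noteq> k" using port_distinct[OF \<tau>k l(1)] 1 by simp
    ultimately show "port c (\<tau> c) k (Suc l) = \<tau> (\<not> c)" using only three_cases[OF ijk] by blast
  qed
  define t where "t = \<tau> True"
  \<comment> \<open>On the white path, port 2 is both the way out of cell 1, whose part is yellow,
    and the way into cell 2, whose part is white. So the minimisers of the two colours
    agree.\<close>
  have t: "\<tau> c = t" for c
  proof -
    have "\<tau> (\<not> True) = \<tau> True"
      using odd_port(2)[of 1 True] even_port[of 2 True] steps2[OF \<tau>(1), of True True] by (simp add: numeral_2_eq_2)
    then show ?thesis by (cases c) (auto simp: t_def)
  qed
  obtain s where s: "{t, s} = {i, j}" "s \<noteq> t" "s \<noteq> k" "t \<noteq> k" using \<tau>(1)[of True] ijk unfolding t_def by auto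
  \<comment> \<open>The third side \<open>s\<close> is never crossed, so the index of type
    \<open>s\<close> stays constant.\<close>
  have "straight c t k s" for c
  proof -
    have "index (node c t k l) $ s = exit_idx c t $ s" if "l < steps c t k" for l
      using that
    proof (induction l)
      case 0
      then show ?case by (simp add: node_first index_exit_cell)
    next
      case (Suc l)
      have "port c t k (Suc l) \<in> {t, k}"
        using even_port[of "Suc l" c] odd_port(1)[of "Suc l" c] Suc.prems unfolding t by auto
      then show ?case using Suc index_node_Suc[OF Suc.prems, of s] s by auto
    qed
    then show ?thesis unfolding straight_def by (metis in_set_conv_nth)
  qed
  then show False using bl s(1,2) \<tau>(1)[of True] unfolding t_def by (auto simp: doubleton_eq_iff)
qed

end

theorem proposition10p5:
  fixes m :: nat and S :: pattern_sets and \<pi> :: "3 set"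
  assumes "labyrinth_patterns_system m S"
    and "\<pi> \<in> PP" and "\<not> blocked m S \<pi>"
    and "\<forall>\<pi>'\<in>PP. \<not> blocked m S \<pi>' \<longrightarrow> \<pi>' = \<pi>"
  shows "(\<forall>i j. {i, j} = \<pi> \<longrightarrow>
            arc_length (white_arc m S i j) < \<infinity> \<and> arc_length (yellow_arc m S i j) < \<infinity>)
       \<and> (\<forall>\<pi>'\<in>PP - {\<pi>}. \<forall>i j. {i, j} = \<pi>' \<longrightarrow>
            arc_length (white_arc m S i j) = \<infinity> \<and> arc_length (yellow_arc m S i j) = \<infinity>)"
proof -
  interpret labyrinth m S by unfold_locales (rule assms(1))
  have PP_iff: "{i, j} \<in> PP \<longleftrightarrow> i \<noteq> j" for i j :: 3
    using exhaust_3[of i] exhaust_3[of j] unfolding PP_def by (elim disjE) (simp_all add: doubleton_eq_iff)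
  obtain i j where ij: "\<pi> = {i, j}" "i \<noteq> j" using assms(2) by (auto simp: PP_def)
  obtain k where k: "k \<noteq> i" "k \<noteq> j" by (rule third_label)
  have str: "straight c i j k" for c
    using not_blocked_iff[of i j k] assms(3) ij k by auto
  have bl: "\<exists>c. \<not> straight c i k j" "\<exists>c. \<not> straight c j k i"
  proof -
    have "{i, k} \<noteq> \<pi>" "{j, k} \<noteq> \<pi>" using ij k by (auto simp: doubleton_eq_iff)
    then have "blocked m S {i, k}" "blocked m S {j, k}" using assms(4) PP_iff k by blast+
    then show "\<exists>c. \<not> straight c i k j" "\<exists>c. \<not> straight c j k i"
      using not_blocked_iff[of i k j] not_blocked_iff[of j k i] ij k by auto
  qed
  have inf: "arc_length (curve c p k) = \<infinity>" "arc_length (curve c k p) = \<infinity>" if "p \<in> {i, j}" for c p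
  proof -
    have "inner_length c p k = \<infinity>" using inner_length_infinite[OF ij(2) _ _ str bl that] k by auto
    then show "arc_length (curve c p k) = \<infinity>" using inner_length_le[of c p k] by (simp add: top_unique)
    moreover have "p \<noteq> k" using that k by auto
    ultimately show "arc_length (curve c k p) = \<infinity>" using curve_sym by simp
  qed
  show ?thesis
  proof (intro conjI allI impI ballI)
    fix p q assume "{p, q} = \<pi>"
    then have pq: "p = i \<and> q = j \<or> p = j \<and> q = i" using ij by (auto simp: doubleton_eq_iff)
    have "arc_length (curve c p q) < \<infinity>" for c
      using arc_length_finite[of i j k c] str pq ij k curve_sym[of i j c] by auto
    then show "arc_length (white_arc m S p q) < \<infinity>" "arc_length (yellow_arc m S p q) < \<infinity>"
      using pq ij(2) by (auto simp: arcs_eq)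
  next
    fix \<pi>' p q assume "\<pi>' \<in> PP - {\<pi>}" "{p, q} = \<pi>'"
    then have pq: "p \<noteq> q" "{p, q} \<noteq> {i, j}" using PP_iff ij by auto
    then have "p \<in> {i, j} \<and> q = k \<or> p = k \<and> q \<in> {i, j}"
      using three_cases[of i j k p] three_cases[of i j k q] ij(2) k by auto
    then have "arc_length (curve c p q) = \<infinity>" for c using inf by auto
    then show "arc_length (white_arc m S p q) = \<infinity>" "arc_length (yellow_arc m S p q) = \<infinity>"
      using pq(1) by (auto simp: arcs_eq)
  qed
qed

end
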